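(* Let $(M^{3},\varphi,\xi,\eta,g)$ be a three-dimensional para-Sasakian manifold with scalar curvature $r$, and suppose that $g$ is a Yamabe soliton, i.e. there are a vector field $V$ on $M$ and a real number $\lambda$ with $\mathcal{L}_V g=(\lambda-r)g$. Then $r$ is constant and the vector field $V$ is Killing ($\mathcal{L}_Vg=0$). Furthermore, either $(M,g)$ has constant curvature $-1$ and is an Einstein manifold, or $V$ is an infinitesimal automorphism of the paracontact metric structure $(\varphi,\xi,\eta,g)$.
   Context: All manifolds are smooth and connected. An almost paracontact structure on a $(2n+1)$-dimensional manifold $M$ consists of a $(1,1)$-tensor field $\varphi$, a vector field $\xi$ and a $1$-form $\eta$ with $\eta(\xi)=1$, $\varphi^2=I-\eta\otimes\xi$, such that the $\pm1$-eigendistributions of $\varphi$ restricted to $\ker\eta$ both have dimension $n$ (so $\varphi\xi=0$, $\eta\circ\varphi=0$). It is an almost paracontact metric manifold if equipped with a semi-Riemannian metric $g$ with $g(\varphi X,\varphi Y)=-g(X,Y)+\eta(X)\eta(Y)$ for all $X,Y$. Its fundamental $2$-form is $\Phi(X,Y)=g(X,\varphi Y)$. It is normal if $[\varphi,\varphi]-2d\eta\otimes\xi=0$, where $[\varphi,\varphi](X,Y)=\varphi^2[X,Y]+[\varphi X,\varphi Y]-\varphi[\varphi X,Y]-\varphi[X,\varphi Y]$, and it is a paracontact metric manifold if $d\eta=\Phi$; here $2\,d\eta(X,Y)=X\eta(Y)-Y\eta(X)-\eta([X,Y])$. A para-Sasakian manifold is a normal paracontact metric manifold; with these conventions it satisfies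 $\nabla_X\xi=-\varphi X$ and $(\nabla_X\varphi)Y=-g(X,Y)\xi+\eta(Y)X$, where $\nabla$ is the Levi-Civita connection. Curvature convention: $R(X,Y)Z=\nabla_X\nabla_YZ-\nabla_Y\nabla_XZ-\nabla_{[X,Y]}Z$, the Ricci tensor is $S(X,Y)=\operatorname{trace}\{Z\mapsto R(Z,X)Y\}$, and the scalar curvature $r$ is the $g$-trace of $S$. $(M,g)$ has constant curvature $c$ if its sectional curvature is constantly $c$, i.e. $R(X,Y)Z=c\,(g(Y,Z)X-g(X,Z)Y)$. Einstein means $S$ is a constant multiple of $g$. $V$ is an infinitesimal automorphism of $(\varphi,\xi,\eta,g)$ if $\mathcal{L}_V\eta=0$, $\mathcal{L}_V\xi=0$, $\mathcal{L}_V\Phi=0$ and $\mathcal{L}_Vg=0$, where $\mathcal{L}$ is the Lie derivative. *)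

theory Defs
  imports "HOL-Analysis.Analysis" "HOL-Library.Function_Algebras"
begin

text \<open>Pointwise real vector space structure on functions; it is needed because tangent vectors
  are represented as functionals on real-valued functions.\<close>

instantiation "fun" :: (type, real_vector) real_vector
begin

definition scaleR_fun :: "real \<Rightarrow> ('a \<Rightarrow> 'b) \<Rightarrow> 'a \<Rightarrow> 'b" where
  "scaleR_fun c f = (\<lambda>x. c *\<^sub>R f x)"

instance
  by standard (simp_all add: scaleR_fun_def plus_fun_def fun_eq_iff algebra_simps)

end


section \<open>Smooth manifolds\<close>

primrec Ck_on :: "nat \<Rightarrow> 'e::euclidean_space set \<Rightarrow> ('e \<Rightarrow> 'f::real_normed_vector) \<Rightarrow> bool" where
  "Ck_on 0 S f \<longleftrightarrow> continuous_on S f"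
| "Ck_on (Suc k) S f \<longleftrightarrow>
     (\<forall>x\<in>S. f differentiable (at x)) \<and> (\<forall>v. Ck_on k S (\<lambda>x. frechet_derivative f (at x) v))"

text \<open>Only meaningful for open \<open>S\<close>.\<close>

definition smooth_on :: "'e::euclidean_space set \<Rightarrow> ('e \<Rightarrow> 'f::real_normed_vector) \<Rightarrow> bool" where
  "smooth_on S f \<longleftrightarrow> (\<forall>k. Ck_on k S f)"

text \<open>A chart is a pair of a domain and a map; the values of the map outside its domain are
  irrelevant. The underlying set of the manifold is the whole type.\<close>

type_synonym ('a, 'e) atlas = "('a set \<times> ('a \<Rightarrow> 'e)) set"

definition smooth_atlas ::
  "('a::{t2_space,second_countable_topology}, 'e::euclidean_space) atlas \<Rightarrow> bool" where
  "smooth_atlas A \<longleftrightarrow>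
     (\<Union>(U, c)\<in>A. U) = UNIV \<and>
     (\<forall>(U, c)\<in>A. open U \<and> open (c ` U) \<and> homeomorphism U (c ` U) c (inv_into U c)) \<and>
     (\<forall>(U, c)\<in>A. \<forall>(W, d)\<in>A. smooth_on (c ` (U \<inter> W)) (d \<circ> inv_into U c))"

definition connected_manifold ::
  "('a::{t2_space,second_countable_topology}, 'e::euclidean_space) atlas \<Rightarrow> bool" where
  "connected_manifold A \<longleftrightarrow> smooth_atlas A \<and> connected (UNIV :: 'a set)"

definition smooth_fun ::
  "('a::topological_space, 'e::euclidean_space) atlas \<Rightarrow> 'a set \<Rightarrow> ('a \<Rightarrow> real) \<Rightarrow> bool" where
  "smooth_fun A W f \<longleftrightarrow> (\<forall>(U, c)\<in>A. smooth_on (c ` (U \<inter> W)) (f \<circ> inv_into U c))"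

definition smooth_near ::
  "('a::topological_space, 'e::euclidean_space) atlas \<Rightarrow> 'a \<Rightarrow> ('a \<Rightarrow> real) \<Rightarrow> bool" where
  "smooth_near A p f \<longleftrightarrow> (\<exists>W. open W \<and> p \<in> W \<and> smooth_fun A W f)"


section \<open>Tangent vectors and vector fields\<close>

type_synonym 'a tvec = "('a \<Rightarrow> real) \<Rightarrow> real"
type_synonym 'a vfield = "'a \<Rightarrow> 'a tvec"

text \<open>Tangent vectors are derivations at \<open>p\<close> of the functions that are smooth near \<open>p\<close>. Such a
  derivation depends only on the germ of the function: if \<open>h\<close> vanishes near \<open>p\<close>, then \<open>h = h \<cdot> k\<close>
  with \<open>k\<close> the indicator function of the complement of a neighbourhood of \<open>p\<close>, which is smooth
  near \<open>p\<close>. The last clause fixes the irrelevant values.\<close>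

definition tangent_space ::
  "('a::topological_space, 'e::euclidean_space) atlas \<Rightarrow> 'a \<Rightarrow> 'a tvec set" where
  "tangent_space A p = {v.
     (\<forall>f h. smooth_near A p f \<longrightarrow> smooth_near A p h \<longrightarrow> v (\<lambda>q. f q + h q) = v f + v h) \<and>
     (\<forall>a f. smooth_near A p f \<longrightarrow> v (\<lambda>q. a * f q) = a * v f) \<and>
     (\<forall>f h. smooth_near A p f \<longrightarrow> smooth_near A p h \<longrightarrow>
        v (\<lambda>q. f q * h q) = v f * h p + f p * v h) \<and>
     (\<forall>f. \<not> smooth_near A p f \<longrightarrow> v f = 0)}"

text \<open>Smooth vector fields on an open set \<open>U\<close>; the values outside \<open>U\<close> are irrelevant.
  Identities between tensor fields are stated below for local vector fields on all open sets
  \<open>U\<close>, which includes the global ones (\<open>U = UNIV\<close>).\<close>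

definition vector_field_on ::
  "('a::topological_space, 'e::euclidean_space) atlas \<Rightarrow> 'a set \<Rightarrow> 'a vfield \<Rightarrow> bool" where
  "vector_field_on A U X \<longleftrightarrow>
     (\<forall>p\<in>U. X p \<in> tangent_space A p) \<and>
     (\<forall>W f. open W \<longrightarrow> W \<subseteq> U \<longrightarrow> smooth_fun A W f \<longrightarrow> smooth_fun A W (\<lambda>p. X p f))"

definition lie_bracket ::
  "('a::topological_space, 'e::euclidean_space) atlas \<Rightarrow> 'a vfield \<Rightarrow> 'a vfield \<Rightarrow> 'a vfield" where
  "lie_bracket A X Y = (\<lambda>p f.
     if smooth_near A p f then X p (\<lambda>q. Y q f) - Y p (\<lambda>q. X q f) else 0)"


section \<open>Tensor fields\<close>

definition linear_within :: "'v::real_vector set \<Rightarrow> ('v \<Rightarrow> 'w::real_vector) \<Rightarrow> bool" where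
  "linear_within T L \<longleftrightarrow>
     (\<forall>x\<in>T. \<forall>y\<in>T. L (x + y) = L x + L y) \<and> (\<forall>a. \<forall>x\<in>T. L (a *\<^sub>R x) = a *\<^sub>R L x)"

definition one_form ::
  "('a::topological_space, 'e::euclidean_space) atlas \<Rightarrow> ('a \<Rightarrow> 'a tvec \<Rightarrow> real) \<Rightarrow> bool" where
  "one_form A \<omega> \<longleftrightarrow>
     (\<forall>p. linear_within (tangent_space A p) (\<omega> p)) \<and>
     (\<forall>U X. open U \<longrightarrow> vector_field_on A U X \<longrightarrow> smooth_fun A U (\<lambda>p. \<omega> p (X p)))"

definition endo_field ::
  "('a::topological_space, 'e::euclidean_space) atlas \<Rightarrow> ('a \<Rightarrow> 'a tvec \<Rightarrow> 'a tvec) \<Rightarrow> bool" where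
  "endo_field A \<phi> \<longleftrightarrow>
     (\<forall>p. linear_within (tangent_space A p) (\<phi> p) \<and> \<phi> p ` tangent_space A p \<subseteq> tangent_space A p) \<and>
     (\<forall>U X. open U \<longrightarrow> vector_field_on A U X \<longrightarrow> vector_field_on A U (\<lambda>p. \<phi> p (X p)))"

definition bilinear_field ::
  "('a::topological_space, 'e::euclidean_space) atlas \<Rightarrow> ('a \<Rightarrow> 'a tvec \<Rightarrow> 'a tvec \<Rightarrow> real) \<Rightarrow> bool"
  where
  "bilinear_field A T \<longleftrightarrow>
     (\<forall>p. \<forall>x\<in>tangent_space A p.
        linear_within (tangent_space A p) (\<lambda>y. T p x y) \<and>
        linear_within (tangent_space A p) (\<lambda>y. T p y x)) \<and>
     (\<forall>U X Y. open U \<longrightarrow> vector_field_on A U X \<longrightarrow> vector_field_on A U Y \<longrightarrow>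
        smooth_fun A U (\<lambda>p. T p (X p) (Y p)))"

text \<open>The index of a nondegenerate symmetric form is locally constant, hence constant on a
  connected manifold, so it needs no separate condition.\<close>

definition semi_riemannian_metric ::
  "('a::topological_space, 'e::euclidean_space) atlas \<Rightarrow> ('a \<Rightarrow> 'a tvec \<Rightarrow> 'a tvec \<Rightarrow> real) \<Rightarrow> bool"
  where
  "semi_riemannian_metric A g \<longleftrightarrow>
     bilinear_field A g \<and>
     (\<forall>p. \<forall>x\<in>tangent_space A p. \<forall>y\<in>tangent_space A p. g p x y = g p y x) \<and>
     (\<forall>p. \<forall>x\<in>tangent_space A p. (\<forall>y\<in>tangent_space A p. g p x y = 0) \<longrightarrow> x = 0)"

text \<open>The exterior derivative is normalised by
  \<open>2 d\<eta>(X,Y) = X \<eta>(Y) - Y \<eta>(X) - \<eta>([X,Y])\<close>.\<close>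

definition ext_deriv ::
  "('a::topological_space, 'e::euclidean_space) atlas \<Rightarrow> ('a \<Rightarrow> 'a tvec \<Rightarrow> real)
     \<Rightarrow> 'a vfield \<Rightarrow> 'a vfield \<Rightarrow> 'a \<Rightarrow> real" where
  "ext_deriv A \<eta> X Y p =
     (X p (\<lambda>q. \<eta> q (Y q)) - Y p (\<lambda>q. \<eta> q (X q)) - \<eta> p (lie_bracket A X Y p)) / 2"

definition lie_deriv1 ::
  "('a::topological_space, 'e::euclidean_space) atlas \<Rightarrow> 'a vfield \<Rightarrow> ('a \<Rightarrow> 'a tvec \<Rightarrow> real)
     \<Rightarrow> 'a vfield \<Rightarrow> 'a \<Rightarrow> real" where
  "lie_deriv1 A V \<omega> X p = V p (\<lambda>q. \<omega> q (X q)) - \<omega> p (lie_bracket A V X p)"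

definition lie_deriv2 ::
  "('a::topological_space, 'e::euclidean_space) atlas \<Rightarrow> 'a vfield
     \<Rightarrow> ('a \<Rightarrow> 'a tvec \<Rightarrow> 'a tvec \<Rightarrow> real) \<Rightarrow> 'a vfield \<Rightarrow> 'a vfield \<Rightarrow> 'a \<Rightarrow> real" where
  "lie_deriv2 A V T X Y p =
     V p (\<lambda>q. T q (X q) (Y q)) - T p (lie_bracket A V X p) (Y p) - T p (X p) (lie_bracket A V Y p)"


section \<open>Levi-Civita connection and curvature\<close>

text \<open>Connections act on vector fields over arbitrary open sets, compatibly with restriction.
  Every connection on global vector fields extends uniquely to one of this kind.\<close>

definition affine_connection ::
  "('a::topological_space, 'e::euclidean_space) atlas \<Rightarrow> ('a vfield \<Rightarrow> 'a vfield \<Rightarrow> 'a vfield) \<Rightarrow> bool"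
  where
  "affine_connection A D \<longleftrightarrow>
     (\<forall>U X Y. open U \<longrightarrow> vector_field_on A U X \<longrightarrow> vector_field_on A U Y \<longrightarrow>
        vector_field_on A U (D X Y) \<and>
        (\<forall>X' Y'. vector_field_on A U X' \<longrightarrow> vector_field_on A U Y' \<longrightarrow>
           (\<forall>p\<in>U. X' p = X p) \<longrightarrow> (\<forall>p\<in>U. Y' p = Y p) \<longrightarrow> (\<forall>p\<in>U. D X' Y' p = D X Y p)) \<and>
        (\<forall>Z. vector_field_on A U Z \<longrightarrow>
           (\<forall>p\<in>U. D (\<lambda>q. X q + Z q) Y p = D X Y p + D Z Y p \<and>
                  D X (\<lambda>q. Y q + Z q) p = D X Y p + D X Z p)) \<and>
        (\<forall>f. smooth_fun A U f \<longrightarrow>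
           (\<forall>p\<in>U. D (\<lambda>q. f q *\<^sub>R X q) Y p = f p *\<^sub>R D X Y p \<and>
                  D X (\<lambda>q. f q *\<^sub>R Y q) p = X p f *\<^sub>R Y p + f p *\<^sub>R D X Y p)))"

definition levi_civita ::
  "('a::topological_space, 'e::euclidean_space) atlas \<Rightarrow> ('a \<Rightarrow> 'a tvec \<Rightarrow> 'a tvec \<Rightarrow> real)
     \<Rightarrow> ('a vfield \<Rightarrow> 'a vfield \<Rightarrow> 'a vfield) \<Rightarrow> bool" where
  "levi_civita A g D \<longleftrightarrow>
     affine_connection A D \<and>
     (\<forall>U X Y. open U \<longrightarrow> vector_field_on A U X \<longrightarrow> vector_field_on A U Y \<longrightarrow>
        (\<forall>p\<in>U. D X Y p - D Y X p = lie_bracket A X Y p)) \<and>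
     (\<forall>U X Y Z. open U \<longrightarrow> vector_field_on A U X \<longrightarrow> vector_field_on A U Y \<longrightarrow> vector_field_on A U Z \<longrightarrow>
        (\<forall>p\<in>U. X p (\<lambda>q. g q (Y q) (Z q)) = g p (D X Y p) (Z p) + g p (Y p) (D X Z p)))"

definition curvature ::
  "('a::topological_space, 'e::euclidean_space) atlas \<Rightarrow> ('a vfield \<Rightarrow> 'a vfield \<Rightarrow> 'a vfield)
     \<Rightarrow> 'a vfield \<Rightarrow> 'a vfield \<Rightarrow> 'a vfield \<Rightarrow> 'a vfield" where
  "curvature A D X Y Z p =
     D X (D Y Z) p - D Y (D X Z) p - D (lie_bracket A X Y) Z p"

text \<open>The value of the curvature on tangent vectors, well defined because the curvature is
  tensorial and every tangent vector extends to a local vector field.\<close>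

definition curvature_at ::
  "('a::topological_space, 'e::euclidean_space) atlas \<Rightarrow> ('a vfield \<Rightarrow> 'a vfield \<Rightarrow> 'a vfield)
     \<Rightarrow> 'a \<Rightarrow> 'a tvec \<Rightarrow> 'a tvec \<Rightarrow> 'a tvec \<Rightarrow> 'a tvec" where
  "curvature_at A D p x y z = (THE w. \<forall>U X Y Z.
     open U \<longrightarrow> p \<in> U \<longrightarrow> vector_field_on A U X \<longrightarrow> vector_field_on A U Y \<longrightarrow> vector_field_on A U Z \<longrightarrow>
     X p = x \<longrightarrow> Y p = y \<longrightarrow> Z p = z \<longrightarrow> curvature A D X Y Z p = w)"

text \<open>Trace of an endomorphism \<open>L\<close> of a finite-dimensional subspace \<open>T\<close>.\<close>

definition trace_on :: "'v::real_vector set \<Rightarrow> ('v \<Rightarrow> 'v) \<Rightarrow> real" where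
  "trace_on T L =
     (let B = (SOME B. B \<subseteq> T \<and> independent B \<and> span B = T)
      in \<Sum>b\<in>B. representation B (L b) b)"

definition ricci ::
  "('a::topological_space, 'e::euclidean_space) atlas \<Rightarrow> ('a vfield \<Rightarrow> 'a vfield \<Rightarrow> 'a vfield)
     \<Rightarrow> 'a \<Rightarrow> 'a tvec \<Rightarrow> 'a tvec \<Rightarrow> real" where
  "ricci A D p x y = trace_on (tangent_space A p) (\<lambda>z. curvature_at A D p z x y)"

text \<open>The \<open>g\<close>-trace of the Ricci tensor \<open>S\<close> is the trace of the operator \<open>Q\<close> given by
  \<open>g(Qx,y) = S(x,y)\<close>.\<close>

definition scalar_curvature ::
  "('a::topological_space, 'e::euclidean_space) atlas \<Rightarrow> ('a \<Rightarrow> 'a tvec \<Rightarrow> 'a tvec \<Rightarrow> real)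
     \<Rightarrow> ('a vfield \<Rightarrow> 'a vfield \<Rightarrow> 'a vfield) \<Rightarrow> 'a \<Rightarrow> real" where
  "scalar_curvature A g D p = trace_on (tangent_space A p)
     (\<lambda>x. THE q. q \<in> tangent_space A p \<and> (\<forall>y\<in>tangent_space A p. g p q y = ricci A D p x y))"

definition constant_curvature ::
  "('a::topological_space, 'e::euclidean_space) atlas \<Rightarrow> ('a \<Rightarrow> 'a tvec \<Rightarrow> 'a tvec \<Rightarrow> real)
     \<Rightarrow> ('a vfield \<Rightarrow> 'a vfield \<Rightarrow> 'a vfield) \<Rightarrow> real \<Rightarrow> bool" where
  "constant_curvature A g D k \<longleftrightarrow>
     (\<forall>U X Y Z. open U \<longrightarrow> vector_field_on A U X \<longrightarrow> vector_field_on A U Y \<longrightarrow> vector_field_on A U Z \<longrightarrow>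
        (\<forall>p\<in>U. curvature A D X Y Z p =
           k *\<^sub>R (g p (Y p) (Z p) *\<^sub>R X p - g p (X p) (Z p) *\<^sub>R Y p)))"

definition einstein_manifold ::
  "('a::topological_space, 'e::euclidean_space) atlas \<Rightarrow> ('a \<Rightarrow> 'a tvec \<Rightarrow> 'a tvec \<Rightarrow> real)
     \<Rightarrow> ('a vfield \<Rightarrow> 'a vfield \<Rightarrow> 'a vfield) \<Rightarrow> bool" where
  "einstein_manifold A g D \<longleftrightarrow>
     (\<exists>k. \<forall>p. \<forall>x\<in>tangent_space A p. \<forall>y\<in>tangent_space A p. ricci A D p x y = k * g p x y)"


section \<open>Almost paracontact structures\<close>

definition almost_paracontact ::
  "('a::topological_space, 'e::euclidean_space) atlas \<Rightarrow> ('a \<Rightarrow> 'a tvec \<Rightarrow> 'a tvec)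
     \<Rightarrow> 'a vfield \<Rightarrow> ('a \<Rightarrow> 'a tvec \<Rightarrow> real) \<Rightarrow> bool" where
  "almost_paracontact A \<phi> \<xi> \<eta> \<longleftrightarrow>
     endo_field A \<phi> \<and> vector_field_on A UNIV \<xi> \<and> one_form A \<eta> \<and>
     (\<forall>p. \<eta> p (\<xi> p) = 1) \<and>
     (\<forall>p. \<forall>x\<in>tangent_space A p. \<phi> p (\<phi> p x) = x - \<eta> p x *\<^sub>R \<xi> p) \<and>
     (\<exists>n. DIM('e) = 2 * n + 1 \<and>
        (\<forall>p. dim {x \<in> tangent_space A p. \<eta> p x = 0 \<and> \<phi> p x = x} = n \<and>
             dim {x \<in> tangent_space A p. \<eta> p x = 0 \<and> \<phi> p x = - x} = n))"

definition almost_paracontact_metric ::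
  "('a::topological_space, 'e::euclidean_space) atlas \<Rightarrow> ('a \<Rightarrow> 'a tvec \<Rightarrow> 'a tvec)
     \<Rightarrow> 'a vfield \<Rightarrow> ('a \<Rightarrow> 'a tvec \<Rightarrow> real) \<Rightarrow> ('a \<Rightarrow> 'a tvec \<Rightarrow> 'a tvec \<Rightarrow> real) \<Rightarrow> bool" where
  "almost_paracontact_metric A \<phi> \<xi> \<eta> g \<longleftrightarrow>
     almost_paracontact A \<phi> \<xi> \<eta> \<and> semi_riemannian_metric A g \<and>
     (\<forall>p. \<forall>x\<in>tangent_space A p. \<forall>y\<in>tangent_space A p.
        g p (\<phi> p x) (\<phi> p y) = - g p x y + \<eta> p x * \<eta> p y)"

definition fundamental_form ::
  "('a \<Rightarrow> 'a tvec \<Rightarrow> 'a tvec) \<Rightarrow> ('a \<Rightarrow> 'a tvec \<Rightarrow> 'a tvec \<Rightarrow> real)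
     \<Rightarrow> 'a \<Rightarrow> 'a tvec \<Rightarrow> 'a tvec \<Rightarrow> real" where
  "fundamental_form \<phi> g p x y = g p x (\<phi> p y)"

definition nijenhuis ::
  "('a::topological_space, 'e::euclidean_space) atlas \<Rightarrow> ('a \<Rightarrow> 'a tvec \<Rightarrow> 'a tvec)
     \<Rightarrow> 'a vfield \<Rightarrow> 'a vfield \<Rightarrow> 'a vfield" where
  "nijenhuis A \<phi> X Y p =
     \<phi> p (\<phi> p (lie_bracket A X Y p))
     + lie_bracket A (\<lambda>q. \<phi> q (X q)) (\<lambda>q. \<phi> q (Y q)) p
     - \<phi> p (lie_bracket A (\<lambda>q. \<phi> q (X q)) Y p)
     - \<phi> p (lie_bracket A X (\<lambda>q. \<phi> q (Y q)) p)"

definition normal_structure ::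
  "('a::topological_space, 'e::euclidean_space) atlas \<Rightarrow> ('a \<Rightarrow> 'a tvec \<Rightarrow> 'a tvec)
     \<Rightarrow> 'a vfield \<Rightarrow> ('a \<Rightarrow> 'a tvec \<Rightarrow> real) \<Rightarrow> bool" where
  "normal_structure A \<phi> \<xi> \<eta> \<longleftrightarrow>
     (\<forall>U X Y. open U \<longrightarrow> vector_field_on A U X \<longrightarrow> vector_field_on A U Y \<longrightarrow>
        (\<forall>p\<in>U. nijenhuis A \<phi> X Y p - (2 * ext_deriv A \<eta> X Y p) *\<^sub>R \<xi> p = 0))"

definition paracontact_metric ::
  "('a::topological_space, 'e::euclidean_space) atlas \<Rightarrow> ('a \<Rightarrow> 'a tvec \<Rightarrow> 'a tvec)
     \<Rightarrow> 'a vfield \<Rightarrow> ('a \<Rightarrow> 'a tvec \<Rightarrow> real) \<Rightarrow> ('a \<Rightarrow> 'a tvec \<Rightarrow> 'a tvec \<Rightarrow> real) \<Rightarrow> bool" where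
  "paracontact_metric A \<phi> \<xi> \<eta> g \<longleftrightarrow>
     almost_paracontact_metric A \<phi> \<xi> \<eta> g \<and>
     (\<forall>U X Y. open U \<longrightarrow> vector_field_on A U X \<longrightarrow> vector_field_on A U Y \<longrightarrow>
        (\<forall>p\<in>U. ext_deriv A \<eta> X Y p = fundamental_form \<phi> g p (X p) (Y p)))"

definition para_sasakian ::
  "('a::topological_space, 'e::euclidean_space) atlas \<Rightarrow> ('a \<Rightarrow> 'a tvec \<Rightarrow> 'a tvec)
     \<Rightarrow> 'a vfield \<Rightarrow> ('a \<Rightarrow> 'a tvec \<Rightarrow> real) \<Rightarrow> ('a \<Rightarrow> 'a tvec \<Rightarrow> 'a tvec \<Rightarrow> real) \<Rightarrow> bool" where
  "para_sasakian A \<phi> \<xi> \<eta> g \<longleftrightarrow> paracontact_metric A \<phi> \<xi> \<eta> g \<and> normal_structure A \<phi> \<xi> \<eta>"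


section \<open>Yamabe solitons, Killing fields and infinitesimal automorphisms\<close>

definition yamabe_soliton ::
  "('a::topological_space, 'e::euclidean_space) atlas \<Rightarrow> ('a \<Rightarrow> 'a tvec \<Rightarrow> 'a tvec \<Rightarrow> real)
     \<Rightarrow> ('a \<Rightarrow> real) \<Rightarrow> 'a vfield \<Rightarrow> real \<Rightarrow> bool" where
  "yamabe_soliton A g r V l \<longleftrightarrow>
     vector_field_on A UNIV V \<and>
     (\<forall>U X Y. open U \<longrightarrow> vector_field_on A U X \<longrightarrow> vector_field_on A U Y \<longrightarrow>
        (\<forall>p\<in>U. lie_deriv2 A V g X Y p = (l - r p) * g p (X p) (Y p)))"

definition lie_deriv2_vanishes ::
  "('a::topological_space, 'e::euclidean_space) atlas \<Rightarrow> 'a vfield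
     \<Rightarrow> ('a \<Rightarrow> 'a tvec \<Rightarrow> 'a tvec \<Rightarrow> real) \<Rightarrow> bool" where
  "lie_deriv2_vanishes A V T \<longleftrightarrow>
     (\<forall>U X Y. open U \<longrightarrow> vector_field_on A U X \<longrightarrow> vector_field_on A U Y \<longrightarrow>
        (\<forall>p\<in>U. lie_deriv2 A V T X Y p = 0))"

definition killing_field ::
  "('a::topological_space, 'e::euclidean_space) atlas \<Rightarrow> ('a \<Rightarrow> 'a tvec \<Rightarrow> 'a tvec \<Rightarrow> real)
     \<Rightarrow> 'a vfield \<Rightarrow> bool" where
  "killing_field A g V \<longleftrightarrow> vector_field_on A UNIV V \<and> lie_deriv2_vanishes A V g"

definition infinitesimal_automorphism ::
  "('a::topological_space, 'e::euclidean_space) atlas \<Rightarrow> ('a \<Rightarrow> 'a tvec \<Rightarrow> 'a tvec)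
     \<Rightarrow> 'a vfield \<Rightarrow> ('a \<Rightarrow> 'a tvec \<Rightarrow> real) \<Rightarrow> ('a \<Rightarrow> 'a tvec \<Rightarrow> 'a tvec \<Rightarrow> real)
     \<Rightarrow> 'a vfield \<Rightarrow> bool" where
  "infinitesimal_automorphism A \<phi> \<xi> \<eta> g V \<longleftrightarrow>
     vector_field_on A UNIV V \<and>
     (\<forall>U X. open U \<longrightarrow> vector_field_on A U X \<longrightarrow> (\<forall>p\<in>U. lie_deriv1 A V \<eta> X p = 0)) \<and>
     (\<forall>p. lie_bracket A V \<xi> p = 0) \<and>
     lie_deriv2_vanishes A V (fundamental_form \<phi> g) \<and>
     lie_deriv2_vanishes A V g"

end

theory Submission
  imports Defs
begin

text \<open>Locally there is a frame \<open>\<xi>, e1, e2\<close> with \<open>\<phi> e1 = e1\<close>, \<open>\<phi> e2 = - e2\<close>, null \<open>e1, e2\<close> and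
  \<open>g(e1, e2) = 1\<close>; the axioms and the Jacobi identity give
  \<open>[\<xi>, e1] = a e1\<close>, \<open>[\<xi>, e2] = - a e2\<close>, \<open>[e1, e2] = 2 \<xi> + \<beta> e1 - \<alpha> e2\<close>. All curvature is expressed by
  one function \<open>\<kappa>\<close> with \<open>\<xi> \<kappa> = 0\<close> and \<open>r = 2 \<kappa> - 4\<close>. For a soliton field \<open>V\<close>, with
  \<open>\<rho> = (\<lambda> - r) / 2\<close>, the field \<open>[\<xi>, V]\<close> is Killing because \<open>\<xi>\<close> is and \<open>\<xi> \<rho> = 0\<close>. Comparing the components of
  \<open>V\<close> and \<open>[\<xi>, V]\<close> yields for \<open>p = e1 \<rho>\<close> the closed system \<open>e1 p = \<alpha> p\<close>, \<open>e2 p = 2 \<rho> - \<beta> p\<close>,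
  \<open>\<xi> p = a p\<close>, whose integrability condition is \<open>p (\<kappa> - 1) = 0\<close>. Differentiating along \<open>e1\<close>
  gives \<open>p\<^sup>2 = 0\<close>, hence \<open>\<rho> = 0\<close>. The same integrability argument for the components of
  \<open>[\<xi>, V]\<close> shows \<open>(\<kappa> + 1) [\<xi>, V] = 0\<close>, which is the dichotomy.\<close>

section \<open>Smooth functions on open sets\<close>

text \<open>The conformal equation prescribes only some first derivatives of the components of
  \<open>V\<close>, and \<rho> enters it without derivatives, so the system does not close by
  itself. Bracketing with \<xi> is what helps: the \<xi>-component of [\<xi>, V] is the
  \<xi>-derivative of that of \<open>V\<close>, which is \<rho>. Thus \<rho> is itself a component
  of a Killing field, and its slopes along \<open>e1\<close> and \<open>e2\<close> are read off from
  [\<xi>, V] and [\<xi>, [\<xi>, V]]. The equation \<rho> = const - \<kappa> is then used once more,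
  as \<open>e1\<close> \<kappa> = - p: it makes the linear integrability condition quadratic when
  that is differentiated.

  \<kappa> is the sectional curvature of the plane field ker \<eta>, while nondegenerate planes
  containing \<xi> have curvature -1; hence r = 2 (\<kappa> - 1 - 1), and constant curvature -1
  means \<kappa> = -1, that is r = -6.

  Frames exist only locally, but the local conclusion r = \<lambda> names the same number
  everywhere. So \<kappa> has one value on the whole manifold, and the dichotomy is global, not
  merely pointwise.\<close>

lemma frechet_derivative_cong_open:
  assumes "open S" "x \<in> S" "\<And>y. y \<in> S \<Longrightarrow> f y = g y"
  shows "frechet_derivative f (at x) = frechet_derivative g (at x)"
proof -
  \<comment> \<open>\<open>frechet_derivative\<close> chooses among all derivatives; both functions
    have the same ones, so the choices agree even where neither function is differentiable.\<close>
  have "(f has_derivative F) (at x) \<longleftrightarrow> (g has_derivative F) (at x)" for F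
    using has_derivative_transform_within_open[OF _ assms(1,2), of f F UNIV g]
      has_derivative_transform_within_open[OF _ assms(1,2), of g F UNIV f] assms(3) by auto
  then show ?thesis by (simp add: frechet_derivative_def)
qed

lemma Ck_on_cong:
  assumes "open S" "\<And>y. y \<in> S \<Longrightarrow> f y = g y" "Ck_on k S f"
  shows "Ck_on k S g"
  using assms(2,3)
proof (induction k arbitrary: f g)
  case 0
  then show ?case using continuous_on_cong[of S S f g] by simp
next
  case (Suc k)
  have "g differentiable (at x)" if x: "x \<in> S" for x
  proof -
    from Suc.prems(2) x obtain F where "(f has_derivative F) (at x)"
      by (auto simp: differentiable_def)
    then have "(g has_derivative F) (at x)"
      by (rule has_derivative_transform_within_open[OF _ assms(1) x Suc.prems(1)])
    then show ?thesis by (rule differentiableI)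
  qed
  moreover have "Ck_on k S (\<lambda>x. frechet_derivative g (at x) v)" for v
    by (rule Suc.IH[of "\<lambda>x. frechet_derivative f (at x) v"])
      (use frechet_derivative_cong_open[OF assms(1) _ Suc.prems(1)] Suc.prems(2) in simp_all)
  ultimately show ?case by simp
qed

lemma Ck_on_subset: "Ck_on k S f \<Longrightarrow> T \<subseteq> S \<Longrightarrow> Ck_on k T f"
  by (induction k arbitrary: f) (auto intro: continuous_on_subset)

lemma Ck_on_pred: "Ck_on (Suc k) S f \<Longrightarrow> Ck_on k S f"
proof (induction k arbitrary: f)
  case 0
  then show ?case
    by (auto intro!: continuous_at_imp_continuous_on differentiable_imp_continuous_within)
next
  case (Suc k)
  note * = Suc.prems[unfolded Ck_on.simps(2)[of "Suc k"]]
  have "Ck_on k S (\<lambda>x. frechet_derivative f (at x) v)" for v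
    using * by (intro Suc.IH) blast
  with * show ?case by (simp only: Ck_on.simps(2)) blast
qed

text \<open>Lets an explicit derivative replace the chosen \<open>frechet_derivative\<close>. The
  closure properties below are inductions on \<open>k\<close> that apply this rule to the relevant
  differentiation formula.\<close>

lemma Ck_on_derivative:
  assumes "open S" "\<And>x. x \<in> S \<Longrightarrow> (f has_derivative f' x) (at x)"
    and "\<And>v. Ck_on k S (\<lambda>x. f' x v)"
  shows "Ck_on (Suc k) S f"
proof -
  have "f' x v = frechet_derivative f (at x) v" if "x \<in> S" for x v
    by (rule fun_cong[OF frechet_derivative_at[OF assms(2)[OF that]]])
  then have "Ck_on k S (\<lambda>x. frechet_derivative f (at x) v)" for v
    by (rule Ck_on_cong[OF assms(1) _ assms(3)[of v]])
  then show ?thesis using differentiableI[OF assms(2)] by simp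
qed

lemma Ck_on_SucD:
  assumes "Ck_on (Suc k) S f"
  shows "x \<in> S \<Longrightarrow> (f has_derivative frechet_derivative f (at x)) (at x)"
    and "Ck_on k S (\<lambda>x. frechet_derivative f (at x) v)"
  using assms by (auto simp: frechet_derivative_works)

lemma Ck_on_const: "open S \<Longrightarrow> Ck_on k S (\<lambda>x. c)"
proof (induction k arbitrary: c)
  case (Suc k)
  show ?case
    by (rule Ck_on_derivative[OF Suc.prems has_derivative_const Suc.IH[OF Suc.prems]])
qed simp

lemma Ck_on_bounded_linear:
  assumes "bounded_linear L" "open S" "Ck_on k S f"
  shows "Ck_on k S (\<lambda>x. L (f x))"
  using assms(3)
proof (induction k arbitrary: f)
  case 0
  then show ?case
    using bounded_linear.continuous_on[OF assms(1)] by simp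
next
  case (Suc k)
  show ?case
    by (rule Ck_on_derivative[OF assms(2) bounded_linear.has_derivative[OF assms(1)]])
      (rule Ck_on_SucD(1)[OF Suc.prems] Suc.IH Ck_on_SucD(2)[OF Suc.prems] | assumption)+
qed

lemma Ck_on_add:
  assumes "open S" "Ck_on k S f" "Ck_on k S g"
  shows "Ck_on k S (\<lambda>x. f x + g x)"
  using assms(2,3)
proof (induction k arbitrary: f g)
  case 0
  then show ?case by (auto intro: continuous_on_add)
next
  case (Suc k)
  show ?case
    by (rule Ck_on_derivative[OF assms(1) has_derivative_add])
      (rule Ck_on_SucD(1)[OF Suc.prems(1)] Ck_on_SucD(1)[OF Suc.prems(2)]
        Suc.IH Ck_on_SucD(2)[OF Suc.prems(1)] Ck_on_SucD(2)[OF Suc.prems(2)] | assumption)+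
qed

lemma Ck_on_sum:
  assumes "open S" "finite I" "\<And>i. i \<in> I \<Longrightarrow> Ck_on k S (f i)"
  shows "Ck_on k S (\<lambda>x. \<Sum>i\<in>I. f i x)"
  using assms(2,3) by (induction I) (auto intro: Ck_on_const Ck_on_add assms(1))

lemma Ck_on_mult:
  fixes f g :: "'e::euclidean_space \<Rightarrow> real"
  assumes "open S" "Ck_on k S f" "Ck_on k S g"
  shows "Ck_on k S (\<lambda>x. f x * g x)"
  using assms(2,3)
proof (induction k arbitrary: f g)
  case 0
  then show ?case by (auto intro: continuous_on_mult)
next
  case (Suc k)
  show ?case
    by (rule Ck_on_derivative[OF assms(1) has_derivative_mult])
      (rule Ck_on_SucD(1)[OF Suc.prems(1)] Ck_on_SucD(1)[OF Suc.prems(2)] Ck_on_add[OF assms(1)]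
        Suc.IH Ck_on_pred[OF Suc.prems(1)] Ck_on_pred[OF Suc.prems(2)]
        Ck_on_SucD(2)[OF Suc.prems(1)] Ck_on_SucD(2)[OF Suc.prems(2)] | assumption)+
qed

text \<open>The derivative of 1/f is a product of 1/f, 1/f and a derivative of \<open>f\<close>, so
  the induction hypothesis for 1/f itself closes the step.\<close>

lemma Ck_on_inverse:
  fixes f :: "'e::euclidean_space \<Rightarrow> real"
  assumes "open S" "\<And>x. x \<in> S \<Longrightarrow> f x \<noteq> 0" "Ck_on k S f"
  shows "Ck_on k S (\<lambda>x. inverse (f x))"
  using assms(3)
proof (induction k)
  case 0
  then show ?case using assms(2) by (auto intro: continuous_on_inverse)
next
  case (Suc k)
  have i: "Ck_on k S (\<lambda>x. inverse (f x))"
    using Suc.IH Ck_on_pred[OF Suc.prems] .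
  show ?case
  proof (rule Ck_on_derivative[OF assms(1)])
    fix x assume x: "x \<in> S"
    show "((\<lambda>x. inverse (f x)) has_derivative
        (\<lambda>v. - (inverse (f x) * frechet_derivative f (at x) v * inverse (f x)))) (at x)"
      by (rule Deriv.has_derivative_inverse[OF assms(2)[OF x] Ck_on_SucD(1)[OF Suc.prems x]])
  next
    fix v
    have "Ck_on k S (\<lambda>x. (-1) * (inverse (f x) * frechet_derivative f (at x) v * inverse (f x)))"
      by (intro Ck_on_mult assms(1) Ck_on_const i Ck_on_SucD(2)[OF Suc.prems])
    then show "Ck_on k S (\<lambda>x. - (inverse (f x) * frechet_derivative f (at x) v * inverse (f x)))"
      by (simp only: mult_minus1)
  qed
qed

text \<open>The induction varies \<open>g\<close> and keeps \<open>h\<close>: the chain rule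
  produces partial derivatives of \<open>g\<close> composed with the same inner map.\<close>

lemma Ck_on_compose:
  fixes g :: "'f::euclidean_space \<Rightarrow> real" and h :: "'e::euclidean_space \<Rightarrow> 'f"
  assumes "open S" "h ` S \<subseteq> T" "Ck_on k S h" "Ck_on k T g"
  shows "Ck_on k S (\<lambda>x. g (h x))"
  using assms(3,4)
proof (induction k arbitrary: g)
  case 0
  then show ?case using assms(2) by (auto intro: continuous_on_compose2)
next
  case (Suc k)
  let ?Dh = "\<lambda>x. frechet_derivative h (at x)" and ?Dg = "\<lambda>y. frechet_derivative g (at y)"
  have dg: "(g has_derivative ?Dg (h x)) (at (h x))" if "x \<in> S" for x
    by (rule Ck_on_SucD(1)[OF Suc.prems(2)]) (use that assms(2) in blast)
  show ?case
  proof (rule Ck_on_derivative[OF assms(1)])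
    fix x assume x: "x \<in> S"
    have lin: "linear (?Dg (h x))"
      by (rule has_derivative_linear[OF dg[OF x]])
    \<comment> \<open>In the chain rule the direction fed to the derivative of \<open>g\<close>
      moves with \<open>x\<close>. Expanding it in the basis leaves a finite sum of products with
      fixed directions, to which the product and sum rules apply.\<close>
    have e: "(\<lambda>v. ?Dg (h x) (?Dh x v)) = (\<lambda>v. \<Sum>b\<in>Basis. (?Dh x v \<bullet> b) * ?Dg (h x) b)"
    proof
      fix v
      show "?Dg (h x) (?Dh x v) = (\<Sum>b\<in>Basis. (?Dh x v \<bullet> b) * ?Dg (h x) b)"
        using linear_sum[OF lin, of "\<lambda>b. (?Dh x v \<bullet> b) *\<^sub>R b" Basis]
        unfolding euclidean_representation linear_cmul[OF lin] real_scaleR_def .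
    qed
    show "((\<lambda>x. g (h x)) has_derivative
        (\<lambda>v. \<Sum>b\<in>Basis. (?Dh x v \<bullet> b) * ?Dg (h x) b)) (at x)"
      using has_derivative_compose[OF Ck_on_SucD(1)[OF Suc.prems(1) x] dg[OF x]] unfolding e .
  next
    fix v
    show "Ck_on k S (\<lambda>x. \<Sum>b\<in>Basis. (?Dh x v \<bullet> b) * ?Dg (h x) b)"
    proof (intro Ck_on_sum Ck_on_mult assms(1) finite_Basis)
      fix b :: 'f
      show "Ck_on k S (\<lambda>x. ?Dh x v \<bullet> b)"
        by (rule Ck_on_bounded_linear[OF bounded_linear_inner_left assms(1)
              Ck_on_SucD(2)[OF Suc.prems(1)]])
      show "Ck_on k S (\<lambda>x. ?Dg (h x) b)"
        by (rule Suc.IH[OF Ck_on_pred[OF Suc.prems(1)] Ck_on_SucD(2)[OF Suc.prems(2)]])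
    qed
  qed
qed

section \<open>Smooth functions and vector fields on a manifold\<close>

lemma sum_fun_apply: "(\<Sum>i\<in>I. F i) x = (\<Sum>i\<in>I. F i x)"
  for F :: "'i \<Rightarrow> 'a \<Rightarrow> 'b::comm_monoid_add"
  by (induction I rule: infinite_finite_induct) (simp_all add: plus_fun_def zero_fun_def)

locale smooth_manifold =
  fixes A :: "('a::{t2_space,second_countable_topology}, 'e::euclidean_space) atlas"
  assumes atlas: "smooth_atlas A"
begin

abbreviation T where "T \<equiv> tangent_space A"
abbreviation smooth where "smooth \<equiv> smooth_fun A"
abbreviation smooth_at where "smooth_at \<equiv> smooth_near A"
abbreviation vf where "vf \<equiv> vector_field_on A"
abbreviation bracket where "bracket \<equiv> lie_bracket A"

lemma chart_at: obtains U c where "(U, c) \<in> A" "p \<in> U"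
proof -
  have "p \<in> (\<Union>(U, c)\<in>A. U)" using atlas by (simp add: smooth_atlas_def)
  then show ?thesis using that by auto
qed

lemma chartD:
  assumes "(U, c) \<in> A"
  shows "open U" "open (c ` U)" "homeomorphism U (c ` U) c (inv_into U c)"
  using assms atlas unfolding smooth_atlas_def by auto

lemma transition_smooth:
  assumes "(U, c) \<in> A" "(W, d) \<in> A"
  shows "smooth_on (c ` (U \<inter> W)) (d \<circ> inv_into U c)"
  using assms atlas unfolding smooth_atlas_def by auto

lemma chart_inv:
  assumes "(U, c) \<in> A"
  shows "p \<in> U \<Longrightarrow> inv_into U c (c p) = p"
    and "y \<in> c ` U \<Longrightarrow> inv_into U c y \<in> U" "y \<in> c ` U \<Longrightarrow> c (inv_into U c y) = y"
    and "y \<in> c ` (U \<inter> W) \<Longrightarrow> inv_into U c y \<in> U \<inter> W"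
  using homeomorphism_apply1[OF chartD(3)[OF assms]] by (auto simp: inv_into_into f_inv_into_f)

lemma open_chart_image:
  assumes "(U, c) \<in> A" "open W"
  shows "open (c ` (U \<inter> W))"
proof -
  have "c ` (U \<inter> W) = inv_into U c -` W \<inter> c ` U"
    using chart_inv[OF assms(1)] by force
  moreover have "open (inv_into U c -` W \<inter> c ` U)"
    using continuous_on_open_vimage[OF chartD(2)[OF assms(1)]] assms(2)
      homeomorphism_cont2[OF chartD(3)[OF assms(1)]] by blast
  ultimately show ?thesis by simp
qed

lemma smoothD:
  "smooth W f \<Longrightarrow> (U, c) \<in> A \<Longrightarrow> Ck_on k (c ` (U \<inter> W)) (\<lambda>y. f (inv_into U c y))"
  unfolding smooth_fun_def smooth_on_def comp_def by blast

lemma smoothI: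
  assumes "\<And>U c k. (U, c) \<in> A \<Longrightarrow> Ck_on k (c ` (U \<inter> W)) (\<lambda>y. f (inv_into U c y))"
  shows "smooth W f"
  using assms unfolding smooth_fun_def smooth_on_def comp_def by blast

lemma smooth_subset: "smooth W f \<Longrightarrow> W' \<subseteq> W \<Longrightarrow> smooth W' f"
  by (rule smoothI, rule Ck_on_subset[OF smoothD]) auto

lemma smooth_cong:
  assumes "open W" "smooth W f" "\<And>p. p \<in> W \<Longrightarrow> f p = h p"
  shows "smooth W h"
  by (rule smoothI, rule Ck_on_cong[OF open_chart_image[OF _ assms(1)] _ smoothD[OF assms(2)]])
    (use chart_inv(4) assms(3) in blast)+

lemma smooth_const: "open W \<Longrightarrow> smooth W (\<lambda>p. a)"
  by (rule smoothI, rule Ck_on_const, rule open_chart_image)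

lemma smooth_add: "open W \<Longrightarrow> smooth W f \<Longrightarrow> smooth W h \<Longrightarrow> smooth W (\<lambda>p. f p + h p)"
  by (rule smoothI, rule Ck_on_add) (auto intro: open_chart_image smoothD)

lemma smooth_mult: "open W \<Longrightarrow> smooth W f \<Longrightarrow> smooth W h \<Longrightarrow> smooth W (\<lambda>p. f p * h p)"
  by (rule smoothI, rule Ck_on_mult) (auto intro: open_chart_image smoothD)

lemma smooth_minus: "open W \<Longrightarrow> smooth W f \<Longrightarrow> smooth W (\<lambda>p. - f p)"
  using smooth_mult[OF _ smooth_const[of W "-1"], of f] by simp

lemma smooth_diff: "open W \<Longrightarrow> smooth W f \<Longrightarrow> smooth W h \<Longrightarrow> smooth W (\<lambda>p. f p - h p)"
  using smooth_add[OF _ _ smooth_minus, of W f h] by simp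

lemma smooth_inverse:
  assumes "open W" "smooth W f" "\<And>p. p \<in> W \<Longrightarrow> f p \<noteq> 0"
  shows "smooth W (\<lambda>p. inverse (f p))"
  by (rule smoothI, rule Ck_on_inverse[OF open_chart_image[OF _ assms(1)] _ smoothD[OF assms(2)]])
    (use chart_inv(4) assms(3) in blast)+

lemma smooth_continuous:
  assumes "open W" "smooth W f"
  shows "continuous_on W f"
proof -
  have "continuous (at p) f" if "p \<in> W" for p
  proof -
    obtain U c where c: "(U, c) \<in> A" "p \<in> U" using chart_at .
    have "continuous_on (c ` (U \<inter> W)) (\<lambda>y. f (inv_into U c y))"
      using smoothD[OF assms(2) c(1), of 0] by simp
    moreover have "continuous_on (U \<inter> W) c"
      using homeomorphism_cont1[OF chartD(3)[OF c(1)]] by (rule continuous_on_subset) auto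
    ultimately have "continuous_on (U \<inter> W) (\<lambda>q. f (inv_into U c (c q)))"
      by (rule continuous_on_compose2) auto
    then have "continuous_on (U \<inter> W) f"
      by (rule continuous_on_eq) (simp add: chart_inv(1)[OF c(1)])
    then show ?thesis
      using c that assms(1) chartD(1)[OF c(1)] by (simp add: continuous_on_eq_continuous_at open_Int)
  qed
  then show ?thesis by (simp add: continuous_at_imp_continuous_on)
qed

text \<open>Provides the neighbourhood on which a pairing of two fields can be inverted, in order to
  normalise a frame.\<close>

lemma smooth_open_nonzero:
  assumes "open W" "smooth W f"
  shows "open {p \<in> W. f p \<noteq> (0::real)}"
proof -
  have "{p \<in> W. f p \<noteq> 0} = f -` (- {0}) \<inter> W" by auto
  then show ?thesis
    using continuous_on_open_vimage[OF assms(1), of f] smooth_continuous[OF assms]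
    by (metis open_Compl closed_singleton)
qed

lemma smooth_atI: "smooth W f \<Longrightarrow> open W \<Longrightarrow> p \<in> W \<Longrightarrow> smooth_at p f"
  unfolding smooth_near_def by blast

lemma smooth_atE:
  assumes "smooth_at p f" "open U" "p \<in> U"
  obtains W where "open W" "p \<in> W" "W \<subseteq> U" "smooth W f"
proof -
  obtain W where "open W" "p \<in> W" "smooth W f" using assms(1) unfolding smooth_near_def by blast
  then show ?thesis using that[of "W \<inter> U"] assms smooth_subset[of W f "W \<inter> U"] by (auto simp: open_Int)
qed

lemma smooth_at_transfer:
  assumes "smooth_at p f" "open W" "p \<in> W" "\<And>q. q \<in> W \<Longrightarrow> f q = h q"
  shows "smooth_at p h"
proof -
  obtain W' where W': "open W'" "p \<in> W'" "W' \<subseteq> W" "smooth W' f"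
    using smooth_atE[OF assms(1-3)] .
  show ?thesis
    by (rule smooth_atI[OF smooth_cong[OF W'(1,4)] W'(1,2)]) (use W'(3) assms(4) in blast)
qed

lemma smooth_at_cong:
  assumes "open W" "p \<in> W" "\<And>q. q \<in> W \<Longrightarrow> f q = h q"
  shows "smooth_at p f \<longleftrightarrow> smooth_at p h"
  using smooth_at_transfer[of p f W h] smooth_at_transfer[of p h W f] assms by metis

lemma smooth_at_const: "smooth_at p (\<lambda>q. a)"
  using smooth_atI[OF smooth_const[OF open_UNIV]] by simp

lemma smooth_at_add: "smooth_at p f \<Longrightarrow> smooth_at p h \<Longrightarrow> smooth_at p (\<lambda>q. f q + h q)"
  and smooth_at_mult: "smooth_at p f \<Longrightarrow> smooth_at p h \<Longrightarrow> smooth_at p (\<lambda>q. f q * h q)"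
  and smooth_at_diff: "smooth_at p f \<Longrightarrow> smooth_at p h \<Longrightarrow> smooth_at p (\<lambda>q. f q - h q)"
proof -
  assume f: "smooth_at p f" and h: "smooth_at p h"
  obtain W where W: "open W" "p \<in> W" "smooth W f" using f unfolding smooth_near_def by blast
  obtain W' where W': "open W'" "p \<in> W'" "W' \<subseteq> W" "smooth W' h" using smooth_atE[OF h W(1,2)] .
  note f' = smooth_subset[OF W(3) W'(3)]
  show "smooth_at p (\<lambda>q. f q + h q)" by (rule smooth_atI[OF smooth_add[OF W'(1) f' W'(4)] W'(1,2)])
  show "smooth_at p (\<lambda>q. f q * h q)" by (rule smooth_atI[OF smooth_mult[OF W'(1) f' W'(4)] W'(1,2)])
  show "smooth_at p (\<lambda>q. f q - h q)" by (rule smooth_atI[OF smooth_diff[OF W'(1) f' W'(4)] W'(1,2)])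
qed

lemma smooth_at_minus: "smooth_at p f \<Longrightarrow> smooth_at p (\<lambda>q. - f q)"
  using smooth_at_diff[OF smooth_at_const[of p 0], of f] by simp

section \<open>Tangent vectors as local derivations\<close>

lemma tangent_add: "v \<in> T p \<Longrightarrow> smooth_at p f \<Longrightarrow> smooth_at p h \<Longrightarrow> v (\<lambda>q. f q + h q) = v f + v h"
  and tangent_scale: "v \<in> T p \<Longrightarrow> smooth_at p f \<Longrightarrow> v (\<lambda>q. a * f q) = a * v f"
  and tangent_mult: "v \<in> T p \<Longrightarrow> smooth_at p f \<Longrightarrow> smooth_at p h \<Longrightarrow>
      v (\<lambda>q. f q * h q) = v f * h p + f p * v h"
  and tangent_nonsmooth: "v \<in> T p \<Longrightarrow> \<not> smooth_at p f \<Longrightarrow> v f = 0"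
  unfolding tangent_space_def by blast+

lemma tangent_minus: "v \<in> T p \<Longrightarrow> smooth_at p f \<Longrightarrow> v (\<lambda>q. - f q) = - v f"
  using tangent_scale[of v p f "-1"] by simp

lemma tangent_diff:
  "v \<in> T p \<Longrightarrow> smooth_at p f \<Longrightarrow> smooth_at p h \<Longrightarrow> v (\<lambda>q. f q - h q) = v f - v h"
  using tangent_add[of v p f "\<lambda>q. - h q"] by (simp add: smooth_at_minus tangent_minus)

lemma tangent_const:
  assumes "v \<in> T p"
  shows "v (\<lambda>q. a) = 0"
proof -
  have "v (\<lambda>q. 1) = 0"
    using tangent_mult[OF assms smooth_at_const[of p 1] smooth_at_const[of p 1]] by simp
  then show ?thesis using tangent_scale[OF assms smooth_at_const[of p 1], of a] by simp
qed

text \<open>Locality holds for all functions: where one is not smooth near \<open>p\<close>, neither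
  is the other, and both get the default value 0.\<close>

lemma tangent_cong:
  assumes v: "v \<in> T p" and W: "open W" "p \<in> W" and eq: "\<And>q. q \<in> W \<Longrightarrow> f q = h q"
  shows "v f = v h"
proof (cases "smooth_at p f")
  case True
  then have sh: "smooth_at p h" by (rule smooth_at_cong[OF W eq, THEN iffD1, rotated])
  \<comment> \<open>The difference of the two functions equals its product with \<open>k\<close>;
    both factors vanish at \<open>p\<close>, so the Leibniz rule gives 0.\<close>
  define k where "k q = (if q \<in> W then 0 else 1 :: real)" for q
  have k: "smooth_at p k"
    using smooth_at_cong[OF W, of k "\<lambda>q. 0"] smooth_at_const[of p 0] by (simp add: k_def)
  have d: "smooth_at p (\<lambda>q. f q - h q)" by (rule smooth_at_diff[OF True sh])
  have "(\<lambda>q. f q - h q) = (\<lambda>q. (f q - h q) * k q)" using eq by (auto simp: k_def)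
  then have "v (\<lambda>q. f q - h q) = v (\<lambda>q. (f q - h q) * k q)" by (rule arg_cong)
  also have "\<dots> = 0" using tangent_mult[OF v d k] W(2) eq[OF W(2)] by (simp add: k_def)
  finally show ?thesis using tangent_diff[OF v True sh] by simp
next
  case False
  moreover have "\<not> smooth_at p h"
    using False by (rule contrapos_nn) (rule smooth_at_cong[OF W eq, THEN iffD2])
  ultimately show ?thesis using tangent_nonsmooth[OF v] by simp
qed

lemma subspace_tangent: "subspace (T p)"
  unfolding subspace_def tangent_space_def
  by (auto simp: plus_fun_def zero_fun_def scaleR_fun_def algebra_simps)

section \<open>Smooth vector fields and coordinate fields\<close>

lemma vf_tangent: "vf U X \<Longrightarrow> p \<in> U \<Longrightarrow> X p \<in> T p"
  and vf_smooth: "vf U X \<Longrightarrow> open W \<Longrightarrow> W \<subseteq> U \<Longrightarrow> smooth W f \<Longrightarrow> smooth W (\<lambda>p. X p f)"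
  and vfI: "(\<And>p. p \<in> U \<Longrightarrow> X p \<in> T p) \<Longrightarrow>
    (\<And>W f. open W \<Longrightarrow> W \<subseteq> U \<Longrightarrow> smooth W f \<Longrightarrow> smooth W (\<lambda>p. X p f)) \<Longrightarrow> vf U X"
  unfolding vector_field_on_def by blast+

lemma vf_subset:
  assumes "vf U X" "W \<subseteq> U"
  shows "vf W X"
proof (rule vfI)
  show "X p \<in> T p" if "p \<in> W" for p using vf_tangent[OF assms(1)] assms(2) that by blast
  show "smooth W' (\<lambda>p. X p f)" if "open W'" "W' \<subseteq> W" "smooth W' f" for W' f
    by (rule vf_smooth[OF assms(1) that(1) _ that(3)]) (use that assms(2) in blast)
qed

lemma vf_smooth_at:
  assumes "vf U X" "open U" "p \<in> U" "smooth_at p f"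
  shows "smooth_at p (\<lambda>q. X q f)"
proof -
  obtain W where "open W" "p \<in> W" "W \<subseteq> U" "smooth W f" using smooth_atE[OF assms(4,2,3)] .
  then show ?thesis using vf_smooth[OF assms(1)] smooth_atI by blast
qed

lemma vf_cong:
  assumes "vf U X" "\<And>p. p \<in> U \<Longrightarrow> X p = Y p"
  shows "vf U Y"
proof (rule vfI)
  show "Y p \<in> T p" if "p \<in> U" for p using vf_tangent[OF assms(1) that] assms(2)[OF that] by simp
  show "smooth W (\<lambda>p. Y p f)" if "open W" "W \<subseteq> U" "smooth W f" for W f
    by (rule smooth_cong[OF that(1) vf_smooth[OF assms(1) that]]) (use assms(2) that(2) in auto)
qed

lemma vf_add:
  assumes "vf U X" "vf U Y"
  shows "vf U (\<lambda>p. X p + Y p)"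
proof (rule vfI)
  show "X p + Y p \<in> T p" if "p \<in> U" for p
    by (rule subspace_add[OF subspace_tangent vf_tangent[OF assms(1) that] vf_tangent[OF assms(2) that]])
  show "smooth W (\<lambda>p. (X p + Y p) f)" if "open W" "W \<subseteq> U" "smooth W f" for W f
    using smooth_add[OF that(1) vf_smooth[OF assms(1) that] vf_smooth[OF assms(2) that]]
    by (simp add: plus_fun_def)
qed

lemma vf_scale:
  assumes "vf U X" "smooth U f"
  shows "vf U (\<lambda>p. f p *\<^sub>R X p)"
proof (rule vfI)
  show "f p *\<^sub>R X p \<in> T p" if "p \<in> U" for p
    by (rule subspace_scale[OF subspace_tangent vf_tangent[OF assms(1) that]])
  show "smooth W (\<lambda>p. (f p *\<^sub>R X p) h)" if "open W" "W \<subseteq> U" "smooth W h" for W h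
    using smooth_mult[OF that(1) smooth_subset[OF assms(2) that(2)] vf_smooth[OF assms(1) that]]
    by (simp add: scaleR_fun_def)
qed

lemma vf_diff:
  assumes "open U" "vf U X" "vf U Y"
  shows "vf U (\<lambda>p. X p - Y p)"
  using vf_add[OF assms(2) vf_scale[OF assms(3) smooth_const[OF assms(1), of "-1"]]] by simp

text \<open>The coordinate derivation in direction \<open>b\<close>. The value 0 on functions not
  smooth near \<open>p\<close> is forced by the last clause of \<open>tangent_space\<close>.\<close>

definition coord_field :: "'a set \<Rightarrow> ('a \<Rightarrow> 'e) \<Rightarrow> 'e \<Rightarrow> 'a vfield" where
  "coord_field U c b p f =
     (if smooth_at p f then frechet_derivative (\<lambda>y. f (inv_into U c y)) (at (c p)) b else 0)"

lemma smooth_at_chart_derivative: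
  assumes "(U, c) \<in> A" "p \<in> U" "smooth_at p f"
  shows "((\<lambda>y. f (inv_into U c y)) has_derivative
      frechet_derivative (\<lambda>y. f (inv_into U c y)) (at (c p))) (at (c p))"
proof -
  obtain W where W: "open W" "p \<in> W" "smooth W f" using assms(3) unfolding smooth_near_def by blast
  then show ?thesis using Ck_on_SucD(1)[OF smoothD[OF W(3) assms(1), of "Suc 0"]] assms(2) by blast
qed

lemma coord_field_tangent:
  assumes c: "(U, c) \<in> A" and p: "p \<in> U"
  shows "coord_field U c b p \<in> T p"
proof -
  note d = smooth_at_chart_derivative[OF c p]
  have add: "coord_field U c b p (\<lambda>q. f q + h q) = coord_field U c b p f + coord_field U c b p h"
    if s: "smooth_at p f" "smooth_at p h" for f h
    using s smooth_at_add[OF s]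
      fun_cong[OF frechet_derivative_at[OF has_derivative_add[OF d[OF s(1)] d[OF s(2)]]], of b]
    by (simp add: coord_field_def)
  have mult: "coord_field U c b p (\<lambda>q. f q * h q) =
      coord_field U c b p f * h p + f p * coord_field U c b p h"
    if s: "smooth_at p f" "smooth_at p h" for f h
    using s smooth_at_mult[OF s] chart_inv(1)[OF c p]
      fun_cong[OF frechet_derivative_at[OF has_derivative_mult[OF d[OF s(1)] d[OF s(2)]]], of b]
    by (simp add: coord_field_def)
  have scale: "coord_field U c b p (\<lambda>q. a * f q) = a * coord_field U c b p f"
    if s: "smooth_at p f" for f a
    using mult[OF smooth_at_const[of p a] s]
    by (simp add: coord_field_def[of U c b p "\<lambda>q. a"] smooth_at_const)
  show ?thesis
    unfolding tangent_space_def using add mult scale by (simp add: coord_field_def)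
qed

text \<open>Smoothness must be tested in every chart: read in \<open>c'\<close>, the derivative of
  \<open>f\<close> is a partial derivative in the chart \<open>c\<close> composed with the
  transition map.\<close>

lemma coord_field_vf:
  assumes c: "(U, c) \<in> A"
  shows "vf U (coord_field U c b)"
proof (rule vfI)
  show "coord_field U c b p \<in> T p" if "p \<in> U" for p by (rule coord_field_tangent[OF c that])
  fix W f assume W: "open W" "W \<subseteq> U" and f: "smooth W f"
  show "smooth W (\<lambda>p. coord_field U c b p f)"
  proof (rule smoothI)
    fix U' c' k assume c': "(U', c') \<in> A"
    let ?h = "c \<circ> inv_into U' c'"
    let ?g = "\<lambda>x. frechet_derivative (\<lambda>y. f (inv_into U c y)) (at x) b"
    note op = open_chart_image[OF c' W(1)]
    have h: "Ck_on k (c' ` (U' \<inter> W)) ?h"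
      by (rule Ck_on_subset[of _ "c' ` (U' \<inter> U)"])
        (use transition_smooth[OF c' c] W(2) in \<open>auto simp: smooth_on_def\<close>)
    have g: "Ck_on k (c ` (U \<inter> W)) ?g"
      by (rule Ck_on_SucD(2)[OF smoothD[OF f c]])
    have sub: "?h ` (c' ` (U' \<inter> W)) \<subseteq> c ` (U \<inter> W)"
      using chart_inv(1)[OF c'] W(2) by auto
    show "Ck_on k (c' ` (U' \<inter> W)) (\<lambda>y. coord_field U c b (inv_into U' c' y) f)"
    proof (rule Ck_on_cong[OF op _ Ck_on_compose[OF op sub h g]])
      fix y assume "y \<in> c' ` (U' \<inter> W)"
      then have "inv_into U' c' y \<in> W" using chart_inv(4)[OF c'] by blast
      then show "?g (?h y) = coord_field U c b (inv_into U' c' y) f"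
        using smooth_atI[OF f W(1)] by (simp add: coord_field_def)
    qed
  qed
qed

lemma coord_field_coordinate:
  assumes c: "(U, c) \<in> A" and p: "p \<in> U"
  shows "coord_field U c b p (\<lambda>q. c q \<bullet> b') = b \<bullet> b'"
proof -
  have "smooth U (\<lambda>q. c q \<bullet> b')"
  proof (rule smoothI)
    fix U' c' k assume c': "(U', c') \<in> A"
    have "Ck_on k (c' ` (U' \<inter> U)) (c \<circ> inv_into U' c')"
      using transition_smooth[OF c' c] by (simp add: smooth_on_def)
    then show "Ck_on k (c' ` (U' \<inter> U)) (\<lambda>y. c (inv_into U' c' y) \<bullet> b')"
      using Ck_on_bounded_linear[OF bounded_linear_inner_left[of b'] open_chart_image[OF c' chartD(1)[OF c]]]
      unfolding comp_def by blast
  qed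
  then have s: "smooth_at p (\<lambda>q. c q \<bullet> b')" using smooth_atI chartD(1)[OF c] p by blast
  have "((\<lambda>y. y \<bullet> b') has_derivative (\<lambda>y. y \<bullet> b')) (at (c p))"
    by (rule bounded_linear_imp_has_derivative[OF bounded_linear_inner_left])
  then have "((\<lambda>y. c (inv_into U c y) \<bullet> b') has_derivative (\<lambda>y. y \<bullet> b')) (at (c p))"
    by (rule has_derivative_transform_within_open[OF _ chartD(2)[OF c] imageI[OF p]])
      (simp add: chart_inv(3)[OF c])
  from fun_cong[OF frechet_derivative_at[OF this], of b] s show ?thesis
    by (simp add: coord_field_def)
qed

text \<open>The coordinate functions are dual to the fields. This bounds the dimension of the
  tangent space from below; the bound from above will come from the eigenspaces of \<phi>.\<close>

lemma coord_fields_independent: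
  assumes c: "(U, c) \<in> A" and p: "p \<in> U"
  shows "independent ((\<lambda>b. coord_field U c b p) ` Basis)"
    and "card ((\<lambda>b. coord_field U c b p) ` Basis) = DIM('e)"
proof -
  let ?X = "\<lambda>b. coord_field U c b p"
  have inj: "inj_on ?X Basis"
  proof (rule inj_onI)
    fix b b' :: 'e assume b: "b \<in> Basis" "b' \<in> Basis" "?X b = ?X b'"
    then have "b \<bullet> b = b' \<bullet> b" using coord_field_coordinate[OF c p] by metis
    then show "b = b'" using b by (simp add: inner_Basis split: if_splits)
  qed
  then show "card (?X ` Basis) = DIM('e)" by (rule card_image)
  have *: "\<forall>x\<in>?X ` Basis. f x = 0" if z: "(\<Sum>x\<in>?X ` Basis. f x *\<^sub>R x) = 0" for f
  proof
    fix x assume "x \<in> ?X ` Basis"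
    then obtain b where b: "b \<in> Basis" "x = ?X b" by blast
    have "0 = (\<Sum>b'\<in>Basis. f (?X b') *\<^sub>R ?X b') (\<lambda>q. c q \<bullet> b)"
      using z by (simp add: sum.reindex[OF inj])
    also have "\<dots> = (\<Sum>b'\<in>Basis. f (?X b') * (b' \<bullet> b))"
      by (simp add: sum_fun_apply scaleR_fun_def coord_field_coordinate[OF c p])
    also have "\<dots> = (\<Sum>b'\<in>Basis. if b' = b then f (?X b) else 0)"
      by (rule sum.cong) (use b in \<open>auto simp: inner_Basis\<close>)
    also have "\<dots> = f x" using b by simp
    finally show "f x = 0" by (rule sym)
  qed
  show "independent (?X ` Basis)"
    by (rule independent_if_scalars_zero[OF finite_imageI[OF finite_Basis]], drule *) (erule bspec)
qed

end

section \<open>Conformal fields in an adapted frame\<close>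

text \<open>Isolates the analytic core from the geometry: three derivations with given commutators,
  without metric or connection. The last two assumptions are what the Jacobi identity leaves over
  for the coefficients.\<close>

locale adapted_frame = smooth_manifold A
  for A :: "('a::{t2_space,second_countable_topology}, 'e::euclidean_space) atlas" +
  fixes U :: "'a set" and \<xi> e1 e2 :: "'a vfield" and a \<alpha> \<beta> :: "'a \<Rightarrow> real"
  assumes U: "open U"
    and frame_vf: "vf U \<xi>" "vf U e1" "vf U e2"
    and coeff_smooth: "smooth U a" "smooth U \<alpha>" "smooth U \<beta>"
    and bracket_\<xi>_e1: "\<And>q. q \<in> U \<Longrightarrow> bracket \<xi> e1 q = a q *\<^sub>R e1 q"
    and bracket_\<xi>_e2: "\<And>q. q \<in> U \<Longrightarrow> bracket \<xi> e2 q = - a q *\<^sub>R e2 q"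
    and bracket_e1_e2: "\<And>q. q \<in> U \<Longrightarrow>
      bracket e1 e2 q = 2 *\<^sub>R \<xi> q + \<beta> q *\<^sub>R e1 q - \<alpha> q *\<^sub>R e2 q"
    and \<xi>_\<alpha>: "\<And>q. q \<in> U \<Longrightarrow> \<xi> q \<alpha> = a q * \<alpha> q + e1 q a"
    and \<xi>_\<beta>: "\<And>q. q \<in> U \<Longrightarrow> \<xi> q \<beta> = - a q * \<beta> q - e2 q a"
begin

text \<open>The sectional curvature of ker \<eta>, written as 1 plus the value on \<open>e1\<close>,
  \<open>e2\<close> of the exterior derivative (without the factor 1/2) of the connection form. It
  is spelled out in structure functions since no connection is present here.\<close>

definition \<kappa> :: "'a \<Rightarrow> real" where
  "\<kappa> = (\<lambda>q. 3 - 2 * a q - e1 q \<beta> - e2 q \<alpha> - 2 * (\<alpha> q * \<beta> q))"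

lemma commutators:
  assumes "q \<in> U" "smooth U h"
  shows "\<xi> q (\<lambda>q. e1 q h) - e1 q (\<lambda>q. \<xi> q h) = a q * e1 q h"
    and "\<xi> q (\<lambda>q. e2 q h) - e2 q (\<lambda>q. \<xi> q h) = - a q * e2 q h"
    and "e1 q (\<lambda>q. e2 q h) - e2 q (\<lambda>q. e1 q h) = 2 * \<xi> q h + \<beta> q * e1 q h - \<alpha> q * e2 q h"
  using bracket_\<xi>_e1[OF assms(1), THEN fun_cong, of h]
    bracket_\<xi>_e2[OF assms(1), THEN fun_cong, of h]
    bracket_e1_e2[OF assms(1), THEN fun_cong, of h] smooth_atI[OF assms(2) U assms(1)]
  by (simp_all add: lie_bracket_def scaleR_fun_def plus_fun_def fun_diff_def fun_Compl_def)

lemma frame_smooth: "smooth U h \<Longrightarrow> smooth U (\<lambda>q. \<xi> q h)"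
    "smooth U h \<Longrightarrow> smooth U (\<lambda>q. e1 q h)" "smooth U h \<Longrightarrow> smooth U (\<lambda>q. e2 q h)"
  using vf_smooth[OF frame_vf(1) U order_refl] vf_smooth[OF frame_vf(2) U order_refl]
    vf_smooth[OF frame_vf(3) U order_refl] by blast+

lemma smooth_closed: "smooth U (\<lambda>q. k)" "smooth U f \<Longrightarrow> smooth U (\<lambda>q. - f q)"
    "smooth U f \<Longrightarrow> smooth U h \<Longrightarrow> smooth U (\<lambda>q. f q + h q)"
    "smooth U f \<Longrightarrow> smooth U h \<Longrightarrow> smooth U (\<lambda>q. f q - h q)"
    "smooth U f \<Longrightarrow> smooth U h \<Longrightarrow> smooth U (\<lambda>q. f q * h q)"
  by (rule smooth_const[OF U] smooth_minus[OF U] smooth_add[OF U] smooth_diff[OF U]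
      smooth_mult[OF U]; assumption)+

lemmas smooth_rules = smooth_closed frame_smooth coeff_smooth

lemma derivation:
  assumes "vf U X" "q \<in> U"
  shows "X q (\<lambda>q. k) = 0"
    and "smooth U f \<Longrightarrow> X q (\<lambda>q. - f q) = - X q f"
    and "smooth U f \<Longrightarrow> smooth U h \<Longrightarrow> X q (\<lambda>q. f q + h q) = X q f + X q h"
    and "smooth U f \<Longrightarrow> smooth U h \<Longrightarrow> X q (\<lambda>q. f q - h q) = X q f - X q h"
    and "smooth U f \<Longrightarrow> smooth U h \<Longrightarrow> X q (\<lambda>q. f q * h q) = X q f * h q + f q * X q h"
  using vf_tangent[OF assms] smooth_atI[OF _ U assms(2)]
  by (simp_all add: tangent_const tangent_minus tangent_add tangent_diff tangent_mult)

lemmas D = derivation[OF frame_vf(1)] derivation[OF frame_vf(2)] derivation[OF frame_vf(3)]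

lemma deriv_cong:
  assumes "vf U X" "q \<in> U" "\<And>q. q \<in> U \<Longrightarrow> f q = h q"
  shows "X q f = X q h"
  by (rule tangent_cong[OF vf_tangent[OF assms(1,2)] U assms(2,3)])

lemmas D_cong = deriv_cong[OF frame_vf(1)] deriv_cong[OF frame_vf(2)] deriv_cong[OF frame_vf(3)]

lemma smooth_\<kappa>: "smooth U \<kappa>"
  unfolding \<kappa>_def by (intro smooth_rules)

text \<open>Geometrically, the Killing field \<xi> preserves curvature. In the frame, the second
  derivatives of \<open>a\<close> combine to [e1, e2] a, whose term \<open>2 * \<xi> q a\<close>
  cancels the derivative of \<open>- 2 * a q\<close>.\<close>

lemma \<xi>_\<kappa>:
  assumes q: "q \<in> U"
  shows "\<xi> q \<kappa> = 0"
proof -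
  have "\<xi> q \<kappa> = - 2 * \<xi> q a - \<xi> q (\<lambda>q. e1 q \<beta>) - \<xi> q (\<lambda>q. e2 q \<alpha>)
      - 2 * (\<xi> q \<alpha> * \<beta> q + \<alpha> q * \<xi> q \<beta>)"
    unfolding \<kappa>_def by (simp add: D q smooth_rules)
  moreover have "e1 q (\<lambda>q. \<xi> q \<beta>) = e1 q (\<lambda>q. - a q * \<beta> q - e2 q a)"
    by (rule D_cong[OF q \<xi>_\<beta>])
  then have "e1 q (\<lambda>q. \<xi> q \<beta>) = - e1 q a * \<beta> q - a q * e1 q \<beta> - e1 q (\<lambda>q. e2 q a)"
    by (simp add: D q smooth_rules)
  moreover have "e2 q (\<lambda>q. \<xi> q \<alpha>) = e2 q (\<lambda>q. a q * \<alpha> q + e1 q a)"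
    by (rule D_cong[OF q \<xi>_\<alpha>])
  then have "e2 q (\<lambda>q. \<xi> q \<alpha>) = e2 q a * \<alpha> q + a q * e2 q \<alpha> + e2 q (\<lambda>q. e1 q a)"
    by (simp add: D q smooth_rules)
  ultimately show ?thesis
    using commutators(1)[OF q coeff_smooth(3)] commutators(2)[OF q coeff_smooth(2)]
      commutators(3)[OF q coeff_smooth(1)] \<xi>_\<alpha>[OF q] \<xi>_\<beta>[OF q]
    by algebra
qed

text \<open>Taking the Lie bracket with \<open>\<xi>\<close> preserves the equations satisfied by the components of
  a conformal field.\<close>

lemma e1_bracket_component:
  assumes v: "smooth U v" "\<And>q. q \<in> U \<Longrightarrow> e1 q v = \<alpha> q * v q" and q: "q \<in> U"
  shows "e1 q (\<lambda>q. \<xi> q v - a q * v q) = \<alpha> q * (\<xi> q v - a q * v q)"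
proof -
  have "e1 q (\<lambda>q. \<xi> q v - a q * v q) = e1 q (\<lambda>q. \<xi> q v) - e1 q a * v q - a q * e1 q v"
    by (simp add: D q v(1) smooth_rules)
  moreover have "\<xi> q (\<lambda>q. e1 q v) = \<xi> q (\<lambda>q. \<alpha> q * v q)" by (rule D_cong[OF q v(2)])
  then have "\<xi> q (\<lambda>q. e1 q v) = \<xi> q \<alpha> * v q + \<alpha> q * \<xi> q v"
    by (simp add: D q v(1) smooth_rules)
  ultimately show ?thesis
    using commutators(1)[OF q v(1)] \<xi>_\<alpha>[OF q] v(2)[OF q] by algebra
qed

lemma e2_bracket_component:
  assumes u: "smooth U u" "\<And>q. q \<in> U \<Longrightarrow> e2 q u = \<beta> q * u q" and q: "q \<in> U"
  shows "e2 q (\<lambda>q. \<xi> q u + a q * u q) = \<beta> q * (\<xi> q u + a q * u q)"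
proof -
  have "e2 q (\<lambda>q. \<xi> q u + a q * u q) = e2 q (\<lambda>q. \<xi> q u) + e2 q a * u q + a q * e2 q u"
    by (simp add: D q u(1) smooth_rules)
  moreover have "\<xi> q (\<lambda>q. e2 q u) = \<xi> q (\<lambda>q. \<beta> q * u q)" by (rule D_cong[OF q u(2)])
  then have "\<xi> q (\<lambda>q. e2 q u) = \<xi> q \<beta> * u q + \<beta> q * \<xi> q u"
    by (simp add: D q u(1) smooth_rules)
  ultimately show ?thesis
    using commutators(2)[OF q u(1)] \<xi>_\<beta>[OF q] u(2)[OF q] by algebra
qed

text \<open>The left side differentiates one of the two horizontal summands of a divergence;
  commuting \<xi> inwards turns \<open>u\<close> into the component of the bracket with \<xi>. The
  summands are treated separately because their individual values are needed later.\<close>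

lemma \<xi>_divergence1:
  assumes u: "smooth U u" and q: "q \<in> U"
  shows "\<xi> q (\<lambda>q. e1 q u + \<alpha> q * u q) =
    e1 q (\<lambda>q. \<xi> q u + a q * u q) + \<alpha> q * (\<xi> q u + a q * u q)"
proof -
  have "\<xi> q (\<lambda>q. e1 q u + \<alpha> q * u q) = \<xi> q (\<lambda>q. e1 q u) + \<xi> q \<alpha> * u q + \<alpha> q * \<xi> q u"
    "e1 q (\<lambda>q. \<xi> q u + a q * u q) = e1 q (\<lambda>q. \<xi> q u) + e1 q a * u q + a q * e1 q u"
    by (simp_all add: D q u smooth_rules)
  then show ?thesis using commutators(1)[OF q u] \<xi>_\<alpha>[OF q] by algebra
qed

lemma \<xi>_divergence2:
  assumes v: "smooth U v" and q: "q \<in> U"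
  shows "\<xi> q (\<lambda>q. e2 q v + \<beta> q * v q) =
    e2 q (\<lambda>q. \<xi> q v - a q * v q) + \<beta> q * (\<xi> q v - a q * v q)"
proof -
  have "\<xi> q (\<lambda>q. e2 q v + \<beta> q * v q) = \<xi> q (\<lambda>q. e2 q v) + \<xi> q \<beta> * v q + \<beta> q * \<xi> q v"
    "e2 q (\<lambda>q. \<xi> q v - a q * v q) = e2 q (\<lambda>q. \<xi> q v) - e2 q a * v q - a q * e2 q v"
    by (simp_all add: D q v smooth_rules)
  then show ?thesis using commutators(2)[OF q v] \<xi>_\<beta>[OF q] by algebra
qed

text \<open>\<open>f, u, v\<close> are the components of a conformal field \<open>V\<close>; \<open>[\<xi>, V]\<close> has the components
  \<open>\<rho>, w1, w2\<close>. Since \<open>\<kappa>\<close> determines the scalar curvature, \<open>\<rho> = k - \<kappa>\<close> is the soliton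
  equation.\<close>

lemma soliton_components:
  fixes \<rho> w1 w2 :: "'a \<Rightarrow> real"
  assumes sm: "smooth U f" "smooth U u" "smooth U v"
    and \<rho>: "\<And>q. q \<in> U \<Longrightarrow> \<rho> q = k - \<kappa> q"
    and w1: "w1 = (\<lambda>q. \<xi> q u + a q * u q)" and w2: "w2 = (\<lambda>q. \<xi> q v - a q * v q)"
    and f0: "\<And>q. q \<in> U \<Longrightarrow> \<xi> q f = \<rho> q"
    and f1: "\<And>q. q \<in> U \<Longrightarrow> e1 q f = - 2 * v q - w2 q"
    and f2: "\<And>q. q \<in> U \<Longrightarrow> e2 q f = 2 * u q - w1 q"
    and v1: "\<And>q. q \<in> U \<Longrightarrow> e1 q v = \<alpha> q * v q"
    and u2: "\<And>q. q \<in> U \<Longrightarrow> e2 q u = \<beta> q * u q"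
    and dv: "\<And>q. q \<in> U \<Longrightarrow> (e1 q u + \<alpha> q * u q) + (e2 q v + \<beta> q * v q) = 2 * \<rho> q"
    and q: "q \<in> U"
  shows "\<rho> q = 0" "w1 q * (\<kappa> q + 1) = 0" "w2 q * (\<kappa> q + 1) = 0"
proof -
  define p where "p = (\<lambda>q. e1 q \<rho>)"
  \<comment> \<open>\<open>w1'\<close> and \<open>w2'\<close> are the horizontal components of
    [\<xi>, [\<xi>, V]].\<close>
  define w1' where "w1' = (\<lambda>q. \<xi> q w1 + a q * w1 q)"
  define w2' where "w2' = (\<lambda>q. \<xi> q w2 - a q * w2 q)"
  have s\<rho>: "smooth U \<rho>"
    by (rule smooth_cong[OF U, of "\<lambda>q. k - \<kappa> q"]) (simp_all add: \<rho> smooth_rules smooth_\<kappa>)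
  have sw: "smooth U w1" "smooth U w2" unfolding w1 w2 by (intro smooth_rules sm)+
  have sw': "smooth U w1'" "smooth U w2'" unfolding w1'_def w2'_def by (intro smooth_rules sw)+
  have sp: "smooth U p" unfolding p_def by (intro smooth_rules s\<rho>)
  note sr = smooth_rules sm sw sw' sp s\<rho> smooth_\<kappa>
  have d\<rho>: "\<xi> q \<rho> = 0" "e1 q \<kappa> = - p q" if "q \<in> U" for q
  proof -
    have "\<xi> q \<rho> = \<xi> q (\<lambda>q. k - \<kappa> q)" "e1 q \<rho> = e1 q (\<lambda>q. k - \<kappa> q)"
      by (rule D_cong[OF that \<rho>], assumption)+
    then show "\<xi> q \<rho> = 0" "e1 q \<kappa> = - p q" by (simp_all add: D that sr \<xi>_\<kappa> p_def)
  qed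
  have w2_1: "e1 q w2 = \<alpha> q * w2 q" if "q \<in> U" for q
    unfolding w2 by (rule e1_bracket_component[OF sm(3) v1 that])
  have w2'_1: "e1 q w2' = \<alpha> q * w2' q" if "q \<in> U" for q
    unfolding w2'_def by (rule e1_bracket_component[OF sw(2) w2_1 that])
  have w1_2: "e2 q w1 = \<beta> q * w1 q" if "q \<in> U" for q
    unfolding w1 by (rule e2_bracket_component[OF sm(2) u2 that])
  \<comment> \<open>These two identities are \<open>f1\<close> and \<open>f2\<close> for the Killing
    field [\<xi>, V], whose \<xi>-component is \<rho>.\<close>
  have p_eq: "p q = - 2 * w2 q - w2' q" if q: "q \<in> U" for q
  proof -
    have "e1 q (\<lambda>q. \<xi> q f) = p q" unfolding p_def by (rule D_cong[OF q f0])
    moreover have "\<xi> q (\<lambda>q. e1 q f) = \<xi> q (\<lambda>q. - 2 * v q - w2 q)" by (rule D_cong[OF q f1])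
    then have "\<xi> q (\<lambda>q. e1 q f) = - 2 * \<xi> q v - \<xi> q w2" by (simp add: D q sr)
    ultimately have "p q = - 2 * \<xi> q v - \<xi> q w2 - a q * (- 2 * v q - w2 q)"
      using commutators(1)[OF q sm(1)] f1[OF q] by simp
    then show ?thesis by (simp add: w2'_def w2[THEN fun_cong, of q] algebra_simps)
  qed
  have r_eq: "e2 q \<rho> = 2 * w1 q - w1' q" if q: "q \<in> U" for q
  proof -
    have "e2 q (\<lambda>q. \<xi> q f) = e2 q \<rho>" by (rule D_cong[OF q f0])
    moreover have "\<xi> q (\<lambda>q. e2 q f) = \<xi> q (\<lambda>q. 2 * u q - w1 q)" by (rule D_cong[OF q f2])
    then have "\<xi> q (\<lambda>q. e2 q f) = 2 * \<xi> q u - \<xi> q w1" by (simp add: D q sr)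
    ultimately have "e2 q \<rho> = 2 * \<xi> q u - \<xi> q w1 + a q * (2 * u q - w1 q)"
      using commutators(2)[OF q sm(1)] f2[OF q] by simp
    then show ?thesis by (simp add: w1'_def w1[THEN fun_cong, of q] algebra_simps)
  qed
  \<comment> \<open>The commutator [e1, e2] on \<open>f\<close> gives the difference of the two
    summands as \<open>2 * \<rho> q\<close>; applying \<xi> to \<open>dv\<close> gives their sum as
    0.\<close>
  have \<psi>: "e1 q w1 + \<alpha> q * w1 q = \<rho> q" "e2 q w2 + \<beta> q * w2 q = - \<rho> q" if q: "q \<in> U" for q
  proof -
    have "e1 q (\<lambda>q. e2 q f) = e1 q (\<lambda>q. 2 * u q - w1 q)" by (rule D_cong[OF q f2])
    then have "e1 q (\<lambda>q. e2 q f) = 2 * e1 q u - e1 q w1" by (simp add: D q sr)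
    moreover have "e2 q (\<lambda>q. e1 q f) = e2 q (\<lambda>q. - 2 * v q - w2 q)" by (rule D_cong[OF q f1])
    then have "e2 q (\<lambda>q. e1 q f) = - 2 * e2 q v - e2 q w2" by (simp add: D q sr)
    ultimately have 1: "(e1 q w1 + \<alpha> q * w1 q) - (e2 q w2 + \<beta> q * w2 q) = 2 * \<rho> q"
      using commutators(3)[OF q sm(1)] f0[OF q] f1[OF q] f2[OF q] dv[OF q] by algebra
    have "\<xi> q (\<lambda>q. (e1 q u + \<alpha> q * u q) + (e2 q v + \<beta> q * v q)) = \<xi> q (\<lambda>q. 2 * \<rho> q)"
      by (rule D_cong[OF q dv])
    moreover have "\<xi> q (\<lambda>q. 2 * \<rho> q) = 0" by (simp add: D q sr d\<rho>)
    moreover have "\<xi> q (\<lambda>q. (e1 q u + \<alpha> q * u q) + (e2 q v + \<beta> q * v q))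
        = \<xi> q (\<lambda>q. e1 q u + \<alpha> q * u q) + \<xi> q (\<lambda>q. e2 q v + \<beta> q * v q)"
      by (rule D(3)[OF q]; intro sr)
    ultimately have 2: "(e1 q w1 + \<alpha> q * w1 q) + (e2 q w2 + \<beta> q * w2 q) = 0"
      using \<xi>_divergence1[OF sm(2) q, folded w1, folded fun_cong[OF w1, of q]]
        \<xi>_divergence2[OF sm(3) q, folded w2, folded fun_cong[OF w2, of q]] by linarith
    show "e1 q w1 + \<alpha> q * w1 q = \<rho> q" "e2 q w2 + \<beta> q * w2 q = - \<rho> q"
      using 1 2 by linarith+
  qed
  have p1: "e1 q p = \<alpha> q * p q" if q: "q \<in> U" for q
  proof -
    have "e1 q p = e1 q (\<lambda>q. - 2 * w2 q - w2' q)" by (rule D_cong[OF q p_eq])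
    then have "e1 q p = - 2 * e1 q w2 - e1 q w2'" by (simp add: D q sr)
    then show ?thesis using w2_1[OF q] w2'_1[OF q] p_eq[OF q] by algebra
  qed
  \<comment> \<open>Applying \<xi> to the second equation of \<open>\<psi>\<close> repeats it for
    \<open>w2'\<close> with right side 0, since \<xi> annihilates \<rho>; hence only
    \<open>w2\<close> contributes a \<rho>.\<close>
  have p2: "e2 q p = 2 * \<rho> q - \<beta> q * p q" if q: "q \<in> U" for q
  proof -
    have "e2 q p = e2 q (\<lambda>q. - 2 * w2 q - w2' q)" by (rule D_cong[OF q p_eq])
    then have "e2 q p = - 2 * e2 q w2 - e2 q w2'" by (simp add: D q sr)
    moreover have "\<xi> q (\<lambda>q. e2 q w2 + \<beta> q * w2 q) = \<xi> q (\<lambda>q. - \<rho> q)" by (rule D_cong[OF q \<psi>(2)])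
    then have "e2 q w2' + \<beta> q * w2' q = 0"
      using \<xi>_divergence2[OF sw(2) q, folded w2'_def, folded fun_cong[OF w2'_def, of q]]
      by (simp add: D q sr d\<rho>)
    ultimately show ?thesis using \<psi>(2)[OF q] p_eq[OF q] by algebra
  qed
  \<comment> \<open>Since \<rho> has slope \<open>p\<close>, differentiating
    \<open>2 * \<rho> q\<close> along \<open>e1\<close> yields \<open>2 * p q\<close>. The terms in
    \<alpha> \<rho> cancel, and the remaining coefficient of \<open>p\<close> is 2 - 2 a - e1
    \<beta> - e2 \<alpha> - 2 \<alpha> \<beta> = \<kappa> - 1.\<close>
  have p\<kappa>: "p q * (\<kappa> q - 1) = 0" if q: "q \<in> U" for q
  proof -
    have "e1 q (\<lambda>q. \<xi> q \<rho>) = e1 q (\<lambda>q. 0)" by (rule D_cong[OF q d\<rho>(1)])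
    then have "\<xi> q p = a q * p q"
      using commutators(1)[OF q s\<rho>] by (simp add: D q sr p_def)
    moreover have "e1 q (\<lambda>q. e2 q p) = e1 q (\<lambda>q. 2 * \<rho> q - \<beta> q * p q)" by (rule D_cong[OF q p2])
    then have "e1 q (\<lambda>q. e2 q p) = 2 * p q - e1 q \<beta> * p q - \<beta> q * e1 q p"
      by (simp add: D q sr p_def)
    moreover have "e2 q (\<lambda>q. e1 q p) = e2 q (\<lambda>q. \<alpha> q * p q)" by (rule D_cong[OF q p1])
    then have "e2 q (\<lambda>q. e1 q p) = e2 q \<alpha> * p q + \<alpha> q * e2 q p" by (simp add: D q sr)
    ultimately show ?thesis
      using commutators(3)[OF q sp] p1[OF q] p2[OF q] \<kappa>_def[THEN fun_cong, of q] by algebra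
  qed
  \<comment> \<open>The square arises from the slope \<open>- p\<close> of \<kappa>; the other term
    is \<alpha> times the vanishing product \<open>p q * (\<kappa> q - 1)\<close>.\<close>
  have p0: "p q = 0" if q: "q \<in> U" for q
  proof -
    have "e1 q (\<lambda>q. p q * (\<kappa> q - 1)) = e1 q (\<lambda>q. 0)" by (rule D_cong[OF q p\<kappa>])
    then have "e1 q p * (\<kappa> q - 1) - p q * p q = 0" by (simp add: D q sr d\<rho>)
    then have "p q * p q = 0" using p1[OF q] p\<kappa>[OF q] by algebra
    then show ?thesis by simp
  qed
  have \<rho>0: "\<rho> q = 0" if q: "q \<in> U" for q
  proof -
    have "e2 q p = e2 q (\<lambda>q. 0)" by (rule D_cong[OF q p0])
    then show ?thesis using p2[OF q] p0[OF q] by (simp add: D q)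
  qed
  then show "\<rho> q = 0" using q .
  \<comment> \<open>Now all three frame derivatives of \<open>w1\<close> and of \<open>w2\<close>
    become multiples of the function itself, so [e1, e2] leaves a single linear condition on
    each.\<close>
  have w2_0: "\<xi> q w2 = (a q - 2) * w2 q" if q: "q \<in> U" for q
    using p_eq[OF q] p0[OF q] w2'_def[THEN fun_cong, of q] by algebra
  have w1_0: "\<xi> q w1 = (2 - a q) * w1 q" if q: "q \<in> U" for q
  proof -
    have "e2 q \<rho> = e2 q (\<lambda>q. 0)" by (rule D_cong[OF q \<rho>0])
    then show ?thesis using r_eq[OF q] w1'_def[THEN fun_cong, of q] by (simp add: D q) algebra
  qed
  have w1_1: "e1 q w1 = - \<alpha> q * w1 q" and w2_2: "e2 q w2 = - \<beta> q * w2 q" if q: "q \<in> U" for q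
    using \<psi>[OF q] \<rho>0[OF q] by simp_all
  have "e1 q (\<lambda>q. e2 q w1) = e1 q (\<lambda>q. \<beta> q * w1 q)" "e2 q (\<lambda>q. e1 q w1) = e2 q (\<lambda>q. - \<alpha> q * w1 q)"
    by (rule D_cong[OF q w1_2], assumption) (rule D_cong[OF q w1_1], assumption)
  then have "e1 q (\<lambda>q. e2 q w1) = e1 q \<beta> * w1 q + \<beta> q * e1 q w1"
    "e2 q (\<lambda>q. e1 q w1) = - e2 q \<alpha> * w1 q - \<alpha> q * e2 q w1"
    by (simp_all add: D q sr)
  \<comment> \<open>The 4 in \<open>2 * (2 - a q)\<close>, coming from the \<xi>-term of the
    commutator, against the 3 in \<kappa> produces the factor \<kappa> + 1.\<close>
  then show "w1 q * (\<kappa> q + 1) = 0"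
    using commutators(3)[OF q sw(1)] w1_0[OF q] w1_1[OF q] w1_2[OF q] \<kappa>_def[THEN fun_cong, of q]
    by algebra
  have "e1 q (\<lambda>q. e2 q w2) = e1 q (\<lambda>q. - \<beta> q * w2 q)" "e2 q (\<lambda>q. e1 q w2) = e2 q (\<lambda>q. \<alpha> q * w2 q)"
    by (rule D_cong[OF q w2_2], assumption) (rule D_cong[OF q w2_1], assumption)
  then have "e1 q (\<lambda>q. e2 q w2) = - e1 q \<beta> * w2 q - \<beta> q * e1 q w2"
    "e2 q (\<lambda>q. e1 q w2) = e2 q \<alpha> * w2 q + \<alpha> q * e2 q w2"
    by (simp_all add: D q sr)
  then show "w2 q * (\<kappa> q + 1) = 0"
    using commutators(3)[OF q sw(2)] w2_0[OF q] w2_1[OF q] w2_2[OF q] \<kappa>_def[THEN fun_cong, of q]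
    by algebra
qed

end

section \<open>Para-Sasakian structures in dimension three\<close>

context smooth_manifold
begin

lemma bracket_cong:
  assumes "open U" "q \<in> U" "vf U X" "vf U Y"
    and "\<And>q. q \<in> U \<Longrightarrow> X q = X' q" "\<And>q. q \<in> U \<Longrightarrow> Y q = Y' q"
  shows "bracket X Y q = bracket X' Y' q"
proof
  fix f
  have "X q (\<lambda>q. Y q f) = X q (\<lambda>q. Y' q f)" "Y q (\<lambda>q. X q f) = Y q (\<lambda>q. X' q f)"
    by (rule tangent_cong[OF vf_tangent[OF assms(3,2)] assms(1,2)], simp add: assms(6))
      (rule tangent_cong[OF vf_tangent[OF assms(4,2)] assms(1,2)], simp add: assms(5))
  then show "bracket X Y q f = bracket X' Y' q f"
    using assms(2,5,6) by (simp add: lie_bracket_def)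
qed

lemma bracket_skew: "bracket X Y q = - bracket Y X q"
  by (simp add: lie_bracket_def fun_eq_iff fun_Compl_def)

lemma bracket_add_right:
  assumes "open U" "q \<in> U" "vf U X" "vf U Y" "vf U Z"
  shows "bracket X (\<lambda>q. Y q + Z q) q = bracket X Y q + bracket X Z q"
proof
  fix f
  show "bracket X (\<lambda>q. Y q + Z q) q f = (bracket X Y q + bracket X Z q) f"
    using tangent_add[OF vf_tangent[OF assms(3,2)] vf_smooth_at[OF assms(4,1,2)]
        vf_smooth_at[OF assms(5,1,2)], of f f]
    by (simp add: lie_bracket_def plus_fun_def)
qed

lemma bracket_scale_right:
  assumes "open U" "q \<in> U" "vf U X" "vf U Y" "smooth U h"
  shows "bracket X (\<lambda>q. h q *\<^sub>R Y q) q = X q h *\<^sub>R Y q + h q *\<^sub>R bracket X Y q"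
proof
  fix f
  show "bracket X (\<lambda>q. h q *\<^sub>R Y q) q f = (X q h *\<^sub>R Y q + h q *\<^sub>R bracket X Y q) f"
    using tangent_mult[OF vf_tangent[OF assms(3,2)] smooth_atI[OF assms(5,1,2)]
        vf_smooth_at[OF assms(4,1,2)], of f] tangent_nonsmooth[OF vf_tangent[OF assms(4,2)], of f]
    by (simp add: lie_bracket_def plus_fun_def scaleR_fun_def algebra_simps)
qed

lemma bracket_self: "bracket X X q = 0"
  by (simp add: lie_bracket_def fun_eq_iff)

lemma bracket_apply:
  assumes "open U" "q \<in> U" "vf U X" "vf U Y" "vf U Z" "smooth_at q f"
  shows "X q (\<lambda>q. bracket Y Z q f) = X q (\<lambda>q. Y q (\<lambda>q. Z q f)) - X q (\<lambda>q. Z q (\<lambda>q. Y q f))"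
    and "bracket Y Z q (\<lambda>q. X q f) = Y q (\<lambda>q. Z q (\<lambda>q. X q f)) - Z q (\<lambda>q. Y q (\<lambda>q. X q f))"
proof -
  obtain W where W: "open W" "q \<in> W" "W \<subseteq> U" "smooth W f" using smooth_atE[OF assms(6,1,2)] .
  have sm: "smooth_at q (\<lambda>q. X q f)" if "vf U X" "smooth_at q f" for X f
    by (rule vf_smooth_at[OF that(1) assms(1,2) that(2)])
  \<comment> \<open>The case distinction inside \<open>lie_bracket\<close> has to be resolved on a
    neighbourhood of \<open>q\<close>, because \<open>X\<close> differentiates the inner
    bracket.\<close>
  have "X q (\<lambda>q. bracket Y Z q f) = X q (\<lambda>q. Y q (\<lambda>q. Z q f) - Z q (\<lambda>q. Y q f))"
    by (rule tangent_cong[OF vf_tangent[OF assms(3,2)] W(1,2)])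
      (simp add: lie_bracket_def smooth_atI[OF W(4,1)])
  also have "\<dots> = X q (\<lambda>q. Y q (\<lambda>q. Z q f)) - X q (\<lambda>q. Z q (\<lambda>q. Y q f))"
    by (rule tangent_diff[OF vf_tangent[OF assms(3,2)] sm[OF assms(4) sm[OF assms(5,6)]]
          sm[OF assms(5) sm[OF assms(4,6)]]])
  finally show "X q (\<lambda>q. bracket Y Z q f) =
    X q (\<lambda>q. Y q (\<lambda>q. Z q f)) - X q (\<lambda>q. Z q (\<lambda>q. Y q f))" .
  show "bracket Y Z q (\<lambda>q. X q f) = Y q (\<lambda>q. Z q (\<lambda>q. X q f)) - Z q (\<lambda>q. Y q (\<lambda>q. X q f))"
    by (simp add: lie_bracket_def sm[OF assms(3,6)])
qed

text \<open>On a function smooth near \<open>q\<close> the third-order terms cancel in pairs; on any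
  other function every bracket has the default value 0.\<close>

lemma jacobi:
  assumes q: "open U" "q \<in> U" and vf: "vf U X" "vf U Y" "vf U Z"
  shows "bracket X (bracket Y Z) q + bracket Y (bracket Z X) q + bracket Z (bracket X Y) q = 0"
proof
  fix f
  show "(bracket X (bracket Y Z) q + bracket Y (bracket Z X) q + bracket Z (bracket X Y) q) f = 0 f"
  proof (cases "smooth_at q f")
    case True
    then show ?thesis
      using bracket_apply[OF q vf True] bracket_apply[OF q vf(2,3,1) True]
        bracket_apply[OF q vf(3,1,2) True]
      by (simp add: lie_bracket_def[of A X "bracket Y Z"] lie_bracket_def[of A Y "bracket Z X"]
          lie_bracket_def[of A Z "bracket X Y"] plus_fun_def)
  next
    case False
    then show ?thesis by (simp add: lie_bracket_def plus_fun_def)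
  qed
qed

end

section \<open>Pointwise algebra of the structure tensors\<close>

locale para_sasakian_3 = smooth_manifold A
  for A :: "('a::{t2_space,second_countable_topology}, real^3) atlas" +
  fixes \<phi> :: "'a \<Rightarrow> 'a tvec \<Rightarrow> 'a tvec" and \<xi> :: "'a vfield" and \<eta> :: "'a \<Rightarrow> 'a tvec \<Rightarrow> real"
    and g :: "'a \<Rightarrow> 'a tvec \<Rightarrow> 'a tvec \<Rightarrow> real" and nabla :: "'a vfield \<Rightarrow> 'a vfield \<Rightarrow> 'a vfield"
  assumes para_sasakian: "para_sasakian A \<phi> \<xi> \<eta> g" and levi_civita: "levi_civita A g nabla"
begin

lemma apm: "almost_paracontact_metric A \<phi> \<xi> \<eta> g"
  using para_sasakian by (simp add: para_sasakian_def paracontact_metric_def)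

lemma apc: "almost_paracontact A \<phi> \<xi> \<eta>" and srm: "semi_riemannian_metric A g"
  using apm by (simp_all add: almost_paracontact_metric_def)

lemma endo: "endo_field A \<phi>" and \<xi>_vf: "vf UNIV \<xi>" and one_form: "one_form A \<eta>"
    and \<eta>_\<xi> [simp]: "\<eta> p (\<xi> p) = 1"
    and \<phi>_\<phi>: "x \<in> T p \<Longrightarrow> \<phi> p (\<phi> p x) = x - \<eta> p x *\<^sub>R \<xi> p"
  using apc by (simp_all add: almost_paracontact_def)

lemma \<xi>_vf_on: "vf U \<xi>"
  by (rule vf_subset[OF \<xi>_vf]) simp

lemma \<xi>_T [simp]: "\<xi> p \<in> T p"
  by (rule vf_tangent[OF \<xi>_vf]) simp

lemma T_closed [simp]: "0 \<in> T p" "x \<in> T p \<Longrightarrow> k *\<^sub>R x \<in> T p" "x \<in> T p \<Longrightarrow> - x \<in> T p"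
    "x \<in> T p \<Longrightarrow> y \<in> T p \<Longrightarrow> x + y \<in> T p" "x \<in> T p \<Longrightarrow> y \<in> T p \<Longrightarrow> x - y \<in> T p"
  using subspace_0[OF subspace_tangent] subspace_scale[OF subspace_tangent]
    subspace_neg[OF subspace_tangent] subspace_add[OF subspace_tangent]
    subspace_diff[OF subspace_tangent] by blast+

lemma \<phi>_T [simp]: "x \<in> T p \<Longrightarrow> \<phi> p x \<in> T p"
    and \<phi>_add: "x \<in> T p \<Longrightarrow> y \<in> T p \<Longrightarrow> \<phi> p (x + y) = \<phi> p x + \<phi> p y"
    and \<phi>_scale: "x \<in> T p \<Longrightarrow> \<phi> p (k *\<^sub>R x) = k *\<^sub>R \<phi> p x"
    and \<phi>_vf: "open U \<Longrightarrow> vf U X \<Longrightarrow> vf U (\<lambda>p. \<phi> p (X p))"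
  using endo unfolding endo_field_def linear_within_def by blast+

lemma \<eta>_add: "x \<in> T p \<Longrightarrow> y \<in> T p \<Longrightarrow> \<eta> p (x + y) = \<eta> p x + \<eta> p y"
    and \<eta>_scale: "x \<in> T p \<Longrightarrow> \<eta> p (k *\<^sub>R x) = k * \<eta> p x"
    and \<eta>_smooth: "open U \<Longrightarrow> vf U X \<Longrightarrow> smooth U (\<lambda>p. \<eta> p (X p))"
  using one_form unfolding one_form_def linear_within_def real_scaleR_def by blast+

lemma bilinear: "bilinear_field A g"
  using srm by (simp add: semi_riemannian_metric_def)

lemma g_sym: "x \<in> T p \<Longrightarrow> y \<in> T p \<Longrightarrow> g p x y = g p y x"
    and g_nondegenerate: "x \<in> T p \<Longrightarrow> (\<And>y. y \<in> T p \<Longrightarrow> g p x y = 0) \<Longrightarrow> x = 0"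
  using srm unfolding semi_riemannian_metric_def by blast+

lemma g_add_left: "x \<in> T p \<Longrightarrow> y \<in> T p \<Longrightarrow> z \<in> T p \<Longrightarrow> g p (x + y) z = g p x z + g p y z"
    and g_add_right: "x \<in> T p \<Longrightarrow> y \<in> T p \<Longrightarrow> z \<in> T p \<Longrightarrow> g p z (x + y) = g p z x + g p z y"
    and g_scale_left: "x \<in> T p \<Longrightarrow> z \<in> T p \<Longrightarrow> g p (k *\<^sub>R x) z = k * g p x z"
    and g_scale_right: "x \<in> T p \<Longrightarrow> z \<in> T p \<Longrightarrow> g p z (k *\<^sub>R x) = k * g p z x"
    and g_smooth: "open U \<Longrightarrow> vf U X \<Longrightarrow> vf U Y \<Longrightarrow> smooth U (\<lambda>p. g p (X p) (Y p))"
  using bilinear unfolding bilinear_field_def linear_within_def real_scaleR_def by blast+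

lemma \<phi>_minus: "x \<in> T p \<Longrightarrow> \<phi> p (- x) = - \<phi> p x"
    and \<eta>_minus: "x \<in> T p \<Longrightarrow> \<eta> p (- x) = - \<eta> p x"
    and g_minus_left: "x \<in> T p \<Longrightarrow> z \<in> T p \<Longrightarrow> g p (- x) z = - g p x z"
    and g_minus_right: "x \<in> T p \<Longrightarrow> z \<in> T p \<Longrightarrow> g p z (- x) = - g p z x"
  using \<phi>_scale[of x p "-1"] \<eta>_scale[of x p "-1"] g_scale_left[of x p z "-1"]
    g_scale_right[of x p z "-1"] by simp_all

lemma \<phi>_diff: "x \<in> T p \<Longrightarrow> y \<in> T p \<Longrightarrow> \<phi> p (x - y) = \<phi> p x - \<phi> p y"
    and \<eta>_diff: "x \<in> T p \<Longrightarrow> y \<in> T p \<Longrightarrow> \<eta> p (x - y) = \<eta> p x - \<eta> p y"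
    and g_diff_left: "x \<in> T p \<Longrightarrow> y \<in> T p \<Longrightarrow> z \<in> T p \<Longrightarrow> g p (x - y) z = g p x z - g p y z"
    and g_diff_right: "x \<in> T p \<Longrightarrow> y \<in> T p \<Longrightarrow> z \<in> T p \<Longrightarrow> g p z (x - y) = g p z x - g p z y"
  using \<phi>_add[of x p "- y"] \<eta>_add[of x p "- y"] g_add_left[of x p "- y" z]
    g_add_right[of x p "- y" z]
  by (simp_all add: \<phi>_minus \<eta>_minus g_minus_left g_minus_right)

lemma zero_simps [simp]: "\<phi> p 0 = 0" "\<eta> p 0 = 0" "x \<in> T p \<Longrightarrow> g p 0 x = 0" "x \<in> T p \<Longrightarrow> g p x 0 = 0"
  using \<phi>_scale[of 0 p 0] \<eta>_scale[of 0 p 0] g_scale_left[of 0 p x 0] g_scale_right[of 0 p x 0]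
  by simp_all

lemmas linear_simps = \<phi>_add \<phi>_scale \<phi>_minus \<phi>_diff \<eta>_add \<eta>_scale \<eta>_minus \<eta>_diff
  g_add_left g_scale_left g_minus_left g_diff_left
  g_add_right g_scale_right g_minus_right g_diff_right

text \<open>Computing the cube of \<phi> in two ways shows that \<phi> \<xi> is a multiple of \<xi>;
  since \<phi> applied twice kills \<xi>, the square of the multiple vanishes.\<close>

lemma \<phi>_\<xi> [simp]: "\<phi> p (\<xi> p) = 0" and \<eta>_\<phi> [simp]: "x \<in> T p \<Longrightarrow> \<eta> p (\<phi> p x) = 0"
proof -
  have *: "\<eta> p x *\<^sub>R \<phi> p (\<xi> p) = \<eta> p (\<phi> p x) *\<^sub>R \<xi> p" if "x \<in> T p" for x
    using \<phi>_\<phi>[of "\<phi> p x" p] arg_cong[OF \<phi>_\<phi>[OF that], of "\<phi> p"] that by (simp add: linear_simps)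
  have 1: "\<phi> p (\<xi> p) = \<eta> p (\<phi> p (\<xi> p)) *\<^sub>R \<xi> p" using *[of "\<xi> p"] by simp
  have "0 = \<phi> p (\<phi> p (\<xi> p))" using \<phi>_\<phi>[of "\<xi> p" p] by simp
  also have "\<dots> = \<eta> p (\<phi> p (\<xi> p)) *\<^sub>R \<phi> p (\<xi> p)"
    using arg_cong[OF 1, of "\<phi> p"] by (simp add: linear_simps)
  finally have "\<eta> p (\<phi> p (\<xi> p)) = 0"
    using arg_cong[of 0 "\<eta> p (\<phi> p (\<xi> p)) *\<^sub>R \<phi> p (\<xi> p)" "\<eta> p"] by (simp add: linear_simps)
  then show 2: "\<phi> p (\<xi> p) = 0" using 1 by simp
  show "\<eta> p (\<phi> p x) = 0" if "x \<in> T p"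
    using arg_cong[OF *[OF that], of "\<eta> p"] 2 that by (simp add: linear_simps)
qed

lemma g_\<phi>_\<phi>: "x \<in> T p \<Longrightarrow> y \<in> T p \<Longrightarrow> g p (\<phi> p x) (\<phi> p y) = - g p x y + \<eta> p x * \<eta> p y"
  using apm unfolding almost_paracontact_metric_def by blast

lemma g_\<xi> [simp]: "x \<in> T p \<Longrightarrow> g p x (\<xi> p) = \<eta> p x" "x \<in> T p \<Longrightarrow> g p (\<xi> p) x = \<eta> p x"
proof -
  show 1: "g p x (\<xi> p) = \<eta> p x" if "x \<in> T p" for x using g_\<phi>_\<phi>[OF that, of "\<xi> p"] that by simp
  show "g p (\<xi> p) x = \<eta> p x" if "x \<in> T p" using 1[OF that] g_sym[OF that \<xi>_T] by simp
qed

lemma nabla_facts: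
  assumes "open U" "vf U X" "vf U Y"
  shows "vf U (nabla X Y)"
    and "vf U X' \<Longrightarrow> vf U Y' \<Longrightarrow> (\<And>q. q \<in> U \<Longrightarrow> X' q = X q) \<Longrightarrow> (\<And>q. q \<in> U \<Longrightarrow> Y' q = Y q) \<Longrightarrow>
      p \<in> U \<Longrightarrow> nabla X' Y' p = nabla X Y p"
    and "vf U Z \<Longrightarrow> p \<in> U \<Longrightarrow> nabla (\<lambda>q. X q + Z q) Y p = nabla X Y p + nabla Z Y p"
    and "smooth U f \<Longrightarrow> p \<in> U \<Longrightarrow> nabla (\<lambda>q. f q *\<^sub>R X q) Y p = f p *\<^sub>R nabla X Y p"
    and "p \<in> U \<Longrightarrow> nabla X Y p - nabla Y X p = bracket X Y p"
    and "vf U Z \<Longrightarrow> p \<in> U \<Longrightarrow>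
      X p (\<lambda>q. g q (Y q) (Z q)) = g p (nabla X Y p) (Z p) + g p (Y p) (nabla X Z p)"
proof -
  have ac: "affine_connection A nabla" using levi_civita unfolding levi_civita_def by blast
  note ac' = ac[unfolded affine_connection_def, rule_format, OF assms]
  show "vf U (nabla X Y)"
    and "vf U X' \<Longrightarrow> vf U Y' \<Longrightarrow> (\<And>q. q \<in> U \<Longrightarrow> X' q = X q) \<Longrightarrow> (\<And>q. q \<in> U \<Longrightarrow> Y' q = Y q) \<Longrightarrow>
      p \<in> U \<Longrightarrow> nabla X' Y' p = nabla X Y p"
    and "vf U Z \<Longrightarrow> p \<in> U \<Longrightarrow> nabla (\<lambda>q. X q + Z q) Y p = nabla X Y p + nabla Z Y p"
    and "smooth U f \<Longrightarrow> p \<in> U \<Longrightarrow> nabla (\<lambda>q. f q *\<^sub>R X q) Y p = f p *\<^sub>R nabla X Y p"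
    using ac' by blast+
  show "p \<in> U \<Longrightarrow> nabla X Y p - nabla Y X p = bracket X Y p"
    using levi_civita[unfolded levi_civita_def] assms by blast
  show "vf U Z \<Longrightarrow> p \<in> U \<Longrightarrow>
      X p (\<lambda>q. g q (Y q) (Z q)) = g p (nabla X Y p) (Z p) + g p (Y p) (nabla X Z p)"
    using levi_civita[unfolded levi_civita_def] assms by blast
qed

lemmas nabla_vf = nabla_facts(1) and nabla_cong = nabla_facts(2) and nabla_add_left = nabla_facts(3)
  and nabla_scale_left = nabla_facts(4) and torsion_free = nabla_facts(5) and metric = nabla_facts(6)

text \<open>Torsion-freeness writes the bracket as a difference of two fields already known to be
  smooth.\<close>

lemma bracket_vf:
  assumes "open U" "vf U X" "vf U Y"
  shows "vf U (bracket X Y)"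
  by (rule vf_cong[OF vf_diff[OF assms(1) nabla_vf[OF assms] nabla_vf[OF assms(1,3,2)]]])
    (rule torsion_free[OF assms])

lemma paracontact:
  assumes "open U" "vf U X" "vf U Y" "p \<in> U"
  shows "X p (\<lambda>q. \<eta> q (Y q)) - Y p (\<lambda>q. \<eta> q (X q)) - \<eta> p (bracket X Y p) = 2 * g p (X p) (\<phi> p (Y p))"
proof -
  have "ext_deriv A \<eta> X Y p = g p (X p) (\<phi> p (Y p))"
    using para_sasakian[unfolded para_sasakian_def paracontact_metric_def fundamental_form_def] assms
    by blast
  then show ?thesis by (simp add: ext_deriv_def)
qed

lemma normal:
  assumes "open U" "vf U X" "vf U Y" "p \<in> U"
  shows "nijenhuis A \<phi> X Y p = (2 * g p (X p) (\<phi> p (Y p))) *\<^sub>R \<xi> p"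
proof -
  have "nijenhuis A \<phi> X Y p - (2 * ext_deriv A \<eta> X Y p) *\<^sub>R \<xi> p = 0"
    using para_sasakian assms unfolding para_sasakian_def normal_structure_def by blast
  then show ?thesis using paracontact[OF assms] by (simp add: ext_deriv_def)
qed

section \<open>Eigenlines of \<phi> and existence of null frames\<close>

definition E :: "real \<Rightarrow> 'a \<Rightarrow> 'a tvec set" where
  "E s p = {x \<in> T p. \<eta> p x = 0 \<and> \<phi> p x = s *\<^sub>R x}"

text \<open>For s = 1 and s = -1 this is twice the projection onto \<open>E s p\<close> along \<xi>
  and the opposite eigenline.\<close>

definition proj :: "real \<Rightarrow> 'a \<Rightarrow> 'a tvec \<Rightarrow> 'a tvec" where
  "proj s p x = x - \<eta> p x *\<^sub>R \<xi> p + s *\<^sub>R \<phi> p x"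

text \<open>The model space \<open>real^3\<close> forces n = 1 in the dimension condition of the
  structure.\<close>

lemma E_line:
  assumes "s = 1 \<or> s = -1"
  obtains b where "E s p = span {b}"
proof -
  have "dim (E s p) = 1"
    using apc assms unfolding almost_paracontact_def E_def by auto
  moreover have "subspace (E s p)"
    unfolding subspace_def E_def by (auto simp: linear_simps algebra_simps)
  moreover obtain B where B: "B \<subseteq> E s p" "independent B" "E s p \<subseteq> span B" "card B = dim (E s p)"
    using basis_exists by blast
  ultimately obtain b where "B = {b}" by (metis card_1_singletonE)
  then have "E s p = span {b}"
    using B span_minimal[OF B(1)] \<open>subspace (E s p)\<close> by blast
  then show ?thesis using that by blast
qed

lemma E_multiple:
  assumes "s = 1 \<or> s = -1" "x \<in> E s p" "y \<in> E s p" "y \<noteq> 0"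
  obtains k where "x = k *\<^sub>R y"
proof -
  obtain b where b: "E s p = span {b}" using E_line[OF assms(1)] .
  obtain k l where kl: "x = k *\<^sub>R b" "y = l *\<^sub>R b"
    using assms(2,3) unfolding b span_singleton by blast
  then have "x = (k / l) *\<^sub>R y" using assms(4) by auto
  then show ?thesis using that by blast
qed

lemma proj_E:
  assumes "s = 1 \<or> s = -1" "x \<in> T p"
  shows "proj s p x \<in> E s p"
  using assms unfolding proj_def E_def by (auto simp: linear_simps \<phi>_\<phi>)

lemma proj_decomp:
  "x = \<eta> p x *\<^sub>R \<xi> p + (1/2) *\<^sub>R proj 1 p x + (1/2) *\<^sub>R proj (-1) p x"
proof -
  have "proj 1 p x + proj (-1) p x = 2 *\<^sub>R (x - \<eta> p x *\<^sub>R \<xi> p)"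
    by (simp add: proj_def scaleR_2)
  then have "(1/2) *\<^sub>R proj 1 p x + (1/2) *\<^sub>R proj (-1) p x = x - \<eta> p x *\<^sub>R \<xi> p"
    by (simp flip: scaleR_add_right)
  then show ?thesis by (simp add: algebra_simps)
qed

lemma proj_vf:
  assumes "open U" "vf U X"
  shows "vf U (\<lambda>q. proj s q (X q))"
  unfolding proj_def
  by (intro vf_add vf_diff vf_scale assms \<xi>_vf_on \<phi>_vf \<eta>_smooth smooth_const)

text \<open>Projected coordinate fields are smooth sections of \<open>E s\<close>. If all of them
  vanished at \<open>p\<close>, three independent tangent vectors would lie in the span of \<xi> and
  one vector of the opposite eigenline.\<close>

lemma exists_eigenfield:
  assumes s: "s = 1 \<or> s = -1"
  obtains U X where "open U" "p \<in> U" "vf U X" "\<And>q. q \<in> U \<Longrightarrow> X q \<in> E s q" "X p \<noteq> 0"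
proof -
  obtain U c where c: "(U, c) \<in> A" "p \<in> U" using chart_at .
  note U = chartD(1)[OF c(1)]
  let ?C = "\<lambda>b. coord_field U c b p"
  have "\<exists>b\<in>Basis. proj s p (?C b) \<noteq> 0"
  proof (rule ccontr)
    assume "\<not> (\<exists>b\<in>Basis. proj s p (?C b) \<noteq> 0)"
    then have 0: "proj s p (?C b) = 0" if "b \<in> Basis" for b using that by blast
    have s': "- s = 1 \<or> - s = -1" using s by auto
    obtain y where y: "E (- s) p = span {y}" using E_line[OF s'] .
    have "?C b \<in> span {\<xi> p, y}" if b: "b \<in> Basis" for b
    proof -
      have "?C b = \<eta> p (?C b) *\<^sub>R \<xi> p + (1/2) *\<^sub>R proj (- s) p (?C b)"
        using proj_decomp[of "?C b" p] 0[OF b] s by auto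
      moreover have "proj (- s) p (?C b) \<in> span {\<xi> p, y}"
        using proj_E[OF s' vf_tangent[OF coord_field_vf[OF c(1)] c(2)]] y span_mono[of "{y}" "{\<xi> p, y}"]
        by auto
      ultimately show ?thesis
        by (metis insertI1 span_add span_base span_scale)
    qed
    then have "card (?C ` Basis) \<le> card {\<xi> p, y}"
      using independent_span_bound[of "{\<xi> p, y}" "?C ` Basis"] coord_fields_independent(1)[OF c] by auto
    also have "\<dots> \<le> 2" by (simp add: card_insert_if)
    finally show False using coord_fields_independent(2)[OF c] by simp
  qed
  then obtain b where "proj s p (?C b) \<noteq> 0" by blast
  then show ?thesis
    using that[OF U c(2) proj_vf[OF U coord_field_vf[OF c(1)]]]
      proj_E[OF s vf_tangent[OF coord_field_vf[OF c(1)]]] by blast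
qed

text \<open>On an eigenline \<phi> scales both arguments by \<open>s\<close>, so compatibility of
  the metric reads \<open>g p x y = - g p x y\<close>.\<close>

lemma g_E_self:
  assumes "s = 1 \<or> s = -1" "x \<in> E s p" "y \<in> E s p"
  shows "g p x y = 0"
  using g_\<phi>_\<phi>[of x p y] assms unfolding E_def by (auto simp: linear_simps)

end

locale para_sasakian_frame = para_sasakian_3 A \<phi> \<xi> \<eta> g nabla
  for A :: "('a::{t2_space,second_countable_topology}, real^3) atlas"
    and \<phi> \<xi> \<eta> g nabla +
  fixes U :: "'a set" and e1 e2 :: "'a vfield"
  assumes open_U: "open U" and e_vf: "vf U e1" "vf U e2"
    and e1_E: "\<And>q. q \<in> U \<Longrightarrow> e1 q \<in> E 1 q" and e2_E: "\<And>q. q \<in> U \<Longrightarrow> e2 q \<in> E (-1) q"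
    and g_e1_e2: "\<And>q. q \<in> U \<Longrightarrow> g q (e1 q) (e2 q) = 1"

context para_sasakian_3
begin

text \<open>Were \<open>e1\<close> and \<open>e2\<close> orthogonal at \<open>p\<close>, then
  \<open>e1\<close> would be orthogonal to \<xi> and to both eigenlines, against nondegeneracy. So
  the pairing is nonzero near \<open>p\<close>, and dividing \<open>e2\<close> by it normalises the
  frame.\<close>

lemma exists_frame:
  assumes "open U'" "p \<in> U'"
  obtains U e1 e2 where "para_sasakian_frame A \<phi> \<xi> \<eta> g nabla U e1 e2" "p \<in> U" "U \<subseteq> U'"
proof -
  obtain U1 e1 where 1: "open U1" "p \<in> U1" "vf U1 e1" "\<And>q. q \<in> U1 \<Longrightarrow> e1 q \<in> E 1 q" "e1 p \<noteq> 0"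
    using exists_eigenfield[of 1 p] by blast
  obtain U2 e2 where 2: "open U2" "p \<in> U2" "vf U2 e2" "\<And>q. q \<in> U2 \<Longrightarrow> e2 q \<in> E (-1) q" "e2 p \<noteq> 0"
    using exists_eigenfield[of "-1" p] by blast
  define \<mu> where "\<mu> q = g q (e1 q) (e2 q)" for q
  have T12: "e1 p \<in> T p" "e2 p \<in> T p" using 1(2,4) 2(2,4) by (auto simp: E_def)
  have "\<mu> p \<noteq> 0"
  proof
    assume 0: "\<mu> p = 0"
    have "g p (e1 p) x = 0" if x: "x \<in> T p" for x
    proof -
      note P = proj_E[of 1 x p] proj_E[of "-1" x p]
      obtain k where k: "proj (-1) p x = k *\<^sub>R e2 p"
        using E_multiple[of "-1" "proj (-1) p x" p "e2 p"] P(2) x 2(2,4,5) by auto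
      have "g p (e1 p) (proj 1 p x) = 0"
        using g_E_self[of 1 "e1 p" p] P(1) x 1(2,4) by auto
      moreover have "g p (e1 p) (proj (-1) p x) = 0"
        unfolding k using T12 0 by (simp add: linear_simps \<mu>_def)
      moreover have "g p (e1 p) (\<xi> p) = 0" using T12 1(2,4) by (auto simp: E_def)
      ultimately show ?thesis
        using T12 P x by (subst proj_decomp[of x p]) (auto simp: linear_simps E_def)
    qed
    then show False using g_nondegenerate[OF T12(1)] 1(5) by blast
  qed
  define W where "W = U1 \<inter> U2 \<inter> U'"
  have W: "open W" "p \<in> W" using 1 2 assms by (auto simp: W_def open_Int)
  have vfW: "vf W e1" "vf W e2"
    using vf_subset[OF 1(3), of W] vf_subset[OF 2(3), of W] by (auto simp: W_def)
  have \<mu>: "smooth W \<mu>" unfolding \<mu>_def by (rule g_smooth[OF W(1) vfW])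
  define V where "V = {q \<in> W. \<mu> q \<noteq> 0}"
  have V: "open V" "p \<in> V" "V \<subseteq> W"
    using smooth_open_nonzero[OF W(1) \<mu>] W(2) \<open>\<mu> p \<noteq> 0\<close> by (auto simp: V_def)
  have "vf V (\<lambda>q. inverse (\<mu> q) *\<^sub>R e2 q)"
    by (rule vf_scale[OF vf_subset[OF vfW(2) V(3)] smooth_inverse[OF V(1) smooth_subset[OF \<mu> V(3)]]])
      (simp add: V_def)
  moreover have "inverse (\<mu> q) *\<^sub>R e2 q \<in> E (-1) q" "g q (e1 q) (inverse (\<mu> q) *\<^sub>R e2 q) = 1"
    if "q \<in> V" for q
    using 1(4)[of q] 2(4)[of q] that
    by (auto simp: V_def W_def E_def linear_simps simp flip: \<mu>_def)
  ultimately have "para_sasakian_frame A \<phi> \<xi> \<eta> g nabla V e1 (\<lambda>q. inverse (\<mu> q) *\<^sub>R e2 q)"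
    by unfold_locales (use V vf_subset[OF vfW(1)] 1(4) in \<open>auto simp: W_def\<close>)
  then show ?thesis using that V(2,3) W_def by blast
qed

end

section \<open>Connection and curvature in an adapted frame\<close>

context para_sasakian_frame
begin

lemma frame_simps [simp]:
  assumes "q \<in> U"
  shows "e1 q \<in> T q" "e2 q \<in> T q" "\<eta> q (e1 q) = 0" "\<eta> q (e2 q) = 0"
    "\<phi> q (e1 q) = e1 q" "\<phi> q (e2 q) = - e2 q"
    "g q (e1 q) (e1 q) = 0" "g q (e2 q) (e2 q) = 0" "g q (e1 q) (e2 q) = 1" "g q (e2 q) (e1 q) = 1"
proof -
  show 1: "e1 q \<in> T q" "e2 q \<in> T q" "\<eta> q (e1 q) = 0" "\<eta> q (e2 q) = 0"
    "\<phi> q (e1 q) = e1 q" "\<phi> q (e2 q) = - e2 q"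
    using e1_E[OF assms] e2_E[OF assms] by (simp_all add: E_def)
  show "g q (e1 q) (e1 q) = 0" "g q (e2 q) (e2 q) = 0"
    using g_E_self[of 1] g_E_self[of "-1"] e1_E[OF assms] e2_E[OF assms] by blast+
  show "g q (e1 q) (e2 q) = 1" "g q (e2 q) (e1 q) = 1"
    using g_e1_e2[OF assms] g_sym[OF 1(1,2)] by simp_all
qed

text \<open>The two fields are null and pair to 1, so the coefficient of \<open>e1\<close> is found
  by pairing with \<open>e2\<close>, and conversely.\<close>

abbreviation c1 where "c1 q x \<equiv> g q x (e2 q)"
abbreviation c2 where "c2 q x \<equiv> g q x (e1 q)"

lemma expansion:
  assumes q: "q \<in> U" and x: "x \<in> T q"
  shows "x = \<eta> q x *\<^sub>R \<xi> q + c1 q x *\<^sub>R e1 q + c2 q x *\<^sub>R e2 q"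
proof -
  have "e1 q \<noteq> 0" "e2 q \<noteq> 0"
    using frame_simps(1,2,9)[OF q] zero_simps(3,4)[of _ q] by force+
  obtain k where k: "proj 1 q x = k *\<^sub>R e1 q"
    using E_multiple[OF _ proj_E[OF _ x] e1_E[OF q] \<open>e1 q \<noteq> 0\<close>] by auto
  obtain l where l: "proj (-1) q x = l *\<^sub>R e2 q"
    using E_multiple[OF _ proj_E[OF _ x] e2_E[OF q] \<open>e2 q \<noteq> 0\<close>] by auto
  have *: "x = \<eta> q x *\<^sub>R \<xi> q + (k / 2) *\<^sub>R e1 q + (l / 2) *\<^sub>R e2 q"
    using proj_decomp[of x q] unfolding k l by simp
  have kl: "c1 q x = k / 2" "c2 q x = l / 2"
    using arg_cong[OF *, of "c1 q"] arg_cong[OF *, of "c2 q"] q by (simp_all add: linear_simps)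
  show ?thesis unfolding kl by (rule *)
qed

lemma combination_components:
  assumes q: "q \<in> U"
  shows "\<eta> q (x *\<^sub>R \<xi> q + y *\<^sub>R e1 q + z *\<^sub>R e2 q) = x"
    "c1 q (x *\<^sub>R \<xi> q + y *\<^sub>R e1 q + z *\<^sub>R e2 q) = y"
    "c2 q (x *\<^sub>R \<xi> q + y *\<^sub>R e1 q + z *\<^sub>R e2 q) = z"
  using q by (simp_all add: linear_simps)

lemma tangent_eqI:
  assumes "q \<in> U" "x \<in> T q" "y \<in> T q" "\<eta> q x = \<eta> q y" "c1 q x = c1 q y" "c2 q x = c2 q y"
  shows "x = y"
proof -
  have "x = \<eta> q y *\<^sub>R \<xi> q + c1 q y *\<^sub>R e1 q + c2 q y *\<^sub>R e2 q"
    using expansion[OF assms(1,2)] unfolding assms(4-6) .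
  also have "\<dots> = y" by (rule expansion[OF assms(1,3), symmetric])
  finally show ?thesis .
qed

lemma g_components:
  assumes q: "q \<in> U" and "x \<in> T q" "y \<in> T q"
  shows "g q x y = \<eta> q x * \<eta> q y + c1 q x * c2 q y + c2 q x * c1 q y"
  using arg_cong[OF expansion[OF q assms(3)], of "g q x"] assms by (simp add: linear_simps)

section \<open>Structure functions and the Jacobi identity\<close>

definition a where "a q = c1 q (bracket \<xi> e1 q)"
text \<open>Turns out to be \<open>- a\<close>, but only through the Jacobi identity, after all
  three brackets are known.\<close>

definition b where "b q = c2 q (bracket \<xi> e2 q)"
definition \<alpha> where "\<alpha> q = - c2 q (bracket e1 e2 q)"
definition \<beta> where "\<beta> q = c1 q (bracket e1 e2 q)"

lemmas fields = \<xi>_vf_on[of U] e_vf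

lemma bracket_fields: "vf U (bracket \<xi> e1)" "vf U (bracket \<xi> e2)" "vf U (bracket e1 e2)"
    "vf U (bracket e2 \<xi>)"
  by (rule bracket_vf[OF open_U]; fact fields)+

lemma structure_smooth: "smooth U a" "smooth U b" "smooth U \<alpha>" "smooth U \<beta>"
  unfolding a_def b_def \<alpha>_def \<beta>_def
  using smooth_minus[OF open_U g_smooth[OF open_U bracket_fields(3) e_vf(1)]]
    g_smooth[OF open_U bracket_fields(1) e_vf(2)] g_smooth[OF open_U bracket_fields(2) e_vf(1)]
    g_smooth[OF open_U bracket_fields(3) e_vf(2)] by blast+

lemma field_const:
  assumes "vf U X" "q \<in> U" "\<And>q. q \<in> U \<Longrightarrow> f q = k"
  shows "X q f = 0"
  using tangent_cong[OF vf_tangent[OF assms(1,2)] open_U assms(2,3)]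
    tangent_const[OF vf_tangent[OF assms(1,2)]] by simp

text \<open>\<eta> is constant on each frame field, so the contact condition leaves only the bracket
  term; the value 2 is -2 times the pairing of \<open>e1\<close> with
  \<open>\<phi> q (e2 q) = - e2 q\<close>.\<close>

lemma \<eta>_bracket:
  assumes "q \<in> U"
  shows "\<eta> q (bracket \<xi> e1 q) = 0" "\<eta> q (bracket \<xi> e2 q) = 0" "\<eta> q (bracket e1 e2 q) = 2"
proof -
  have z: "X q (\<lambda>q. \<eta> q (\<xi> q)) = 0" "X q (\<lambda>q. \<eta> q (e1 q)) = 0" "X q (\<lambda>q. \<eta> q (e2 q)) = 0"
    if "vf U X" for X
    by (rule field_const[OF that assms], simp)+
  then show "\<eta> q (bracket \<xi> e1 q) = 0" "\<eta> q (bracket \<xi> e2 q) = 0" "\<eta> q (bracket e1 e2 q) = 2"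
    using paracontact[OF open_U fields(1,2) assms] paracontact[OF open_U fields(1,3) assms]
      paracontact[OF open_U fields(2,3) assms] z[OF fields(1)] z[OF fields(2)] z[OF fields(3)] assms
    by (simp_all add: linear_simps)
qed

lemma bracket_zero_left:
  assumes "Y q \<in> T q"
  shows "bracket (\<lambda>q. 0) Y q = 0"
  using tangent_const[OF assms] by (simp add: lie_bracket_def fun_eq_iff zero_fun_def)

text \<open>Normality for the pair \<xi>, \<open>e1\<close> says that the bracket is again fixed by
  \<phi>, because \<phi> \<xi> = 0 and \<phi> e1 = e1; hence it stays in the eigenline.\<close>

lemma bracket_\<xi>_e1:
  assumes q: "q \<in> U"
  shows "bracket \<xi> e1 q = a q *\<^sub>R e1 q"
proof -
  let ?B = "bracket \<xi> e1 q"
  have B: "?B \<in> T q" by (rule vf_tangent[OF bracket_fields(1) q])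
  have "bracket (\<lambda>q. 0) (\<lambda>q. \<phi> q (e1 q)) q = 0" "bracket (\<lambda>q. 0) e1 q = 0"
    by (rule bracket_zero_left; use q in simp)+
  moreover have "bracket \<xi> (\<lambda>q. \<phi> q (e1 q)) q = ?B"
    by (rule bracket_cong[OF open_U q fields(1) e_vf(1), symmetric]) simp_all
  ultimately have "\<phi> q (\<phi> q ?B) - \<phi> q ?B = 0"
    using normal[OF open_U fields(1,2) q] q by (simp add: nijenhuis_def)
  then have "\<phi> q ?B = ?B" using \<phi>_\<phi>[OF B] \<eta>_bracket(1)[OF q] by simp
  then have "?B \<in> E 1 q" using B \<eta>_bracket(1)[OF q] by (simp add: E_def)
  then have "c2 q ?B = 0" using g_E_self[of 1] e1_E[OF q] by blast
  then show ?thesis using expansion[OF q B] \<eta>_bracket(1)[OF q] by (simp add: a_def)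
qed

lemma bracket_\<xi>_e2_b:
  assumes q: "q \<in> U"
  shows "bracket \<xi> e2 q = b q *\<^sub>R e2 q"
proof -
  let ?B = "bracket \<xi> e2 q"
  have B: "?B \<in> T q" by (rule vf_tangent[OF bracket_fields(2) q])
  have "bracket (\<lambda>q. 0) (\<lambda>q. \<phi> q (e2 q)) q = 0" "bracket (\<lambda>q. 0) e2 q = 0"
    by (rule bracket_zero_left; use q in simp)+
  moreover have "bracket \<xi> (\<lambda>q. \<phi> q (e2 q)) q = bracket \<xi> (\<lambda>q. (-1) *\<^sub>R e2 q) q"
    by (rule bracket_cong[OF open_U q fields(1) \<phi>_vf[OF open_U e_vf(2)]]) simp_all
  then have "bracket \<xi> (\<lambda>q. \<phi> q (e2 q)) q = - ?B"
    using bracket_scale_right[OF open_U q fields(1) e_vf(2) smooth_const[OF open_U, of "-1"]]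
      field_const[OF fields(1) q, of "\<lambda>q. -1"] by simp
  ultimately have "\<phi> q (\<phi> q ?B) + \<phi> q ?B = 0"
    using normal[OF open_U fields(1,3) q] q B by (simp add: nijenhuis_def linear_simps)
  then have "\<phi> q ?B = - ?B" using \<phi>_\<phi>[OF B] \<eta>_bracket(2)[OF q]
    by (simp add: eq_neg_iff_add_eq_0 add.commute)
  then have "?B \<in> E (-1) q" using B \<eta>_bracket(2)[OF q] by (simp add: E_def)
  then have "c1 q ?B = 0" using g_E_self[of "-1"] e2_E[OF q] by blast
  then show ?thesis using expansion[OF q B] \<eta>_bracket(2)[OF q] by (simp add: b_def)
qed

lemma bracket_e1_e2:
  assumes q: "q \<in> U"
  shows "bracket e1 e2 q = 2 *\<^sub>R \<xi> q + \<beta> q *\<^sub>R e1 q - \<alpha> q *\<^sub>R e2 q"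
  using expansion[OF q vf_tangent[OF bracket_fields(3) q]] \<eta>_bracket(3)[OF q]
  by (simp add: \<alpha>_def \<beta>_def)

text \<open>These are the \<xi>-, e1- and e2-components of the Jacobi identity for the
  frame.\<close>

lemma structure_equations:
  assumes q: "q \<in> U"
  shows "b q = - a q" "\<xi> q \<beta> + \<beta> q * a q - b q * \<beta> q + e2 q a - a q * \<beta> q = 0"
    "- \<xi> q \<alpha> - \<alpha> q * b q - e1 q b + b q * \<alpha> q + a q * \<alpha> q = 0"
proof -
  note s = structure_smooth
  note s2 = smooth_const[OF open_U, of 2]
  note s\<alpha> = smooth_minus[OF open_U s(3)] and sb = smooth_minus[OF open_U s(2)]
  let ?X = "\<lambda>q. 2 *\<^sub>R \<xi> q" and ?Y = "\<lambda>q. \<beta> q *\<^sub>R e1 q" and ?Z = "\<lambda>q. - \<alpha> q *\<^sub>R e2 q"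
  have vf: "vf U ?X" "vf U ?Y" "vf U ?Z"
    by (rule vf_scale[OF fields(1) s2] vf_scale[OF e_vf(1) s(4)] vf_scale[OF e_vf(2) s\<alpha>])+
  have "bracket \<xi> (bracket e1 e2) q = bracket \<xi> (\<lambda>q. (?X q + ?Y q) + ?Z q) q"
    by (rule bracket_cong[OF open_U q fields(1) bracket_fields(3) refl]) (simp add: bracket_e1_e2)
  also have "\<dots> = bracket \<xi> ?X q + bracket \<xi> ?Y q + bracket \<xi> ?Z q"
    using bracket_add_right[OF open_U q fields(1) vf_add[OF vf(1,2)] vf(3)]
      bracket_add_right[OF open_U q fields(1) vf(1,2)] by simp
  also have "\<dots> = (\<xi> q \<beta> + \<beta> q * a q) *\<^sub>R e1 q + (- \<xi> q \<alpha> - \<alpha> q * b q) *\<^sub>R e2 q"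
    using bracket_scale_right[OF open_U q fields(1) fields(1) s2] field_const[OF fields(1) q, of "\<lambda>q. 2"]
      bracket_scale_right[OF open_U q fields(1) e_vf(1) s(4)]
      bracket_scale_right[OF open_U q fields(1) e_vf(2) s\<alpha>]
      tangent_minus[OF \<xi>_T smooth_atI[OF s(3) open_U q]]
    by (simp add: bracket_self bracket_\<xi>_e1[OF q] bracket_\<xi>_e2_b[OF q] scaleR_add_left
        scaleR_diff_left)
  finally have 1: "bracket \<xi> (bracket e1 e2) q =
    (\<xi> q \<beta> + \<beta> q * a q) *\<^sub>R e1 q + (- \<xi> q \<alpha> - \<alpha> q * b q) *\<^sub>R e2 q" .
  have "bracket e1 (bracket e2 \<xi>) q = bracket e1 (\<lambda>q. - b q *\<^sub>R e2 q) q"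
    by (rule bracket_cong[OF open_U q e_vf(1) bracket_fields(4) refl])
      (simp add: bracket_skew[of e2] bracket_\<xi>_e2_b)
  also have "\<dots> = - e1 q b *\<^sub>R e2 q - b q *\<^sub>R bracket e1 e2 q"
    using bracket_scale_right[OF open_U q e_vf(1) e_vf(2) sb]
      tangent_minus[OF vf_tangent[OF e_vf(1) q] smooth_atI[OF s(2) open_U q]] by simp
  finally have 2: "bracket e1 (bracket e2 \<xi>) q = - e1 q b *\<^sub>R e2 q - b q *\<^sub>R bracket e1 e2 q" .
  have "bracket e2 (bracket \<xi> e1) q = bracket e2 (\<lambda>q. a q *\<^sub>R e1 q) q"
    by (rule bracket_cong[OF open_U q e_vf(2) bracket_fields(1) refl]) (simp add: bracket_\<xi>_e1)
  also have "\<dots> = e2 q a *\<^sub>R e1 q - a q *\<^sub>R bracket e1 e2 q"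
    using bracket_scale_right[OF open_U q e_vf(2) e_vf(1) s(1)] bracket_skew[of e2 e1 q] by simp
  finally have 3: "bracket e2 (bracket \<xi> e1) q = e2 q a *\<^sub>R e1 q - a q *\<^sub>R bracket e1 e2 q" .
  define v where "v = (\<xi> q \<beta> + \<beta> q * a q) *\<^sub>R e1 q + (- \<xi> q \<alpha> - \<alpha> q * b q) *\<^sub>R e2 q
    + (- e1 q b *\<^sub>R e2 q - b q *\<^sub>R (2 *\<^sub>R \<xi> q + \<beta> q *\<^sub>R e1 q - \<alpha> q *\<^sub>R e2 q))
    + (e2 q a *\<^sub>R e1 q - a q *\<^sub>R (2 *\<^sub>R \<xi> q + \<beta> q *\<^sub>R e1 q - \<alpha> q *\<^sub>R e2 q))"
  have "v = 0" using jacobi[OF open_U q fields] unfolding 1 2 3 v_def bracket_e1_e2[OF q] .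
  moreover have "v = (- 2 * b q - 2 * a q) *\<^sub>R \<xi> q
      + (\<xi> q \<beta> + \<beta> q * a q - b q * \<beta> q + e2 q a - a q * \<beta> q) *\<^sub>R e1 q
      + (- \<xi> q \<alpha> - \<alpha> q * b q - e1 q b + b q * \<alpha> q + a q * \<alpha> q) *\<^sub>R e2 q"
    unfolding v_def by (simp add: algebra_simps)
  ultimately have "- 2 * b q - 2 * a q = 0"
    "\<xi> q \<beta> + \<beta> q * a q - b q * \<beta> q + e2 q a - a q * \<beta> q = 0"
    "- \<xi> q \<alpha> - \<alpha> q * b q - e1 q b + b q * \<alpha> q + a q * \<alpha> q = 0"
    using combination_components[OF q] zero_simps(2,3) frame_simps(1,2)[OF q] by metis+
  then show "b q = - a q" "\<xi> q \<beta> + \<beta> q * a q - b q * \<beta> q + e2 q a - a q * \<beta> q = 0"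
    "- \<xi> q \<alpha> - \<alpha> q * b q - e1 q b + b q * \<alpha> q + a q * \<alpha> q = 0"
    by linarith+
qed

sublocale adapted_frame A U \<xi> e1 e2 a \<alpha> \<beta>
proof unfold_locales
  show "open U" "vf U \<xi>" "vf U e1" "vf U e2" "smooth U a" "smooth U \<alpha>" "smooth U \<beta>"
    by (fact open_U fields structure_smooth)+
  fix q assume q: "q \<in> U"
  show "bracket \<xi> e1 q = a q *\<^sub>R e1 q" by (rule bracket_\<xi>_e1[OF q])
  show "bracket \<xi> e2 q = - a q *\<^sub>R e2 q"
    using bracket_\<xi>_e2_b[OF q] structure_equations(1)[OF q] by simp
  show "bracket e1 e2 q = 2 *\<^sub>R \<xi> q + \<beta> q *\<^sub>R e1 q - \<alpha> q *\<^sub>R e2 q" by (rule bracket_e1_e2[OF q])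
  have "e1 q b = e1 q (\<lambda>q. - a q)"
    by (rule tangent_cong[OF vf_tangent[OF e_vf(1) q] open_U q structure_equations(1)])
  also have "\<dots> = - e1 q a"
    by (rule tangent_minus[OF vf_tangent[OF e_vf(1) q] smooth_atI[OF structure_smooth(1) open_U q]])
  finally show "\<xi> q \<alpha> = a q * \<alpha> q + e1 q a"
    using structure_equations(1,3)[OF q] by simp
  show "\<xi> q \<beta> = - a q * \<beta> q - e2 q a"
    using structure_equations(1,2)[OF q] by (simp add: algebra_simps)
qed

section \<open>Coefficients of the Levi-Civita connection\<close>

lemma nabla_T [simp]: "vf U X \<Longrightarrow> vf U Y \<Longrightarrow> q \<in> U \<Longrightarrow> nabla X Y q \<in> T q"
  by (rule vf_tangent[OF nabla_vf[OF open_U]])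

lemma metric_constant:
  assumes "vf U X" "vf U Y" "vf U Z" "\<And>q. q \<in> U \<Longrightarrow> g q (Y q) (Z q) = k" "q \<in> U"
  shows "g q (nabla X Y q) (Z q) + g q (nabla X Z q) (Y q) = 0"
  using metric[OF open_U assms(1-3,5)] field_const[OF assms(1,5,4)]
    g_sym[OF vf_tangent[OF assms(2,5)] nabla_T[OF assms(1,3,5)]] by simp

lemma nabla_frame_components:
  assumes X: "vf U X" and q: "q \<in> U"
  shows "\<eta> q (nabla X \<xi> q) = 0" "c2 q (nabla X e1 q) = 0" "c1 q (nabla X e2 q) = 0"
    "\<eta> q (nabla X e1 q) = - c2 q (nabla X \<xi> q)" "\<eta> q (nabla X e2 q) = - c1 q (nabla X \<xi> q)"
    "c2 q (nabla X e2 q) = - c1 q (nabla X e1 q)"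
proof -
  note T = nabla_T[OF X fields(1) q] nabla_T[OF X fields(2) q] nabla_T[OF X fields(3) q]
  show "\<eta> q (nabla X \<xi> q) = 0"
    using metric_constant[OF X fields(1) fields(1) _ q, of 1] T by simp
  show "c2 q (nabla X e1 q) = 0"
    using metric_constant[OF X fields(2) fields(2) _ q, of 0] T by simp
  show "c1 q (nabla X e2 q) = 0"
    using metric_constant[OF X fields(3) fields(3) _ q, of 0] T by simp
  show "\<eta> q (nabla X e1 q) = - c2 q (nabla X \<xi> q)"
    using metric_constant[OF X fields(1) fields(2) _ q, of 0] T by simp
  show "\<eta> q (nabla X e2 q) = - c1 q (nabla X \<xi> q)"
    using metric_constant[OF X fields(1) fields(3) _ q, of 0] T by simp
  show "c2 q (nabla X e2 q) = - c1 q (nabla X e1 q)"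
    using metric_constant[OF X fields(2) fields(3) _ q, of 1] T by simp
qed

text \<open>Metric compatibility leaves nine unknown coefficients, three per direction; the nine
  components of the three torsion equations determine them, which is the Koszul formula in this
  frame.\<close>

lemma nabla_frame:
  assumes q: "q \<in> U"
  shows "c1 q (nabla \<xi> \<xi> q) = 0" "c2 q (nabla \<xi> \<xi> q) = 0"
    "c1 q (nabla e1 \<xi> q) = - 1" "c2 q (nabla e1 \<xi> q) = 0"
    "c1 q (nabla e2 \<xi> q) = 0" "c2 q (nabla e2 \<xi> q) = 1"
    "c1 q (nabla \<xi> e1 q) = a q - 1" "c1 q (nabla e1 e1 q) = \<alpha> q" "c1 q (nabla e2 e1 q) = - \<beta> q"
proof -
  note nf = nabla_frame_components[OF fields(1) q] nabla_frame_components[OF fields(2) q]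
    nabla_frame_components[OF fields(3) q]
  have t: "nabla \<xi> e1 q - nabla e1 \<xi> q = a q *\<^sub>R e1 q"
    "nabla \<xi> e2 q - nabla e2 \<xi> q = - a q *\<^sub>R e2 q"
    "nabla e1 e2 q - nabla e2 e1 q = 2 *\<^sub>R \<xi> q + \<beta> q *\<^sub>R e1 q - \<alpha> q *\<^sub>R e2 q"
    using torsion_free[OF open_U fields(1,2) q] torsion_free[OF open_U fields(1,3) q]
      torsion_free[OF open_U fields(2,3) q] bracket_\<xi>_e1[OF q] bracket_\<xi>_e2[OF q] bracket_e1_e2[OF q]
    by simp_all
  note comps = arg_cong[of _ _ "\<eta> q"] arg_cong[of _ _ "c1 q"] arg_cong[of _ _ "c2 q"]
  note eqs = comps[OF t(1)] comps[OF t(2)] comps[OF t(3)]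
  note eqs' = eqs[simplified linear_simps nabla_T fields q \<xi>_T T_closed frame_simps nf g_\<xi> \<eta>_\<xi>]
  show "c1 q (nabla \<xi> \<xi> q) = 0" "c2 q (nabla \<xi> \<xi> q) = 0"
    "c1 q (nabla e1 \<xi> q) = - 1" "c2 q (nabla e1 \<xi> q) = 0"
    "c1 q (nabla e2 \<xi> q) = 0" "c2 q (nabla e2 \<xi> q) = 1"
    "c1 q (nabla \<xi> e1 q) = a q - 1" "c1 q (nabla e1 e1 q) = \<alpha> q" "c1 q (nabla e2 e1 q) = - \<beta> q"
    using eqs' by auto
qed

lemma component_smooth:
  assumes "vf U X"
  shows "smooth U (\<lambda>q. \<eta> q (X q))" "smooth U (\<lambda>q. c1 q (X q))" "smooth U (\<lambda>q. c2 q (X q))"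
  by (rule \<eta>_smooth[OF open_U assms] g_smooth[OF open_U assms e_vf(2)]
      g_smooth[OF open_U assms e_vf(1)])+

lemma nabla_left:
  assumes X: "vf U X" and Y: "vf U Y" and q: "q \<in> U"
  shows "nabla X Y q = \<eta> q (X q) *\<^sub>R nabla \<xi> Y q + c1 q (X q) *\<^sub>R nabla e1 Y q
    + c2 q (X q) *\<^sub>R nabla e2 Y q"
proof -
  let ?A = "\<lambda>q. \<eta> q (X q) *\<^sub>R \<xi> q" and ?B = "\<lambda>q. c1 q (X q) *\<^sub>R e1 q"
    and ?C = "\<lambda>q. c2 q (X q) *\<^sub>R e2 q"
  note s = component_smooth[OF X]
  note vf = vf_scale[OF fields(1) s(1)] vf_scale[OF e_vf(1) s(2)] vf_scale[OF e_vf(2) s(3)]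
  have "nabla X Y q = nabla (\<lambda>q. (?A q + ?B q) + ?C q) Y q"
    by (rule nabla_cong[OF open_U vf_add[OF vf_add[OF vf(1,2)] vf(3)] Y X Y _ refl q])
      (rule expansion[OF _ vf_tangent[OF X]])
  also have "\<dots> = nabla ?A Y q + nabla ?B Y q + nabla ?C Y q"
    using nabla_add_left[OF open_U vf_add[OF vf(1,2)] Y vf(3) q] nabla_add_left[OF open_U vf(1) Y vf(2) q]
    by simp
  also have "\<dots> = \<eta> q (X q) *\<^sub>R nabla \<xi> Y q + c1 q (X q) *\<^sub>R nabla e1 Y q
    + c2 q (X q) *\<^sub>R nabla e2 Y q"
    using nabla_scale_left[OF open_U fields(1) Y s(1) q] nabla_scale_left[OF open_U fields(2) Y s(2) q]
      nabla_scale_left[OF open_U fields(3) Y s(3) q] by simp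
  finally show ?thesis .
qed

text \<open>The connection form: \<open>nabla X e1 = w X e1\<close> modulo \<open>\<xi>\<close>.\<close>

definition w :: "'a vfield \<Rightarrow> 'a \<Rightarrow> real" where
  "w X q = (a q - 1) * \<eta> q (X q) + \<alpha> q * c1 q (X q) - \<beta> q * c2 q (X q)"

text \<open>The first two equations are the horizontal part of the para-Sasakian identity
  \<open>nabla X \<xi>\<close> = - \<phi> X.\<close>

lemma nabla_frame_general:
  assumes X: "vf U X" and q: "q \<in> U"
  shows "c1 q (nabla X \<xi> q) = - c1 q (X q)" "c2 q (nabla X \<xi> q) = c2 q (X q)"
    "c1 q (nabla X e1 q) = w X q"
proof -
  note T = nabla_T[OF fields(1) _ q] nabla_T[OF fields(2) _ q] nabla_T[OF fields(3) _ q]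
  note f = fields(1) fields(2) fields(3)
  show "c1 q (nabla X \<xi> q) = - c1 q (X q)" "c2 q (nabla X \<xi> q) = c2 q (X q)"
    unfolding nabla_left[OF X f(1) q]
    using q T[OF f(1)] by (simp_all add: g_add_left g_scale_left nabla_frame)
  show "c1 q (nabla X e1 q) = w X q"
    unfolding nabla_left[OF X f(2) q] w_def
    using q T[OF f(2)] by (simp add: g_add_left g_scale_left nabla_frame algebra_simps)
qed

text \<open>Metric compatibility moves the derivative from \<open>Y\<close> to the frame field it is
  paired with, whose covariant derivative is already known.\<close>

lemma nabla_components:
  assumes X: "vf U X" and Y: "vf U Y" and q: "q \<in> U"
  shows "\<eta> q (nabla X Y q) = X q (\<lambda>q. \<eta> q (Y q)) - c2 q (X q) * c1 q (Y q) + c1 q (X q) * c2 q (Y q)"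
    "c1 q (nabla X Y q) = X q (\<lambda>q. c1 q (Y q)) + w X q * c1 q (Y q) - c1 q (X q) * \<eta> q (Y q)"
    "c2 q (nabla X Y q) = X q (\<lambda>q. c2 q (Y q)) - w X q * c2 q (Y q) + c2 q (X q) * \<eta> q (Y q)"
proof -
  note f = fields(1) fields(2) fields(3)
  note XT = vf_tangent[OF X q] and YT = vf_tangent[OF Y q]
  note n = nabla_frame_components[OF X q] nabla_frame_general[OF X q]
  have "X q (\<lambda>q. g q (Y q) (\<xi> q)) = X q (\<lambda>q. \<eta> q (Y q))"
    by (rule tangent_cong[OF XT open_U q]) (simp add: vf_tangent[OF Y])
  then show "\<eta> q (nabla X Y q) = X q (\<lambda>q. \<eta> q (Y q)) - c2 q (X q) * c1 q (Y q) + c1 q (X q) * c2 q (Y q)"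
    using metric[OF open_U X Y f(1) q] g_components[OF q YT nabla_T[OF X f(1) q]]
      nabla_T[OF X Y q] by (simp add: n algebra_simps)
  show "c1 q (nabla X Y q) = X q (\<lambda>q. c1 q (Y q)) + w X q * c1 q (Y q) - c1 q (X q) * \<eta> q (Y q)"
    using metric[OF open_U X Y f(3) q] g_components[OF q YT nabla_T[OF X f(3) q]]
    by (simp add: n)
  show "c2 q (nabla X Y q) = X q (\<lambda>q. c2 q (Y q)) - w X q * c2 q (Y q) + c2 q (X q) * \<eta> q (Y q)"
    using metric[OF open_U X Y f(2) q] g_components[OF q YT nabla_T[OF X f(2) q]]
    by (simp add: n)
qed

lemma bracket_components:
  assumes X: "vf U X" and Y: "vf U Y" and q: "q \<in> U"
  shows "\<eta> q (bracket X Y q) = \<eta> q (nabla X Y q) - \<eta> q (nabla Y X q)"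
    "c1 q (bracket X Y q) = c1 q (nabla X Y q) - c1 q (nabla Y X q)"
    "c2 q (bracket X Y q) = c2 q (nabla X Y q) - c2 q (nabla Y X q)"
  unfolding torsion_free[OF open_U X Y q, symmetric]
  using q nabla_T[OF X Y q] nabla_T[OF Y X q] by (simp_all add: \<eta>_diff g_diff_left)

lemma apply_expand:
  assumes "vf U X" "q \<in> U"
  shows "X q h = \<eta> q (X q) * \<xi> q h + c1 q (X q) * e1 q h + c2 q (X q) * e2 q h"
  using fun_cong[OF expansion[OF assms(2) vf_tangent[OF assms]], of h]
  by (simp add: plus_fun_def scaleR_fun_def)

lemma bracket_apply_smooth:
  assumes "vf U X" "vf U Y" "q \<in> U" "smooth U h"
  shows "bracket X Y q h = X q (\<lambda>q. Y q h) - Y q (\<lambda>q. X q h)"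
  using smooth_atI[OF assms(4) open_U assms(3)] by (simp add: lie_bracket_def)

section \<open>Curvature in frame components\<close>

lemma w_smooth:
  assumes "vf U X"
  shows "smooth U (\<lambda>q. w X q)"
  unfolding w_def by (intro smooth_rules component_smooth[OF assms])

lemma apply_w:
  assumes X: "vf U X" and Y: "vf U Y" and q: "q \<in> U"
  shows "X q (w Y) = X q a * \<eta> q (Y q) + (a q - 1) * X q (\<lambda>q. \<eta> q (Y q))
    + X q \<alpha> * c1 q (Y q) + \<alpha> q * X q (\<lambda>q. c1 q (Y q))
    - X q \<beta> * c2 q (Y q) - \<beta> q * X q (\<lambda>q. c2 q (Y q))"
proof -
  note s = component_smooth[OF Y]
  have "w Y = (\<lambda>q. (a q - 1) * \<eta> q (Y q) + \<alpha> q * c1 q (Y q) - \<beta> q * c2 q (Y q))"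
    by (simp add: w_def fun_eq_iff)
  then show ?thesis by (simp add: derivation[OF X q] s smooth_rules)
qed

lemma apply_nabla_components:
  assumes X: "vf U X" and Y: "vf U Y" and Z: "vf U Z" and q: "q \<in> U"
  shows "X q (\<lambda>q. \<eta> q (nabla Y Z q)) = X q (\<lambda>q. Y q (\<lambda>q. \<eta> q (Z q)))
      - (X q (\<lambda>q. c2 q (Y q)) * c1 q (Z q) + c2 q (Y q) * X q (\<lambda>q. c1 q (Z q)))
      + (X q (\<lambda>q. c1 q (Y q)) * c2 q (Z q) + c1 q (Y q) * X q (\<lambda>q. c2 q (Z q)))"
    "X q (\<lambda>q. c1 q (nabla Y Z q)) = X q (\<lambda>q. Y q (\<lambda>q. c1 q (Z q)))
      + (X q (w Y) * c1 q (Z q) + w Y q * X q (\<lambda>q. c1 q (Z q)))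
      - (X q (\<lambda>q. c1 q (Y q)) * \<eta> q (Z q) + c1 q (Y q) * X q (\<lambda>q. \<eta> q (Z q)))"
    "X q (\<lambda>q. c2 q (nabla Y Z q)) = X q (\<lambda>q. Y q (\<lambda>q. c2 q (Z q)))
      - (X q (w Y) * c2 q (Z q) + w Y q * X q (\<lambda>q. c2 q (Z q)))
      + (X q (\<lambda>q. c2 q (Y q)) * \<eta> q (Z q) + c2 q (Y q) * X q (\<lambda>q. \<eta> q (Z q)))"
proof -
  note s = component_smooth[OF Y] component_smooth[OF Z] w_smooth[OF Y]
    component_smooth[OF Z, THEN vf_smooth[OF Y open_U order_refl]]
  note d = derivation[OF X q]
  have "X q (\<lambda>q. \<eta> q (nabla Y Z q)) = X q (\<lambda>q. Y q (\<lambda>q. \<eta> q (Z q))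
      - c2 q (Y q) * c1 q (Z q) + c1 q (Y q) * c2 q (Z q))"
    by (rule deriv_cong[OF X q nabla_components(1)[OF Y Z]])
  then show "X q (\<lambda>q. \<eta> q (nabla Y Z q)) = X q (\<lambda>q. Y q (\<lambda>q. \<eta> q (Z q)))
      - (X q (\<lambda>q. c2 q (Y q)) * c1 q (Z q) + c2 q (Y q) * X q (\<lambda>q. c1 q (Z q)))
      + (X q (\<lambda>q. c1 q (Y q)) * c2 q (Z q) + c1 q (Y q) * X q (\<lambda>q. c2 q (Z q)))"
    by (simp add: d s smooth_closed)
  have "X q (\<lambda>q. c1 q (nabla Y Z q)) = X q (\<lambda>q. Y q (\<lambda>q. c1 q (Z q))
      + w Y q * c1 q (Z q) - c1 q (Y q) * \<eta> q (Z q))"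
    by (rule deriv_cong[OF X q nabla_components(2)[OF Y Z]])
  then show "X q (\<lambda>q. c1 q (nabla Y Z q)) = X q (\<lambda>q. Y q (\<lambda>q. c1 q (Z q)))
      + (X q (w Y) * c1 q (Z q) + w Y q * X q (\<lambda>q. c1 q (Z q)))
      - (X q (\<lambda>q. c1 q (Y q)) * \<eta> q (Z q) + c1 q (Y q) * X q (\<lambda>q. \<eta> q (Z q)))"
    by (simp add: d s smooth_closed)
  have "X q (\<lambda>q. c2 q (nabla Y Z q)) = X q (\<lambda>q. Y q (\<lambda>q. c2 q (Z q))
      - w Y q * c2 q (Z q) + c2 q (Y q) * \<eta> q (Z q))"
    by (rule deriv_cong[OF X q nabla_components(3)[OF Y Z]])
  then show "X q (\<lambda>q. c2 q (nabla Y Z q)) = X q (\<lambda>q. Y q (\<lambda>q. c2 q (Z q)))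
      - (X q (w Y) * c2 q (Z q) + w Y q * X q (\<lambda>q. c2 q (Z q)))
      + (X q (\<lambda>q. c2 q (Y q)) * \<eta> q (Z q) + c2 q (Y q) * X q (\<lambda>q. \<eta> q (Z q)))"
    by (simp add: d s smooth_closed)
qed

text \<open>The left side is the exterior derivative of \<open>w\<close>, without the factor 1/2.
  The equations for \<xi> \<alpha> and \<xi> \<beta> are exactly the vanishing of its values on
  (\<xi>, e1) and (\<xi>, e2), so only the (e1, e2) part survives.\<close>

lemma connection_form_curvature:
  assumes X: "vf U X" and Y: "vf U Y" and q: "q \<in> U"
  shows "X q (w Y) - Y q (w X) - w (bracket X Y) q =
    (\<kappa> q - 1) * (c1 q (X q) * c2 q (Y q) - c2 q (X q) * c1 q (Y q))"
proof -
  have \<kappa>: "e1 q \<beta> = 3 - 2 * a q - \<kappa> q - e2 q \<alpha> - 2 * (\<alpha> q * \<beta> q)"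
    by (simp add: \<kappa>_def)
  have *: "w (bracket X Y) q = (a q - 1) * (\<eta> q (nabla X Y q) - \<eta> q (nabla Y X q))
    + \<alpha> q * (c1 q (nabla X Y q) - c1 q (nabla Y X q))
    - \<beta> q * (c2 q (nabla X Y q) - c2 q (nabla Y X q))"
    by (simp add: w_def[of "bracket X Y"] bracket_components[OF X Y q])
  show ?thesis
    unfolding apply_w[OF X Y q] apply_w[OF Y X q] * nabla_components[OF X Y q]
      nabla_components[OF Y X q] w_def[of X q] w_def[of Y q] apply_expand[OF X q, of a]
      apply_expand[OF X q, of \<alpha>] apply_expand[OF X q, of \<beta>] apply_expand[OF Y q, of a]
      apply_expand[OF Y q, of \<alpha>] apply_expand[OF Y q, of \<beta>] \<xi>_\<alpha>[OF q] \<xi>_\<beta>[OF q] \<kappa>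
    by (simp add: algebra_simps)
qed

text \<open>Second derivatives of the components of \<open>Z\<close> cancel against the bracket
  term, and derivatives of the connection form enter only through its exterior derivative. The
  result is split into curvature -1 and a remainder with factor \<kappa> + 1.\<close>

lemma curvature_components:
  assumes X: "vf U X" and Y: "vf U Y" and Z: "vf U Z" and q: "q \<in> U"
  defines "x0 \<equiv> \<eta> q (X q)" and "x1 \<equiv> c1 q (X q)" and "x2 \<equiv> c2 q (X q)"
    and "y0 \<equiv> \<eta> q (Y q)" and "y1 \<equiv> c1 q (Y q)" and "y2 \<equiv> c2 q (Y q)"
    and "z0 \<equiv> \<eta> q (Z q)" and "z1 \<equiv> c1 q (Z q)" and "z2 \<equiv> c2 q (Z q)"
  shows "\<eta> q (curvature A nabla X Y Z q) = - ((y1 * z2 + y2 * z1) * x0 - (x1 * z2 + x2 * z1) * y0)"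
    "c1 q (curvature A nabla X Y Z q) =
      - ((y0 * z0 + y1 * z2 + y2 * z1) * x1 - (x0 * z0 + x1 * z2 + x2 * z1) * y1)
      + (\<kappa> q + 1) * ((y1 * z2 + y2 * z1) * x1 - (x1 * z2 + x2 * z1) * y1)"
    "c2 q (curvature A nabla X Y Z q) =
      - ((y0 * z0 + y1 * z2 + y2 * z1) * x2 - (x0 * z0 + x1 * z2 + x2 * z1) * y2)
      + (\<kappa> q + 1) * ((y1 * z2 + y2 * z1) * x2 - (x1 * z2 + x2 * z1) * y2)"
proof -
  note B = bracket_vf[OF open_U X Y]
  note YZ = nabla_vf[OF open_U Y Z] and XZ = nabla_vf[OF open_U X Z]
  have cT: "nabla X (nabla Y Z) q \<in> T q" "nabla Y (nabla X Z) q \<in> T q"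
    "nabla (bracket X Y) Z q \<in> T q"
    using nabla_T[OF X YZ q] nabla_T[OF Y XZ q] nabla_T[OF B Z q] .
  have s: "smooth U (\<lambda>q. \<eta> q (Z q))" "smooth U (\<lambda>q. c1 q (Z q))" "smooth U (\<lambda>q. c2 q (Z q))"
    by (rule component_smooth[OF Z])+
  note rules = nabla_components[OF X YZ q] nabla_components[OF Y XZ q] nabla_components[OF B Z q]
    apply_nabla_components[OF X Y Z q] apply_nabla_components[OF Y X Z q]
    bracket_apply_smooth[OF X Y q s(1)] bracket_apply_smooth[OF X Y q s(2)]
    bracket_apply_smooth[OF X Y q s(3)]
    bracket_components[OF X Y q]
  note rules2 = nabla_components[OF X Y q] nabla_components[OF Y X q]
    nabla_components[OF X Z q] nabla_components[OF Y Z q]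
  note defs = x0_def x1_def x2_def y0_def y1_def y2_def z0_def z1_def z2_def
  have dw: "w (bracket X Y) q = X q (w Y) - Y q (w X)
    - (\<kappa> q - 1) * (c1 q (X q) * c2 q (Y q) - c2 q (X q) * c1 q (Y q))"
    using connection_form_curvature[OF X Y q] by simp
  show "\<eta> q (curvature A nabla X Y Z q) = - ((y1 * z2 + y2 * z1) * x0 - (x1 * z2 + x2 * z1) * y0)"
    unfolding curvature_def defs \<eta>_diff[OF T_closed(5)[OF cT(1,2)] cT(3)] \<eta>_diff[OF cT(1,2)]
      rules rules2 dw w_def[of X q] w_def[of Y q]
    by (simp add: algebra_simps)
  show "c1 q (curvature A nabla X Y Z q) =
      - ((y0 * z0 + y1 * z2 + y2 * z1) * x1 - (x0 * z0 + x1 * z2 + x2 * z1) * y1)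
      + (\<kappa> q + 1) * ((y1 * z2 + y2 * z1) * x1 - (x1 * z2 + x2 * z1) * y1)"
    unfolding curvature_def defs g_diff_left[OF T_closed(5)[OF cT(1,2)] cT(3) frame_simps(2)[OF q]]
      g_diff_left[OF cT(1,2) frame_simps(2)[OF q]]
      rules rules2 dw w_def[of X q] w_def[of Y q]
    by (simp add: algebra_simps)
  show "c2 q (curvature A nabla X Y Z q) =
      - ((y0 * z0 + y1 * z2 + y2 * z1) * x2 - (x0 * z0 + x1 * z2 + x2 * z1) * y2)
      + (\<kappa> q + 1) * ((y1 * z2 + y2 * z1) * x2 - (x1 * z2 + x2 * z1) * y2)"
    unfolding curvature_def defs g_diff_left[OF T_closed(5)[OF cT(1,2)] cT(3) frame_simps(1)[OF q]]
      g_diff_left[OF cT(1,2) frame_simps(1)[OF q]]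
      rules rules2 dw w_def[of X q] w_def[of Y q]
    by (simp add: algebra_simps)
qed

end

section \<open>Traces, Ricci and scalar curvature\<close>

lemma linear_within_sum:
  assumes T: "subspace T" and L: "linear_within T L" and I: "finite I" "\<And>i. i \<in> I \<Longrightarrow> x i \<in> T"
  shows "L (\<Sum>i\<in>I. f i *\<^sub>R x i) = (\<Sum>i\<in>I. f i *\<^sub>R L (x i))"
  using I
proof (induction I)
  case empty
  have "L (0 *\<^sub>R 0) = 0 *\<^sub>R L 0"
    using L subspace_0[OF T] unfolding linear_within_def by blast
  then show ?case by simp
next
  case (insert i I)
  have "(\<Sum>i\<in>I. f i *\<^sub>R x i) \<in> T"
    by (intro subspace_sum[OF T] subspace_scale[OF T]) (use insert.prems in blast)
  then have "L (f i *\<^sub>R x i + (\<Sum>i\<in>I. f i *\<^sub>R x i)) = L (f i *\<^sub>R x i) + L (\<Sum>i\<in>I. f i *\<^sub>R x i)"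
    using L subspace_scale[OF T insert.prems[of i]] unfolding linear_within_def by blast
  moreover have "L (f i *\<^sub>R x i) = f i *\<^sub>R L (x i)"
    using L insert.prems[of i] unfolding linear_within_def by blast
  ultimately show ?case using insert by simp
qed

text \<open>\<open>trace_on\<close> refers to an unspecified basis. The identity is the sum of the
  tensors \<theta> i times b i, so expanding basis elements this way and swapping the two sums moves
  the trace to the given family.\<close>

lemma trace_on_dual_basis:
  fixes T :: "'v::real_vector set" and b :: "'i \<Rightarrow> 'v" and \<theta> :: "'i \<Rightarrow> 'v \<Rightarrow> real"
  assumes T: "subspace T" and I: "finite I" "\<And>i. i \<in> I \<Longrightarrow> b i \<in> T"
    and \<theta>: "\<And>i. i \<in> I \<Longrightarrow> linear_within T (\<theta> i)"
    and decomp: "\<And>x. x \<in> T \<Longrightarrow> x = (\<Sum>i\<in>I. \<theta> i x *\<^sub>R b i)"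
    and L: "linear_within T L" "\<And>x. x \<in> T \<Longrightarrow> L x \<in> T"
  shows "trace_on T L = (\<Sum>i\<in>I. \<theta> i (L (b i)))"
proof -
  define B where "B = (SOME B. B \<subseteq> T \<and> independent B \<and> span B = T)"
  obtain B0 where B0: "B0 \<subseteq> T" "independent B0" "T \<subseteq> span B0"
    by (rule basis_exists[of T])
  then have "B0 \<subseteq> T \<and> independent B0 \<and> span B0 = T"
    using span_minimal[OF B0(1) T] by (simp add: subset_antisym)
  then have "B \<subseteq> T \<and> independent B \<and> span B = T" unfolding B_def by (rule someI)
  then have B: "B \<subseteq> T" "independent B" "span B = T" by simp_all
  have "x \<in> span (b ` I)" if "x \<in> B" for x
  proof -
    have "(\<Sum>i\<in>I. \<theta> i x *\<^sub>R b i) \<in> span (b ` I)"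
      by (intro span_sum span_scale span_base imageI)
    then show ?thesis by (subst decomp[OF subsetD[OF B(1) that]])
  qed
  \<comment> \<open>A sum over an infinite basis would default to 0; independence inside the span of
    a finite family excludes this.\<close>
  then have fin: "finite B"
    using independent_span_bound[OF finite_imageI[OF I(1)] B(2)] by blast
  have Lb: "L (b i) \<in> span B" if "i \<in> I" for i using L(2) I(2) that B(3) by blast
  have "representation B (L x) x = (\<Sum>i\<in>I. \<theta> i x * representation B (L (b i)) x)" if x: "x \<in> B" for x
  proof -
    have "L x = L (\<Sum>i\<in>I. \<theta> i x *\<^sub>R b i)"
      by (rule arg_cong[OF decomp[OF subsetD[OF B(1) x]]])
    also have "\<dots> = (\<Sum>i\<in>I. \<theta> i x *\<^sub>R L (b i))" by (rule linear_within_sum[OF T L(1) I])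
    finally show ?thesis
      using B(2) Lb by (simp add: representation_sum representation_scale span_scale)
  qed
  then have "trace_on T L = (\<Sum>x\<in>B. \<Sum>i\<in>I. \<theta> i x * representation B (L (b i)) x)"
    by (simp add: trace_on_def Let_def flip: B_def)
  also have "\<dots> = (\<Sum>i\<in>I. \<Sum>x\<in>B. representation B (L (b i)) x *\<^sub>R \<theta> i x)"
    by (subst sum.swap) (simp add: mult.commute)
  also have "\<dots> = (\<Sum>i\<in>I. \<theta> i (\<Sum>x\<in>B. representation B (L (b i)) x *\<^sub>R x))"
    by (rule sum.cong[OF refl], rule linear_within_sum[OF T \<theta> fin, symmetric]) (use B(1) in auto)
  also have "\<dots> = (\<Sum>i\<in>I. \<theta> i (L (b i)))"
    by (rule sum.cong[OF refl], subst sum_representation_eq[OF B(2) Lb fin order_refl]) auto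
  finally show ?thesis .
qed

context para_sasakian_frame
begin

text \<open>The deviation from constant curvature -1 is concentrated on ker \<eta>: the second
  summand is the constant curvature tensor of the horizontal projections, times \<kappa> +
  1.\<close>

definition curv :: "'a \<Rightarrow> 'a tvec \<Rightarrow> 'a tvec \<Rightarrow> 'a tvec \<Rightarrow> 'a tvec" where
  "curv q x y z = - (g q y z *\<^sub>R x - g q x z *\<^sub>R y)
    + (\<kappa> q + 1) *\<^sub>R ((g q y z - \<eta> q y * \<eta> q z) *\<^sub>R (x - \<eta> q x *\<^sub>R \<xi> q)
                     - (g q x z - \<eta> q x * \<eta> q z) *\<^sub>R (y - \<eta> q y *\<^sub>R \<xi> q))"

lemma curv_T: "x \<in> T q \<Longrightarrow> y \<in> T q \<Longrightarrow> curv q x y z \<in> T q"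
  unfolding curv_def by (intro T_closed \<xi>_T)

lemma curv_components:
  assumes q: "q \<in> U" and "x \<in> T q" "y \<in> T q" "z \<in> T q"
  shows "\<eta> q (curv q x y z) = - ((c1 q y * c2 q z + c2 q y * c1 q z) * \<eta> q x
      - (c1 q x * c2 q z + c2 q x * c1 q z) * \<eta> q y)"
    "c1 q (curv q x y z) = - (g q y z * c1 q x - g q x z * c1 q y)
      + (\<kappa> q + 1) * ((c1 q y * c2 q z + c2 q y * c1 q z) * c1 q x
        - (c1 q x * c2 q z + c2 q x * c1 q z) * c1 q y)"
    "c2 q (curv q x y z) = - (g q y z * c2 q x - g q x z * c2 q y)
      + (\<kappa> q + 1) * ((c1 q y * c2 q z + c2 q y * c1 q z) * c2 q x
        - (c1 q x * c2 q z + c2 q x * c1 q z) * c2 q y)"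
  unfolding curv_def using assms
  by (simp_all add: linear_simps g_components[OF q assms(3,4)] g_components[OF q assms(2,4)]
      algebra_simps)

lemma curvature_eq:
  assumes X: "vf U X" and Y: "vf U Y" and Z: "vf U Z" and q: "q \<in> U"
  shows "curvature A nabla X Y Z q = curv q (X q) (Y q) (Z q)"
proof (rule tangent_eqI[OF q])
  note XT = vf_tangent[OF X q] vf_tangent[OF Y q] vf_tangent[OF Z q]
  show "curvature A nabla X Y Z q \<in> T q"
    unfolding curvature_def
    by (intro T_closed nabla_T nabla_vf[OF open_U] bracket_vf[OF open_U] X Y Z q)
  show "curv q (X q) (Y q) (Z q) \<in> T q" by (rule curv_T[OF XT(1,2)])
  show "\<eta> q (curvature A nabla X Y Z q) = \<eta> q (curv q (X q) (Y q) (Z q))"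
    "c1 q (curvature A nabla X Y Z q) = c1 q (curv q (X q) (Y q) (Z q))"
    "c2 q (curvature A nabla X Y Z q) = c2 q (curv q (X q) (Y q) (Z q))"
    unfolding curvature_components[OF X Y Z q] curv_components[OF q XT]
      g_components[OF q XT(2,3)] g_components[OF q XT(1,3)] by simp_all
qed

lemma restrict_frame:
  assumes "open U'"
  shows "para_sasakian_frame A \<phi> \<xi> \<eta> g nabla (U \<inter> U') e1 e2"
  by unfold_locales
    (use assms open_U e1_E e2_E g_e1_e2 vf_subset[OF e_vf(1)] vf_subset[OF e_vf(2)] in \<open>auto simp: open_Int\<close>)

text \<open>The fields live on another open set, so the frame is restricted to the intersection. The
  structure functions are pointwise expressions in the frame and do not mention \<open>U\<close>, so
  \<open>curv\<close> is unchanged by this.\<close>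

lemma curvature_eq_local:
  assumes "open U'" "vf U' X" "vf U' Y" "vf U' Z" "q \<in> U" "q \<in> U'"
  shows "curvature A nabla X Y Z q = curv q (X q) (Y q) (Z q)"
proof -
  interpret W: para_sasakian_frame A \<phi> \<xi> \<eta> g nabla "U \<inter> U'" e1 e2
    by (rule restrict_frame[OF assms(1)])
  show ?thesis
    by (rule W.curvature_eq) (use assms vf_subset[of U' _ "U \<inter> U'"] in auto)
qed

lemma extend_vector:
  assumes q: "q \<in> U" and x: "x \<in> T q"
  obtains X where "vf U X" "X q = x"
proof -
  let ?X = "\<lambda>p. \<eta> q x *\<^sub>R \<xi> p + c1 q x *\<^sub>R e1 p + c2 q x *\<^sub>R e2 p"
  have "vf U ?X" by (intro vf_add vf_scale fields smooth_const open_U)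
  then show ?thesis using that[of ?X] expansion[OF q x] by simp
qed

lemma curvature_at_eq:
  assumes q: "q \<in> U" and T: "x \<in> T q" "y \<in> T q" "z \<in> T q"
  shows "curvature_at A nabla q x y z = curv q x y z"
  unfolding curvature_at_def
proof (rule the_equality)
  show "\<forall>U' X Y Z. open U' \<longrightarrow> q \<in> U' \<longrightarrow> vf U' X \<longrightarrow> vf U' Y \<longrightarrow> vf U' Z \<longrightarrow>
      X q = x \<longrightarrow> Y q = y \<longrightarrow> Z q = z \<longrightarrow> curvature A nabla X Y Z q = curv q x y z"
    using curvature_eq_local q by blast
next
  \<comment> \<open>Uniqueness rests on extending the three vectors to fields on \<open>U\<close>:
    without extensions the condition on \<open>v\<close> would be vacuous.\<close>
  fix v assume v: "\<forall>U' X Y Z. open U' \<longrightarrow> q \<in> U' \<longrightarrow> vf U' X \<longrightarrow> vf U' Y \<longrightarrow> vf U' Z \<longrightarrow>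
      X q = x \<longrightarrow> Y q = y \<longrightarrow> Z q = z \<longrightarrow> curvature A nabla X Y Z q = v"
  obtain X where X: "vf U X" "X q = x" using extend_vector[OF q T(1)] .
  obtain Y where Y: "vf U Y" "Y q = y" using extend_vector[OF q T(2)] .
  obtain Z where Z: "vf U Z" "Z q = z" using extend_vector[OF q T(3)] .
  have "curvature A nabla X Y Z q = v"
    by (rule v[rule_format, OF open_U q X(1) Y(1) Z(1) X(2) Y(2) Z(2)])
  then show "v = curv q x y z" using curvature_eq[OF X(1) Y(1) Z(1) q] X(2) Y(2) Z(2) by simp
qed

lemma trace_frame:
  assumes q: "q \<in> U" and L: "linear_within (T q) L" "\<And>x. x \<in> T q \<Longrightarrow> L x \<in> T q"
  shows "trace_on (T q) L = \<eta> q (L (\<xi> q)) + c1 q (L (e1 q)) + c2 q (L (e2 q))"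
proof -
  define b where "b i = [\<xi> q, e1 q, e2 q] ! i" for i
  define \<theta> where "\<theta> i = [\<eta> q, c1 q, c2 q] ! i" for i
  have "trace_on (T q) L = (\<Sum>i<3. \<theta> i (L (b i)))"
  proof (rule trace_on_dual_basis[OF subspace_tangent])
    show "b i \<in> T q" if "i \<in> {..<3}" for i
      using that q by (auto simp: b_def less_Suc_eq numeral_3_eq_3)
    show "linear_within (T q) (\<theta> i)" if "i \<in> {..<3}" for i
      using that q by (auto simp: \<theta>_def linear_within_def linear_simps less_Suc_eq numeral_3_eq_3)
    show "x = (\<Sum>i<3. \<theta> i x *\<^sub>R b i)" if "x \<in> T q" for x
      using expansion[OF q that] by (simp add: numeral_3_eq_3 b_def \<theta>_def)
  qed (use L in auto)
  then show ?thesis by (simp add: numeral_3_eq_3 b_def \<theta>_def)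
qed

text \<open>The coefficient of the horizontal part is \<kappa> + (-1), from ker \<eta> and one plane
  through \<xi>; in direction \<xi> two planes of curvature -1 contribute -2.\<close>

lemma ricci_eq:
  assumes q: "q \<in> U" and x: "x \<in> T q" and y: "y \<in> T q"
  shows "ricci A nabla q x y = (\<kappa> q - 1) * (g q x y - \<eta> q x * \<eta> q y) - 2 * \<eta> q x * \<eta> q y"
proof -
  let ?L = "\<lambda>z. curvature_at A nabla q z x y"
  have L: "?L z = curv q z x y" if "z \<in> T q" for z by (rule curvature_at_eq[OF q that x y])
  have "linear_within (T q) ?L"
    unfolding linear_within_def
    using x y by (auto simp: L curv_def linear_simps algebra_simps)
  then have "ricci A nabla q x y = \<eta> q (?L (\<xi> q)) + c1 q (?L (e1 q)) + c2 q (?L (e2 q))"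
    unfolding ricci_def by (rule trace_frame[OF q]) (simp add: L curv_T x)
  then show ?thesis
    using q x y by (simp add: L curv_components g_components[OF q x y] g_sym[of "e1 q" q y]
        g_sym[of "e2 q" q y] algebra_simps)
qed

lemma scalar_curvature_eq:
  assumes q: "q \<in> U"
  shows "scalar_curvature A g nabla q = 2 * \<kappa> q - 4"
proof -
  \<comment> \<open>The Ricci operator, obtained from \<open>ricci_eq\<close> by raising an index;
    nondegeneracy identifies it with the definite description.\<close>
  let ?Q = "\<lambda>x. (\<kappa> q - 1) *\<^sub>R (x - \<eta> q x *\<^sub>R \<xi> q) - (2 * \<eta> q x) *\<^sub>R \<xi> q"
  let ?L = "\<lambda>x. THE v. v \<in> T q \<and> (\<forall>y\<in>T q. g q v y = ricci A nabla q x y)"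
  have L: "?L x = ?Q x" if x: "x \<in> T q" for x
  proof (rule the_equality)
    have Q: "g q (?Q x) y = ricci A nabla q x y" if y: "y \<in> T q" for y
      using x y by (simp add: ricci_eq[OF q x y] linear_simps algebra_simps)
    have QT: "?Q x \<in> T q" using x by (intro T_closed \<xi>_T)
    show "?Q x \<in> T q \<and> (\<forall>y\<in>T q. g q (?Q x) y = ricci A nabla q x y)" using Q QT by blast
    fix v assume v: "v \<in> T q \<and> (\<forall>y\<in>T q. g q v y = ricci A nabla q x y)"
    have "v - ?Q x = 0"
      by (rule g_nondegenerate[OF T_closed(5)]) (use v QT Q in \<open>auto simp: g_diff_left\<close>)
    then show "v = ?Q x" by simp
  qed
  have "linear_within (T q) ?L"
    unfolding linear_within_def by (auto simp: L linear_simps algebra_simps)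
  then have "trace_on (T q) ?L = \<eta> q (?L (\<xi> q)) + c1 q (?L (e1 q)) + c2 q (?L (e2 q))"
    by (rule trace_frame[OF q]) (simp add: L)
  then show ?thesis unfolding scalar_curvature_def using q by (simp add: L linear_simps)
qed

end

section \<open>Yamabe solitons\<close>

context para_sasakian_frame
begin

text \<open>Frame pairings are constant, so the Lie derivative of the metric on frame fields reduces
  to bracket terms. The six pairs of frame fields then give the six component equations of the
  abstract system.\<close>

lemma soliton_at:
  assumes sol: "yamabe_soliton A g r V l" and r: "\<And>p. r p = scalar_curvature A g nabla p"
    and q: "q \<in> U"
  shows "r q = l" "\<kappa> q \<noteq> -1 \<Longrightarrow> bracket V \<xi> q = 0"
proof -
  have V: "vf U V"
    using sol vf_subset[of UNIV V U] unfolding yamabe_soliton_def by blast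
  have lie: "- g q (bracket V X q) (Y q) - g q (X q) (bracket V Y q) = (l - r q) * g q (X q) (Y q)"
    if q: "q \<in> U" and X: "vf U X" and Y: "vf U Y" and const: "\<And>q. q \<in> U \<Longrightarrow> g q (X q) (Y q) = k"
    for q X Y k
  proof -
    have "lie_deriv2 A V g X Y q = (l - r q) * g q (X q) (Y q)"
      using sol open_U X Y q unfolding yamabe_soliton_def by blast
    then show ?thesis
      using field_const[OF V q, of "\<lambda>q. g q (X q) (Y q)", OF const] by (simp add: lie_deriv2_def)
  qed
  define f u v where "f = (\<lambda>q. \<eta> q (V q))" and "u = (\<lambda>q. c1 q (V q))" and "v = (\<lambda>q. c2 q (V q))"
  define w1 w2 where "w1 = (\<lambda>q. \<xi> q u + a q * u q)" and "w2 = (\<lambda>q. \<xi> q v - a q * v q)"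
  have pt: "\<eta> q (V q) = f q" "c1 q (V q) = u q" "c2 q (V q) = v q" for q
    by (simp_all add: f_def u_def v_def)
  define \<rho> where "\<rho> q = (l - r q) / 2" for q
  have sm: "smooth U f" "smooth U u" "smooth U v"
    unfolding f_def u_def v_def by (rule component_smooth[OF V])+
  \<comment> \<open>The constant \<open>l / 2 + 2\<close> comes from halving \<open>l - r q\<close>
    with r = 2 \<kappa> - 4.\<close>
  have \<rho>: "\<rho> q = (l / 2 + 2) - \<kappa> q" if "q \<in> U" for q
    by (simp add: \<rho>_def r scalar_curvature_eq[OF that] field_simps)
  have BT: "bracket V \<xi> q \<in> T q" "bracket V e1 q \<in> T q" "bracket V e2 q \<in> T q" if "q \<in> U" for q
    by (rule vf_tangent[OF bracket_vf[OF open_U V] that]; fact fields)+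
  \<comment> \<open>Minus signs appear because these are brackets with \<open>V\<close> on the left.
    The terms \<open>w V q\<close> and \<open>f q\<close> occur with opposite signs for
    \<open>e1\<close> and \<open>e2\<close>, so they drop out of the equation for the pair (e1,
    e2).\<close>
  have br: "\<eta> q (bracket V \<xi> q) = - \<xi> q f" "c1 q (bracket V \<xi> q) = - w1 q"
    "c2 q (bracket V \<xi> q) = - w2 q"
    "\<eta> q (bracket V e1 q) = - e1 q f - 2 * v q" "c2 q (bracket V e1 q) = \<alpha> q * v q - e1 q v"
    "c1 q (bracket V e1 q) = w V q - e1 q u - \<alpha> q * u q + f q"
    "\<eta> q (bracket V e2 q) = - e2 q f + 2 * u q" "c1 q (bracket V e2 q) = \<beta> q * u q - e2 q u"
    "c2 q (bracket V e2 q) = - w V q - e2 q v - \<beta> q * v q - f q" if q: "q \<in> U" for q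
    using q by (simp_all add: bracket_components[OF V _ q] fields nabla_components(1)[OF _ V q]
        nabla_components(2)[OF _ V q] nabla_components(3)[OF _ V q]
        nabla_frame_components[OF V q] nabla_frame_general[OF V q]
        w_def[of \<xi>] w_def[of e1] w_def[of e2] w1_def w2_def pt algebra_simps)
  have eqs: "\<xi> q f = \<rho> q" "e1 q f = - 2 * v q - w2 q" "e2 q f = 2 * u q - w1 q"
    "e1 q v = \<alpha> q * v q" "e2 q u = \<beta> q * u q"
    "(e1 q u + \<alpha> q * u q) + (e2 q v + \<beta> q * v q) = 2 * \<rho> q" if q: "q \<in> U" for q
  proof -
    note B = BT[OF q]
    show "\<xi> q f = \<rho> q"
      using lie[OF q fields(1) fields(1), of 1] br[OF q] B q by (simp add: \<rho>_def)
    show "e1 q f = - 2 * v q - w2 q"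
      using lie[OF q fields(1) fields(2), of 0] br[OF q] B q by simp
    show "e2 q f = 2 * u q - w1 q"
      using lie[OF q fields(1) fields(3), of 0] br[OF q] B q by simp
    show "e1 q v = \<alpha> q * v q"
      using lie[OF q fields(2) fields(2), of 0] br[OF q] B q g_sym[OF frame_simps(1)[OF q] B(2)] by simp
    show "e2 q u = \<beta> q * u q"
      using lie[OF q fields(3) fields(3), of 0] br[OF q] B q g_sym[OF frame_simps(2)[OF q] B(3)] by simp
    show "(e1 q u + \<alpha> q * u q) + (e2 q v + \<beta> q * v q) = 2 * \<rho> q"
      using lie[OF q fields(2) fields(3), of 1] br[OF q] B q g_sym[OF frame_simps(1)[OF q] B(3)]
      by (simp add: \<rho>_def)
  qed
  note sol = soliton_components[OF sm \<rho> w1_def w2_def eqs q]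
  show "r q = l" using sol(1) by (simp add: \<rho>_def)
  show "bracket V \<xi> q = 0" if "\<kappa> q \<noteq> -1"
    by (rule tangent_eqI[OF q BT(1)[OF q]])
      (use that sol br(1-3)[OF q] eqs(1)[OF q] q in \<open>auto simp: eq_neg_iff_add_eq_0\<close>)
qed

end

section \<open>From Killing fields to automorphisms, and the global statement\<close>

context para_sasakian_3
begin

text \<open>\<eta> is the metric dual of \<xi>, so it is invariant along with both. The fundamental
  form is the exterior derivative of \<eta>, and Lie derivatives commute with exterior derivatives;
  the latter is carried out here with the Jacobi identity.\<close>

lemma infinitesimal_automorphismI:
  assumes V: "vf UNIV V" and killing: "lie_deriv2_vanishes A V g"
    and \<xi>: "\<And>p. bracket V \<xi> p = 0"
  shows "infinitesimal_automorphism A \<phi> \<xi> \<eta> g V"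
proof -
  have VU: "vf U V" for U by (rule vf_subset[OF V]) simp
  have \<eta>: "V p (\<lambda>q. \<eta> q (X q)) = \<eta> p (bracket V X p)" if U: "open U" "vf U X" "p \<in> U" for U X p
  proof -
    have "lie_deriv2 A V g X \<xi> p = 0"
      using killing U \<xi>_vf_on[of U] unfolding lie_deriv2_vanishes_def by blast
    moreover have "V p (\<lambda>q. g q (X q) (\<xi> q)) = V p (\<lambda>q. \<eta> q (X q))"
      by (rule tangent_cong[OF vf_tangent[OF V UNIV_I] U(1,3)]) (simp add: vf_tangent[OF U(2)])
    ultimately show ?thesis
      using vf_tangent[OF bracket_vf[OF U(1) VU U(2)] U(3)] vf_tangent[OF U(2,3)] \<xi>[of p]
      by (simp add: lie_deriv2_def)
  qed
  have "lie_deriv2 A V (fundamental_form \<phi> g) X Y p = 0"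
    if U: "open U" and X: "vf U X" and Y: "vf U Y" and p: "p \<in> U" for U X Y p
  proof -
    note BX = bracket_vf[OF U VU X] and BY = bracket_vf[OF U VU Y] and B = bracket_vf[OF U X Y]
    note VT = vf_tangent[OF V UNIV_I[of p]]
    have sm: "smooth_at p (\<lambda>q. \<eta> q (Z q))" if "vf U Z" for Z
      by (rule smooth_atI[OF \<eta>_smooth[OF U that] U p])
    have sX: "smooth_at p (\<lambda>q. X q (\<lambda>q. \<eta> q (Y q)))" "smooth_at p (\<lambda>q. Y q (\<lambda>q. \<eta> q (X q)))"
      by (rule vf_smooth_at[OF X U p sm[OF Y]] vf_smooth_at[OF Y U p sm[OF X]])+
    have "smooth_at p (\<lambda>q. g q (X q) (\<phi> q (Y q)))"
      by (rule smooth_atI[OF g_smooth[OF U X \<phi>_vf[OF U Y]] U p])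
    then have "2 * V p (\<lambda>q. g q (X q) (\<phi> q (Y q))) = V p (\<lambda>q. 2 * g q (X q) (\<phi> q (Y q)))"
      by (rule tangent_scale[OF VT, symmetric])
    also have "\<dots> = V p (\<lambda>q. X q (\<lambda>q. \<eta> q (Y q)) - Y q (\<lambda>q. \<eta> q (X q)) - \<eta> q (bracket X Y q))"
      by (rule tangent_cong[OF VT U p]) (rule paracontact[OF U X Y, symmetric])
    also have "\<dots> = V p (\<lambda>q. X q (\<lambda>q. \<eta> q (Y q))) - V p (\<lambda>q. Y q (\<lambda>q. \<eta> q (X q)))
        - V p (\<lambda>q. \<eta> q (bracket X Y q))"
      by (simp only: tangent_diff[OF VT smooth_at_diff[OF sX] sm[OF B]] tangent_diff[OF VT sX])
    finally have 1: "2 * V p (\<lambda>q. g q (X q) (\<phi> q (Y q))) = V p (\<lambda>q. X q (\<lambda>q. \<eta> q (Y q)))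
        - V p (\<lambda>q. Y q (\<lambda>q. \<eta> q (X q))) - \<eta> p (bracket V (bracket X Y) p)"
      using \<eta>[OF U B p] by simp
    \<comment> \<open>Invariance of \<eta> holds on all of \<open>U\<close>, so the inner derivative
      along \<open>V\<close> may be replaced by a bracket before differentiating along
      \<open>X\<close>.\<close>
    have 2: "bracket V X p (\<lambda>q. \<eta> q (Y q)) =
        V p (\<lambda>q. X q (\<lambda>q. \<eta> q (Y q))) - X p (\<lambda>q. \<eta> q (bracket V Y q))"
    proof -
      have "X p (\<lambda>q. V q (\<lambda>q. \<eta> q (Y q))) = X p (\<lambda>q. \<eta> q (bracket V Y q))"
        by (rule tangent_cong[OF vf_tangent[OF X p] U p \<eta>[OF U Y]])
      then show ?thesis using sm[OF Y] by (simp add: lie_bracket_def[of A V X])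
    qed
    have 3: "bracket V Y p (\<lambda>q. \<eta> q (X q)) =
        V p (\<lambda>q. Y q (\<lambda>q. \<eta> q (X q))) - Y p (\<lambda>q. \<eta> q (bracket V X q))"
    proof -
      have "Y p (\<lambda>q. V q (\<lambda>q. \<eta> q (X q))) = Y p (\<lambda>q. \<eta> q (bracket V X q))"
        by (rule tangent_cong[OF vf_tangent[OF Y p] U p \<eta>[OF U X]])
      then show ?thesis using sm[OF X] by (simp add: lie_bracket_def[of A V Y])
    qed
    have neg: "bracket X (bracket Y V) p = - bracket X (bracket V Y) p"
    proof -
      have "bracket X (bracket Y V) p = bracket X (\<lambda>q. (-1) *\<^sub>R bracket V Y q) p"
        by (rule bracket_cong[OF U p X bracket_vf[OF U Y VU] refl]) (simp add: bracket_skew[of Y V])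
      then show ?thesis
        using bracket_scale_right[OF U p X BY smooth_const[OF U, of "-1"]]
          tangent_const[OF vf_tangent[OF X p], of "-1"] by simp
    qed
    have "bracket V (bracket X Y) p = bracket X (bracket V Y) p + bracket (bracket V X) Y p"
      using jacobi[OF U p VU X Y] neg bracket_skew[of "bracket V X" Y p]
      by (simp add: algebra_simps)
    then have 4: "\<eta> p (bracket V (bracket X Y) p) =
        \<eta> p (bracket X (bracket V Y) p) + \<eta> p (bracket (bracket V X) Y p)"
      using vf_tangent[OF bracket_vf[OF U X BY] p] vf_tangent[OF bracket_vf[OF U BX Y] p]
      by (simp add: \<eta>_add)
    show ?thesis
      using 1 2 3 4 paracontact[OF U BX Y p] paracontact[OF U X BY p]
      by (simp add: lie_deriv2_def fundamental_form_def)
  qed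
  then show ?thesis
    using V killing \<xi> \<eta>
    unfolding infinitesimal_automorphism_def lie_deriv2_vanishes_def lie_deriv1_def by simp
qed

lemma frame_at:
  obtains U e1 e2 where "para_sasakian_frame A \<phi> \<xi> \<eta> g nabla U e1 e2" "p \<in> U"
  by (rule exists_frame[OF open_UNIV UNIV_I[of p]]) (rule that; assumption)

text \<open>The local result gives \<open>r p = l\<close> at every point with the same
  \<open>l\<close>, so the soliton equation loses its right side and \<open>V\<close> is Killing
  without any patching.\<close>

lemma yamabe_soliton_rigidity:
  assumes sol: "yamabe_soliton A g r V l" and r: "r = scalar_curvature A g nabla"
  shows "(\<exists>r0. \<forall>p. r p = r0) \<and> killing_field A g V \<and>
    (constant_curvature A g nabla (-1) \<and> einstein_manifold A g nabla
     \<or> infinitesimal_automorphism A \<phi> \<xi> \<eta> g V)"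
proof -
  have r': "r p = scalar_curvature A g nabla p" for p by (simp add: r)
  have r_const: "r p = l" for p
  proof -
    obtain U e1 e2 where "para_sasakian_frame A \<phi> \<xi> \<eta> g nabla U e1 e2" "p \<in> U"
      using frame_at .
    then show ?thesis by (rule para_sasakian_frame.soliton_at(1)[OF _ sol r'])
  qed
  have killing: "killing_field A g V"
    using sol unfolding yamabe_soliton_def killing_field_def lie_deriv2_vanishes_def
    by (simp add: r_const)
  show ?thesis
  \<comment> \<open>By r = 2 \<kappa> - 4 this is the condition \<kappa> = -1, now independent of
    point and frame.\<close>
  proof (cases "l = -6")
    case True
    have "curvature A nabla X Y Z p = - 1 *\<^sub>R (g p (Y p) (Z p) *\<^sub>R X p - g p (X p) (Z p) *\<^sub>R Y p)"
      if U': "open U'" "p \<in> U'" and vf: "vf U' X" "vf U' Y" "vf U' Z" for U' X Y Z p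
    proof -
      obtain U e1 e2 where "para_sasakian_frame A \<phi> \<xi> \<eta> g nabla U e1 e2" "p \<in> U"
        using frame_at .
      then interpret F: para_sasakian_frame A \<phi> \<xi> \<eta> g nabla U e1 e2 by simp
      have "F.\<kappa> p = -1" using F.scalar_curvature_eq[OF \<open>p \<in> U\<close>] r_const[of p] True by (simp add: r)
      then show ?thesis
        using F.curvature_eq_local[OF U'(1) vf \<open>p \<in> U\<close> U'(2)] by (simp add: F.curv_def)
    qed
    \<comment> \<open>The Einstein constant -2 is \<kappa> - 1 at \<kappa> = -1, where it matches
      the coefficient in direction \<xi>.\<close>
    moreover have "ricci A nabla p x y = -2 * g p x y" if "x \<in> T p" "y \<in> T p" for p x y
    proof -
      obtain U e1 e2 where "para_sasakian_frame A \<phi> \<xi> \<eta> g nabla U e1 e2" "p \<in> U"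
        using frame_at .
      then interpret F: para_sasakian_frame A \<phi> \<xi> \<eta> g nabla U e1 e2 by simp
      have "F.\<kappa> p = -1" using F.scalar_curvature_eq[OF \<open>p \<in> U\<close>] r_const[of p] True by (simp add: r)
      then show ?thesis using F.ricci_eq[OF \<open>p \<in> U\<close> that] by simp
    qed
    ultimately have "constant_curvature A g nabla (-1)" "einstein_manifold A g nabla"
      unfolding constant_curvature_def einstein_manifold_def by blast+
    then show ?thesis using r_const killing by blast
  next
    case False
    have "bracket V \<xi> p = 0" for p
    proof -
      obtain U e1 e2 where "para_sasakian_frame A \<phi> \<xi> \<eta> g nabla U e1 e2" "p \<in> U"
        using frame_at .
      then interpret F: para_sasakian_frame A \<phi> \<xi> \<eta> g nabla U e1 e2 by simp
      have "F.\<kappa> p \<noteq> -1" using F.scalar_curvature_eq[OF \<open>p \<in> U\<close>] r_const[of p] False by (auto simp: r)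
      then show ?thesis using F.soliton_at(2)[OF sol r' \<open>p \<in> U\<close>] by simp
    qed
    then have "infinitesimal_automorphism A \<phi> \<xi> \<eta> g V"
      using killing unfolding killing_field_def by (intro infinitesimal_automorphismI) simp_all
    then show ?thesis using r_const killing by blast
  qed
qed

end

theorem theorem1:
  fixes A :: "('a::{t2_space,second_countable_topology}, real^3) atlas"
    and \<phi> :: "'a \<Rightarrow> 'a tvec \<Rightarrow> 'a tvec"
    and \<xi> :: "'a vfield"
    and \<eta> :: "'a \<Rightarrow> 'a tvec \<Rightarrow> real"
    and g :: "'a \<Rightarrow> 'a tvec \<Rightarrow> 'a tvec \<Rightarrow> real"
    and nabla :: "'a vfield \<Rightarrow> 'a vfield \<Rightarrow> 'a vfield"
    and r :: "'a \<Rightarrow> real"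
    and V :: "'a vfield"
    and l :: real
  assumes "connected_manifold A"
    and "para_sasakian A \<phi> \<xi> \<eta> g"
    and "levi_civita A g nabla"
    and "r = scalar_curvature A g nabla"
    and "yamabe_soliton A g r V l"
  shows "(\<exists>r0. \<forall>p. r p = r0) \<and> killing_field A g V \<and>
    (constant_curvature A g nabla (-1) \<and> einstein_manifold A g nabla
     \<or> infinitesimal_automorphism A \<phi> \<xi> \<eta> g V)"
proof -
  interpret para_sasakian_3 A \<phi> \<xi> \<eta> g nabla
    by unfold_locales (use assms(1-3) in \<open>simp_all add: connected_manifold_def\<close>)
  show ?thesis by (rule yamabe_soliton_rigidity[OF assms(5,4)])
qed

end
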